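(* Consider the linear model with unpenalized intercept, $y_i=x_i\beta^*+\sigma^*\xi_i$, $i=1,\dots,n$, with $\sigma^*=1$, and the exp-Lasso estimator $(\hat\beta,\hat\sigma)$ with tuning parameter $\lambda\asymp\sqrt{\log p/n}$ in which the intercept is not penalized, as described in the context. Let $s^*:=\#\{j\ge 2:\beta_j^*\ne0\}$. Assume: (1) $\xi_1,\xi_2,\dots$ are i.i.d. copies of a random variable $\xi$ with known density $f$ (not depending on $n$), $f>0$ everywhere, $l:=-\log f$ is convex and differentiable with derivative $\dot l$, and $|\mathbb E\, l(\xi)|<\infty$, $\mathbb E(\dot l(\xi))^2<\infty$, $\mathbb E(\dot l(\xi)\xi)^2<\infty$. (2) The $x_i$ are non-random and $\max_{i,j}|x_{i,j}|\le K_{\rm x}$, where $K_{\rm x}\ge1$. (3) There is a function $G>0$ with $\mathbb E G^2(\xi)<\infty$ and $\mathbb E G^2(\xi)\xi^4<\infty$ such that for all $M>0$ small enough, $|\dot l(\xi+y)-\dot l(\xi+\tilde y)|\le G(\xi)|y-\tilde y|$ for all $y,\tilde y$ with $|y|\vee|\tilde y|\le (K_{\rm x}+|\xi|)M$. (4) The function $H(c,d):=\mathbb E\, l(d\xi-c)$, $(c,d)\in\mathbb R\times(0,\infty)$, has for $|c|+|d-1|$ small enough a Hessian $\ddot H(c,d)$ which is continuous there, and $\ddot H(0,1)$ is positive definite. Moreover, with $\mathcal H(c,d):=H(c,d)-\log d$ and $\ddot{\mathcal H}$ its Hessian, for some constant $L_{\rm H}$ and all $|c|+|d-1|$ small enough,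 $\|\ddot{\mathcal H}(c,d)-\ddot{\mathcal H}(0,1)\|_\infty\le L_{\rm H}(|c|+|d-1|)$. (5) $p\to\infty$ and $\log p/n\to0$. (6) For some matrix $\Sigma\in\mathbb R^{p\times p}$ with smallest eigenvalue $\Lambda_{\rm x}^2>0$ not depending on $n$, $\max_{j,k}|\hat\Sigma_{j,k}-\Sigma_{j,k}|\lesssim K_{\rm x}^2\sqrt{\log p/n}$. (7) Either $\alpha\in(0,1/2)$ is fixed (not depending on $n$) or $\alpha=1/p$, and $F^{-1}(1-\alpha)\asymp\sqrt{\log p/n}$, where $F$ is the distribution of $\lambda^*$. (8) $s^*\le s_{\max}$, where $1\le s_{\max}\ll\Lambda_{\rm x}^2\sqrt{n/\log p}/K_{\rm x}^2$. (9) $\sum_{i=1}^nx_{i,j}=0$ for $j=2,\dots,p$, and $\min_{2\le j\le p}\|x_j\|_2^2/n\gtrsim1$, where $x_j=(x_{1,j},\dots,x_{n,j})^T$. Let $H_0:\beta^*_{-0}=0$ be true. Then for $1>\eta\gg K_{\rm x}^2\sqrt{\log p/n}$, $$\mathbb P(\hat\beta_{-0}\ne0)\ \ge\ \mathbb P(\lambda^*(1-\eta)>\lambda)+o(1).$$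
   Context: Model: $x_i=(1,x_{i,2},\dots,x_{i,p})\in\mathbb R^p$ is a row vector whose first entry is $1$ (intercept), $y_i=x_i\beta^*+\sigma^*\xi_i$, with $\beta^*\in\mathbb R^p$ an unknown column vector and $\sigma^*>0$. Write $\beta=(\beta_0,\beta_{-0}^T)^T$ where $\beta_0:=\beta_1$ is the intercept and $\beta_{-0}:=(\beta_2,\dots,\beta_p)^T$. $\hat\Sigma:=\frac1n\sum_{i=1}^n x_i^Tx_i$. $R_n(\beta,\sigma):=\frac1n\sum_{i=1}^n\bigl[l\bigl(\frac{y_i-x_i\beta}{\sigma}\bigr)+\log\sigma\bigr]$. Exp-Lasso with unpenalized intercept: $(\hat\beta,\hat\sigma)\in\arg\min_{\beta\in\mathbb R^p,\ \sigma>0}\{\exp[R_n(\beta,\sigma)]+\lambda\|\beta_{-0}\|_1\}$. $\lambda^*:=\bigl\|\frac1n\sum_{i=1}^n\dot l(\xi_i)x_i\bigr\|_\infty\exp\bigl[-\frac1n\sum_{i=1}^n\log f(\xi_i)\bigr]$; $F$ is its distribution function and $F^{-1}$ its quantile function. $\|\cdot\|_\infty$ is the maximum absolute entry of a vector or matrix. Asymptotics: limits are for $n\to\infty$. The quantities $p,x_i,\beta^*,K_{\rm x},\Sigma,s_{\max},\alpha,\eta,\lambda$ may depend on $n$; $f$ (and $L_{\rm H}$) does not. For positive sequences, $u\lesssim v$ (equivalently $v\gtrsim u$) means $\limsup u_n/v_n<\infty$; $u\asymp v$ means $u\lesssim v$ and $v\lesssim u$; $u\ll v$ or $v\gg u$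 means $u_n/v_n\to0$. "For $M$ small enough" means for all $0<M\le M_0$ for some $M_0>0$. *)

theory Defs
  imports
    "HOL-Probability.Probability"
    "HOL-Library.Landau_Symbols"
    "Jordan_Normal_Form.Char_Poly"
begin

no_notation vec_index (infixl "$" 100)

text \<open>
  Indices are 0-based: observations are \<open>i < n\<close>, coordinates are \<open>j < p\<close>, and \<open>j = 0\<close> is
  the intercept.  A vector of length \<open>p\<close> is a function \<open>nat \<Rightarrow> real\<close> of which only the
  values at \<open>j < p\<close> are used, and \<open>x i j\<close> is entry \<open>j\<close> of the row vector \<open>x\<^sub>i\<close>.
\<close>

definition row_mult :: "nat \<Rightarrow> (nat \<Rightarrow> real) \<Rightarrow> (nat \<Rightarrow> real) \<Rightarrow> real" where
  "row_mult p v b = (\<Sum>j<p. v j * b j)"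

definition loss :: "(real \<Rightarrow> real) \<Rightarrow> real \<Rightarrow> real" where
  "loss f u = - ln (f u)"

definition noise :: "(real \<Rightarrow> real) \<Rightarrow> real measure" where
  "noise f = density lborel (\<lambda>u. ennreal (f u))"

definition emp_risk ::
  "(real \<Rightarrow> real) \<Rightarrow> nat \<Rightarrow> nat \<Rightarrow> (nat \<Rightarrow> nat \<Rightarrow> real) \<Rightarrow> (nat \<Rightarrow> real) \<Rightarrow> (nat \<Rightarrow> real) \<Rightarrow> real \<Rightarrow> real" where
  "emp_risk f n p x y b s =
     (1 / real n) * (\<Sum>i<n. loss f ((y i - row_mult p (x i) b) / s) + ln s)"

definition exp_lasso_objective ::
  "(real \<Rightarrow> real) \<Rightarrow> nat \<Rightarrow> nat \<Rightarrow> (nat \<Rightarrow> nat \<Rightarrow> real) \<Rightarrow> (nat \<Rightarrow> real) \<Rightarrow> real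
     \<Rightarrow> (nat \<Rightarrow> real) \<times> real \<Rightarrow> real" where
  "exp_lasso_objective f n p x y lam = (\<lambda>(b, s).
     exp (emp_risk f n p x y b s) + lam * (\<Sum>j\<in>{1..<p}. \<bar>b j\<bar>))"

definition is_exp_lasso ::
  "(real \<Rightarrow> real) \<Rightarrow> nat \<Rightarrow> nat \<Rightarrow> (nat \<Rightarrow> nat \<Rightarrow> real) \<Rightarrow> (nat \<Rightarrow> real) \<Rightarrow> real
     \<Rightarrow> (nat \<Rightarrow> real) \<Rightarrow> real \<Rightarrow> bool" where
  "is_exp_lasso f n p x y lam b s \<longleftrightarrow>
     is_arg_min (exp_lasso_objective f n p x y lam) (\<lambda>(b, s). s > 0) (b, s)"

definition lambda_star ::
  "(real \<Rightarrow> real) \<Rightarrow> nat \<Rightarrow> nat \<Rightarrow> (nat \<Rightarrow> nat \<Rightarrow> real) \<Rightarrow> (nat \<Rightarrow> real) \<Rightarrow> real" where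
  "lambda_star f n p x e =
     Max ((\<lambda>j. \<bar>(1 / real n) * (\<Sum>i<n. deriv (loss f) (e i) * x i j)\<bar>) ` {..<p})
       * exp (- ((1 / real n) * (\<Sum>i<n. ln (f (e i)))))"

definition quantile :: "real measure \<Rightarrow> real \<Rightarrow> real" where
  "quantile D u = Inf {t. u \<le> cdf D t}"

definition gram :: "nat \<Rightarrow> nat \<Rightarrow> (nat \<Rightarrow> nat \<Rightarrow> real) \<Rightarrow> real mat" where
  "gram n p x = mat p p (\<lambda>(j, k). (1 / real n) * (\<Sum>i<n. x i j * x i k))"

definition max_abs_entry :: "real mat \<Rightarrow> real" where
  "max_abs_entry A =
     Max ((\<lambda>(j, k). \<bar>A $$ (j, k)\<bar>) ` ({..<dim_row A} \<times> {..<dim_col A}))"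

definition smallest_eigenvalue :: "real mat \<Rightarrow> real \<Rightarrow> bool" where
  "smallest_eigenvalue A k \<longleftrightarrow> eigenvalue A k \<and> (\<forall>k'. eigenvalue A k' \<longrightarrow> k \<le> k')"

text \<open>A pair \<open>(c, d)\<close> is a vector of \<open>real ^ 2\<close> with \<open>c = z $ 1\<close> and \<open>d = z $ 2\<close>.\<close>

definition risk :: "(real \<Rightarrow> real) \<Rightarrow> real ^ 2 \<Rightarrow> real" where
  "risk f z = (\<integral>u. loss f (z $ 2 * u - z $ 1) \<partial>noise f)"

definition near_truth :: "real \<Rightarrow> (real ^ 2) set" where
  "near_truth \<delta> = {z. \<bar>z $ 1\<bar> + \<bar>z $ 2 - 1\<bar> < \<delta>}"

definition has_hessian :: "(real ^ 2 \<Rightarrow> real) \<Rightarrow> real ^ 2 ^ 2 \<Rightarrow> real ^ 2 \<Rightarrow> bool" where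
  "has_hessian h A z \<longleftrightarrow>
     (\<exists>g. (\<forall>\<^sub>F w in nhds z. GDERIV h w :> g w) \<and> (g has_derivative (\<lambda>v. A *v v)) (at z))"

end

theory Submission
  imports Defs
begin

text \<open>If the penalised coefficients are estimated as zero, then the intercept and the scale
  estimate minimise a convex scalar location-scale risk. Its population version grows
  quadratically around the truth, so the minimiser lies within \<open>\<rho> = sqrt (ln p / n)\<close> of the truth
  with probability tending to one. The stationarity condition for the penalised coefficients
  bounds every residual score correlation by \<open>\<lambda>\<close>. Because the columns are orthogonal to the
  intercept, moving from the fit to the truth changes these correlations only by an empirical
  process of Lipschitz functions over a square of side \<open>\<rho>\<close>; symmetrisation and dyadic chaining
  bound it by \<open>K \<rho> * sqrt (ln p / n)\<close>, which is negligible against \<open>\<eta> \<lambda>\<close>. Hence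
  \<open>\<lambda>\<^sup>* (1 - \<eta>) \<le> \<lambda>\<close> outside an event of vanishing probability.\<close>

section \<open>Maxima of sums of independent variables\<close>

text \<open>The obstacle is that score and envelope have second moments only, while a maximum over
  \<open>p n\<close> coordinates may cost no more than a factor \<open>sqrt (ln p)\<close>. Random
  signs supply the missing exponential moments: pointwise in the data they are bounded through
  \<open>cosh x \<le> exp (x\<^sup>2 / 2)\<close>.

  The radius is constrained from both sides. Loss fluctuations over a square of side
  \<open>\<rho>\<close> are of order \<open>\<rho> * sqrt n\<close>, against a growth of order
  \<open>n * \<rho>\<^sup>2\<close>, so \<open>\<rho> * sqrt n\<close> must diverge; and
  \<open>K\<^sup>2 * \<rho>\<close> must be negligible against \<open>\<eta>\<close>. The choice
  \<open>sqrt (ln p / n)\<close> does both.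

  The exponential in the objective makes the stationarity condition bound the score correlation
  times the exponential of the fitted risk, while \<open>lambda_star\<close> carries the risk at the
  truth. Exchanging the two costs a factor \<open>1 + 4 * \<rho>\<close>, paid out of
  \<open>\<eta>\<close>. Moreover \<open>lambda_star\<close> contains the unpenalised intercept
  coordinate, about which the penalty says nothing: its score sum has mean zero and order
  \<open>sqrt n\<close>, smaller than \<open>n * lam\<close> by a factor
  \<open>sqrt (ln p)\<close>.\<close>

lemma cosh_le_exp_square_half: "cosh (x::real) \<le> exp (x\<^sup>2 / 2)"
proof -
  have S1: "(\<lambda>n. x ^ (2 * n) /\<^sub>R fact (2 * n)) sums cosh x"
  proof -
    have "(\<lambda>n. (\<lambda>n. if even n then x ^ n /\<^sub>R fact n else 0) (2 * n)) sums cosh x"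
      by (rule sums_mono_reindex[THEN iffD2, OF _ _ cosh_converges]) (auto simp: strict_mono_def elim!: evenE)
    then show ?thesis by simp
  qed
  have S2: "(\<lambda>n. (x\<^sup>2 / 2) ^ n /\<^sub>R fact n) sums exp (x\<^sup>2 / 2)"
    by (rule exp_converges)
  have "x ^ (2 * n) /\<^sub>R fact (2 * n) \<le> (x\<^sup>2 / 2) ^ n /\<^sub>R fact n" for n
  proof -
    \<comment> \<open>The two power series are compared term by term, which reduces to this
      factorial inequality.\<close>
    have fl: "2 ^ n * fact n \<le> (fact (2 * n) :: real)"
    proof (induction n)
      case (Suc n)
      have "2 ^ Suc n * fact (Suc n) = (2 * real (Suc n)) * (2 ^ n * fact n)" by simp
      also have "\<dots> \<le> (2 * real (Suc n)) * fact (2 * n)"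
        by (rule mult_left_mono[OF Suc]) simp
      also have "\<dots> \<le> (real (2 * n + 2) * real (2 * n + 1)) * fact (2 * n)"
        by (rule mult_right_mono) (auto simp: algebra_simps)
      also have "\<dots> = fact (2 * Suc n)" by (simp add: algebra_simps)
      finally show ?case .
    qed simp
    have "x ^ (2 * n) / fact (2 * n) \<le> x ^ (2 * n) / (2 ^ n * fact n)"
      by (rule divide_left_mono[OF fl]) (auto simp: zero_le_even_power)
    also have "\<dots> = (x\<^sup>2 / 2) ^ n / fact n"
      by (simp add: power_mult power_divide)
    finally show ?thesis
      by (simp only: real_scaleR_def divide_real_def mult.commute[of "inverse (fact _)"])
  qed
  then show ?thesis
    by (intro sums_le[OF _ S1 S2])
qed

context
  fixes N :: "'a measure" and T :: "'t set"
  assumes N: "prob_space N" and T: "finite T" "T \<noteq> {}"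
begin

text \<open>Since \<open>a + X\<close> is the midpoint of \<open>a + 2 X\<close> and \<open>a = a - E (2 X)\<close>, Jensen's inequality
  introduces the random sign without an independent copy of \<open>X\<close>.\<close>

lemma symmetrization_step:
  fixes \<phi> :: "'t \<Rightarrow> 'a \<Rightarrow> real"
  assumes int: "\<And>t. t \<in> T \<Longrightarrow> integrable N (\<phi> t)" "\<And>t. t \<in> T \<Longrightarrow> (\<integral>u. \<phi> t u \<partial>N) = 0"
  shows "(\<integral>\<^sup>+u. (SUP t\<in>T. ennreal \<bar>a t + \<phi> t u\<bar>) \<partial>N) \<le>
    (\<integral>\<^sup>+u. ennreal (1/2) * (SUP t\<in>T. ennreal \<bar>a t + 2 * \<phi> t u\<bar>)
      + ennreal (1/2) * (SUP t\<in>T. ennreal \<bar>a t - 2 * \<phi> t u\<bar>) \<partial>N)"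
proof -
  interpret N: prob_space N by (rule N)
  have [measurable]: "t \<in> T \<Longrightarrow> \<phi> t \<in> borel_measurable N" for t
    using int(1) by blast
  have [simp]: "countable T" using T by (simp add: countable_finite)
  have base: "(SUP t\<in>T. ennreal \<bar>a t\<bar>) \<le> (\<integral>\<^sup>+u. (SUP t\<in>T. ennreal \<bar>a t - 2 * \<phi> t u\<bar>) \<partial>N)"
  proof (rule SUP_least)
    fix t assume t: "t \<in> T"
    have "a t = (\<integral>u. a t - 2 * \<phi> t u \<partial>N)"
      using int[OF t] by (simp add: N.prob_space)
    then have "ennreal \<bar>a t\<bar> = ennreal (norm (\<integral>u. a t - 2 * \<phi> t u \<partial>N))"
      by simp
    also have "\<dots> \<le> (\<integral>\<^sup>+u. norm (a t - 2 * \<phi> t u) \<partial>N)"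
      using int[OF t] by (intro integral_norm_bound_ennreal) auto
    also have "\<dots> \<le> (\<integral>\<^sup>+u. (SUP t\<in>T. ennreal \<bar>a t - 2 * \<phi> t u\<bar>) \<partial>N)"
      using t by (intro nn_integral_mono) (auto intro: SUP_upper2)
    finally show "ennreal \<bar>a t\<bar> \<le> (\<integral>\<^sup>+u. (SUP t\<in>T. ennreal \<bar>a t - 2 * \<phi> t u\<bar>) \<partial>N)" .
  qed
  have pt: "(SUP t\<in>T. ennreal \<bar>a t + \<phi> t u\<bar>) \<le>
      ennreal (1/2) * (SUP t\<in>T. ennreal \<bar>a t + 2 * \<phi> t u\<bar>) + ennreal (1/2) * (SUP t\<in>T. ennreal \<bar>a t\<bar>)" for u
  proof (rule SUP_least)
    fix t assume t: "t \<in> T"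
    have "ennreal \<bar>a t + \<phi> t u\<bar> \<le> ennreal (1/2 * \<bar>a t + 2 * \<phi> t u\<bar> + 1/2 * \<bar>a t\<bar>)"
      by (intro ennreal_leI) (simp add: abs_if field_simps; linarith)
    also have "\<dots> = ennreal (1/2) * ennreal \<bar>a t + 2 * \<phi> t u\<bar> + ennreal (1/2) * ennreal \<bar>a t\<bar>"
      by (simp only: ennreal_plus ennreal_mult' abs_ge_zero zero_le_mult_iff zero_le_divide_1_iff zero_le_numeral simp_thms)
    also have "\<dots> \<le> ennreal (1/2) * (SUP t\<in>T. ennreal \<bar>a t + 2 * \<phi> t u\<bar>) + ennreal (1/2) * (SUP t\<in>T. ennreal \<bar>a t\<bar>)"
      using t by (intro add_mono mult_left_mono) (auto intro: SUP_upper2)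
    finally show "ennreal \<bar>a t + \<phi> t u\<bar> \<le> \<dots>" .
  qed
  have "(\<integral>\<^sup>+u. (SUP t\<in>T. ennreal \<bar>a t + \<phi> t u\<bar>) \<partial>N) \<le>
      (\<integral>\<^sup>+u. ennreal (1/2) * (SUP t\<in>T. ennreal \<bar>a t + 2 * \<phi> t u\<bar>) + ennreal (1/2) * (SUP t\<in>T. ennreal \<bar>a t\<bar>) \<partial>N)"
    by (intro nn_integral_mono pt)
  also have "\<dots> = (\<integral>\<^sup>+u. ennreal (1/2) * (SUP t\<in>T. ennreal \<bar>a t + 2 * \<phi> t u\<bar>) \<partial>N) + ennreal (1/2) * (SUP t\<in>T. ennreal \<bar>a t\<bar>)"
    by (subst nn_integral_add) (auto simp: N.emeasure_space_1)
  also have "\<dots> \<le> (\<integral>\<^sup>+u. ennreal (1/2) * (SUP t\<in>T. ennreal \<bar>a t + 2 * \<phi> t u\<bar>) \<partial>N)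
     + ennreal (1/2) * (\<integral>\<^sup>+u. (SUP t\<in>T. ennreal \<bar>a t - 2 * \<phi> t u\<bar>) \<partial>N)"
    by (intro add_mono mult_left_mono base) auto
  also have "\<dots> = (\<integral>\<^sup>+u. ennreal (1/2) * (SUP t\<in>T. ennreal \<bar>a t + 2 * \<phi> t u\<bar>)
      + ennreal (1/2) * (SUP t\<in>T. ennreal \<bar>a t - 2 * \<phi> t u\<bar>) \<partial>N)"
    by (simp add: nn_integral_add nn_integral_cmult)
  finally show ?thesis .
qed

text \<open>\<open>ennreal\<close> sends negative reals to zero, so the bounds of the following
  induction may be averaged inside \<open>ennreal\<close> only once they are known to be
  nonnegative. As \<open>T\<close> is nonempty, the sum is at least 1, and
  \<open>ln q \<ge> 1 - 1 / q\<close>.\<close>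

lemma ln_exp_bound_nonneg:
  fixes a :: "'t \<Rightarrow> real"
  assumes "q > 0"
  shows "0 \<le> ln q - 1 + (\<Sum>t\<in>T. 2 * cosh (a t)) / q"
proof -
  obtain t where t: "t \<in> T" using T by blast
  have "1 \<le> 2 * cosh (a t)" using cosh_real_ge_1[of "a t"] by linarith
  also have "\<dots> \<le> (\<Sum>t\<in>T. 2 * cosh (a t))"
    using T t by (intro member_le_sum) auto
  finally have "1 / q \<le> (\<Sum>t\<in>T. 2 * cosh (a t)) / q"
    using assms by (intro divide_right_mono) auto
  moreover have "- ln q \<le> 1 / q - 1"
    using ln_le_minus_one[of "1 / q"] assms by (simp add: ln_div)
  ultimately show ?thesis by linarith
qed

text \<open>The variable \<open>q\<close> parametrises the tangents of the logarithm, so that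
  \<open>\<theta> x \<le> ln q - 1 + exp (\<theta> x) / q\<close>; letting \<open>q\<close> absorb the factor
  \<open>exp (2 (\<theta> c V u)\<^sup>2)\<close> at every step linearises the exponential moments, and only the
  second moment of \<open>V\<close> is needed.\<close>

lemma expectation_max_sum_aux:
  fixes \<phi> :: "'t \<Rightarrow> nat \<Rightarrow> 'a \<Rightarrow> real" and V :: "'a \<Rightarrow> real"
  assumes [measurable]: "\<And>t i. t \<in> T \<Longrightarrow> \<phi> t i \<in> borel_measurable N"
    and V: "V \<in> borel_measurable N" "integrable N (\<lambda>u. (V u)\<^sup>2)"
    and mean: "\<And>t i. t \<in> T \<Longrightarrow> (\<integral>u. \<phi> t i u \<partial>N) = 0"
    and bound: "\<And>t i u. t \<in> T \<Longrightarrow> u \<in> space N \<Longrightarrow> \<bar>\<phi> t i u\<bar> \<le> c * V u"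
    and \<theta>: "\<theta> > 0" and q: "q > 0"
  shows "(\<integral>\<^sup>+\<omega>. (SUP t\<in>T. ennreal \<bar>a t + (\<Sum>i<n. \<phi> t i (\<omega> i))\<bar>) \<partial>PiM {..<n} (\<lambda>_. N)) \<le>
    ennreal ((ln q - 1 + (\<Sum>t\<in>T. 2 * cosh (\<theta> * a t)) / q + real n * (2 * \<theta>\<^sup>2 * c\<^sup>2 * (\<integral>u. (V u)\<^sup>2 \<partial>N))) / \<theta>)"
  using q
proof (induction n arbitrary: a q)
  case 0
  have "(SUP t\<in>T. ennreal \<bar>a t\<bar>) \<le> ennreal ((ln q - 1 + (\<Sum>t\<in>T. 2 * cosh (\<theta> * a t)) / q) / \<theta>)"
  proof (rule SUP_least)
    fix t assume t: "t \<in> T"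
    \<comment> \<open>One sum of \<open>2 * cosh\<close> over \<open>T\<close> dominates the
      exponential of every index with either sign.\<close>
    have "exp \<bar>\<theta> * a t\<bar> \<le> 2 * cosh (\<theta> * a t)"
      by (auto simp: cosh_def abs_if)
    also have "\<dots> \<le> (\<Sum>t\<in>T. 2 * cosh (\<theta> * a t))"
      using T t by (intro member_le_sum) auto
    finally have le: "exp \<bar>\<theta> * a t\<bar> / q \<le> (\<Sum>t\<in>T. 2 * cosh (\<theta> * a t)) / q"
      using 0 by (intro divide_right_mono) auto
    have "\<bar>\<theta> * a t\<bar> - ln q \<le> exp \<bar>\<theta> * a t\<bar> / q - 1"
      using ln_le_minus_one[of "exp \<bar>\<theta> * a t\<bar> / q"] 0 by (simp add: ln_div)
    with le have "\<theta> * \<bar>a t\<bar> \<le> ln q - 1 + (\<Sum>t\<in>T. 2 * cosh (\<theta> * a t)) / q"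
      using \<theta> by (simp add: abs_mult)
    then show "ennreal \<bar>a t\<bar> \<le> ennreal ((ln q - 1 + (\<Sum>t\<in>T. 2 * cosh (\<theta> * a t)) / q) / \<theta>)"
      using \<theta> by (intro ennreal_leI) (simp add: field_simps)
  qed
  then show ?case by (simp add: PiM_empty nn_integral_count_space_finite)
next
  case (Suc n)
  interpret N: prob_space N by (rule N)
  interpret PS: product_sigma_finite "\<lambda>_::nat. N" by standard
  interpret Pn: prob_space "PiM {..<n} (\<lambda>_. N)" by (rule prob_space_PiM) (rule N)
  interpret Q: pair_sigma_finite "PiM {..<n} (\<lambda>_. N)" N by standard
  have [simp]: "countable T" using T by (simp add: countable_finite)
  define s where "s u = 2 * \<theta>\<^sup>2 * c\<^sup>2 * (V u)\<^sup>2" for u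
  define \<sigma> where "\<sigma> = 2 * \<theta>\<^sup>2 * c\<^sup>2 * (\<integral>u. (V u)\<^sup>2 \<partial>N)"
  define A where "A = (\<Sum>t\<in>T. 2 * cosh (\<theta> * a t))"
  note V(1)[measurable]
  have [measurable]: "s \<in> borel_measurable N" unfolding s_def by measurable
  have s_nn: "0 \<le> s u" for u by (simp add: s_def)
  have s_int: "integrable N s" "(\<integral>u. s u \<partial>N) = \<sigma>"
    using V(2) by (simp_all add: s_def[abs_def] \<sigma>_def)
  have \<sigma>_nn: "0 \<le> \<sigma>" by (simp add: \<sigma>_def)
  have Vint: "integrable N V"
    using N.square_integrable_imp_integrable[OF V] .
  have \<phi>int: "integrable N (\<phi> t i)" if "t \<in> T" for t i
    by (rule Bochner_Integration.integrable_bound[OF integrable_mult_right[OF Vint, of c]])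
       (use bound[OF that] that in \<open>auto intro!: AE_I2 order_trans[OF bound]\<close>)
  define F where "F b = (\<integral>\<^sup>+\<omega>. (SUP t\<in>T. ennreal \<bar>b t + (\<Sum>i<n. \<phi> t i (\<omega> i))\<bar>) \<partial>PiM {..<n} (\<lambda>_. N))" for b
  have meas: "(\<lambda>\<omega>. SUP t\<in>T. ennreal \<bar>a t + (\<Sum>i<Suc n. \<phi> t i (\<omega> i))\<bar>) \<in> borel_measurable (PiM (insert n {..<n}) (\<lambda>_. N))"
    by measurable auto
  have "(\<integral>\<^sup>+\<omega>. (SUP t\<in>T. ennreal \<bar>a t + (\<Sum>i<Suc n. \<phi> t i (\<omega> i))\<bar>) \<partial>PiM {..<Suc n} (\<lambda>_. N))
      = (\<integral>\<^sup>+\<omega>. (\<integral>\<^sup>+u. (SUP t\<in>T. ennreal \<bar>a t + (\<Sum>i<Suc n. \<phi> t i ((fun_upd \<omega> n u) i))\<bar>) \<partial>N) \<partial>PiM {..<n} (\<lambda>_. N))"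
    unfolding lessThan_Suc by (rule PS.product_nn_integral_insert) (use meas in \<open>auto simp: lessThan_Suc\<close>)
  also have "\<dots> = (\<integral>\<^sup>+\<omega>. (\<integral>\<^sup>+u. (SUP t\<in>T. ennreal \<bar>(a t + (\<Sum>i<n. \<phi> t i (\<omega> i))) + \<phi> t n u\<bar>) \<partial>N) \<partial>PiM {..<n} (\<lambda>_. N))"
    by (intro nn_integral_cong SUP_cong refl arg_cong[where f=ennreal] arg_cong[where f=abs]) (simp add: add.assoc)
  also have "\<dots> \<le> (\<integral>\<^sup>+\<omega>. (\<integral>\<^sup>+u. ennreal (1/2) * (SUP t\<in>T. ennreal \<bar>(a t + (\<Sum>i<n. \<phi> t i (\<omega> i))) + 2 * \<phi> t n u\<bar>)
      + ennreal (1/2) * (SUP t\<in>T. ennreal \<bar>(a t + (\<Sum>i<n. \<phi> t i (\<omega> i))) - 2 * \<phi> t n u\<bar>) \<partial>N) \<partial>PiM {..<n} (\<lambda>_. N))"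
    by (intro nn_integral_mono symmetrization_step \<phi>int mean)
  \<comment> \<open>With the last variable outside, the shifted offsets are constants for each fixed
    \<open>u\<close>. The induction hypothesis is general in \<open>a\<close> and \<open>q\<close>,
    so it applies with a \<open>q\<close> that depends on \<open>u\<close>.\<close>
  also have "\<dots> = (\<integral>\<^sup>+u. (\<integral>\<^sup>+\<omega>. ennreal (1/2) * (SUP t\<in>T. ennreal \<bar>(a t + (\<Sum>i<n. \<phi> t i (\<omega> i))) + 2 * \<phi> t n u\<bar>)
      + ennreal (1/2) * (SUP t\<in>T. ennreal \<bar>(a t + (\<Sum>i<n. \<phi> t i (\<omega> i))) - 2 * \<phi> t n u\<bar>) \<partial>PiM {..<n} (\<lambda>_. N)) \<partial>N)"
    by (rule Q.Fubini'[symmetric]) measurable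
  also have "\<dots> = (\<integral>\<^sup>+u. ennreal (1/2) * F (\<lambda>t. a t + 2 * \<phi> t n u) + ennreal (1/2) * F (\<lambda>t. a t - 2 * \<phi> t n u) \<partial>N)"
  proof (rule nn_integral_cong)
    fix u assume "u \<in> space N"
    have e: "a t + S + 2 * \<phi> t n u = a t + 2 * \<phi> t n u + S" "a t + S - 2 * \<phi> t n u = a t - 2 * \<phi> t n u + S" for t S
      by simp_all
    show "(\<integral>\<^sup>+\<omega>. ennreal (1/2) * (SUP t\<in>T. ennreal \<bar>(a t + (\<Sum>i<n. \<phi> t i (\<omega> i))) + 2 * \<phi> t n u\<bar>)
      + ennreal (1/2) * (SUP t\<in>T. ennreal \<bar>(a t + (\<Sum>i<n. \<phi> t i (\<omega> i))) - 2 * \<phi> t n u\<bar>) \<partial>PiM {..<n} (\<lambda>_. N))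
      = ennreal (1/2) * F (\<lambda>t. a t + 2 * \<phi> t n u) + ennreal (1/2) * F (\<lambda>t. a t - 2 * \<phi> t n u)"
      unfolding F_def e by (subst nn_integral_add; (measurable; fail)?) (simp add: nn_integral_cmult)
  qed
  also have "\<dots> \<le> (\<integral>\<^sup>+u. ennreal ((ln q - 1 + s u + A / q + real n * \<sigma>) / \<theta>) \<partial>N)"
  proof (rule nn_integral_mono)
    fix u assume u: "u \<in> space N"
    define q' where "q' = q * exp (s u)"
    have q': "q' > 0" using Suc.prems by (simp add: q'_def)
    define B1 where "B1 = (\<Sum>t\<in>T. 2 * cosh (\<theta> * (a t + 2 * \<phi> t n u)))"
    define B2 where "B2 = (\<Sum>t\<in>T. 2 * cosh (\<theta> * (a t - 2 * \<phi> t n u)))"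
    \<comment> \<open>Averaging the two signs turns the addition formula into a product of two
      \<open>cosh\<close> factors; the second is at most \<open>exp (s u)\<close>, which is the
      factor by which \<open>q'\<close> exceeds \<open>q\<close>.\<close>
    have "(B1 + B2) / 2 = (\<Sum>t\<in>T. 2 * cosh (\<theta> * a t) * cosh (2 * \<theta> * \<phi> t n u))"
      unfolding B1_def B2_def sum.distrib[symmetric] sum_divide_distrib
      by (intro sum.cong refl) (simp add: distrib_left right_diff_distrib cosh_add cosh_diff mult_ac)
    also have "\<dots> \<le> (\<Sum>t\<in>T. 2 * cosh (\<theta> * a t) * exp (s u))"
    proof (intro sum_mono mult_left_mono)
      fix t assume t: "t \<in> T"
      have "cosh (2 * \<theta> * \<phi> t n u) \<le> exp ((2 * \<theta> * \<phi> t n u)\<^sup>2 / 2)"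
        by (rule cosh_le_exp_square_half)
      also have "(\<phi> t n u)\<^sup>2 \<le> (c * V u)\<^sup>2"
        using bound[OF t u, of n] by (metis abs_ge_zero order_trans power2_abs power_mono)
      then have "(2 * \<theta> * \<phi> t n u)\<^sup>2 / 2 \<le> s u"
        unfolding s_def by (simp add: power_mult_distrib mult_left_mono)
      finally show "cosh (2 * \<theta> * \<phi> t n u) \<le> exp (s u)" by simp
    qed auto
    also have "\<dots> = A * exp (s u)" by (simp add: A_def sum_distrib_right)
    finally have "(B1 + B2) / 2 / q' \<le> A * exp (s u) / q'"
      using q' by (intro divide_right_mono) auto
    then have B: "(B1 + B2) / 2 / q' \<le> A / q"
      by (simp add: q'_def)
    have lnq: "ln q' = ln q + s u" using Suc.prems unfolding q'_def by (subst ln_mult) auto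
    define R1 where "R1 = (ln q' - 1 + B1 / q' + real n * \<sigma>) / \<theta>"
    define R2 where "R2 = (ln q' - 1 + B2 / q' + real n * \<sigma>) / \<theta>"
    have R: "0 \<le> R1" "0 \<le> R2"
      using ln_exp_bound_nonneg[OF q', of "\<lambda>t. \<theta> * (a t + 2 * \<phi> t n u)"]
        ln_exp_bound_nonneg[OF q', of "\<lambda>t. \<theta> * (a t - 2 * \<phi> t n u)"] \<theta> \<sigma>_nn
      by (simp_all add: R1_def R2_def B1_def B2_def)
    have "ennreal (1/2) * F (\<lambda>t. a t + 2 * \<phi> t n u) + ennreal (1/2) * F (\<lambda>t. a t - 2 * \<phi> t n u)
       \<le> ennreal (1/2) * ennreal R1 + ennreal (1/2) * ennreal R2"
      unfolding F_def R1_def R2_def B1_def B2_def \<sigma>_def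
      by (intro add_mono mult_left_mono Suc.IH q') auto
    also have "\<dots> = ennreal ((R1 + R2) / 2)"
      using R by (subst (1 2) ennreal_mult'[symmetric]) (auto simp: ennreal_plus[symmetric] add_divide_distrib simp del: ennreal_plus)
    also have "(R1 + R2) / 2 = (ln q - 1 + s u + (B1 + B2) / 2 / q' + real n * \<sigma>) / \<theta>"
      unfolding R1_def R2_def lnq by (simp add: add_divide_distrib diff_divide_distrib mult_ac)
    also have "ennreal \<dots> \<le> ennreal ((ln q - 1 + s u + A / q + real n * \<sigma>) / \<theta>)"
      using B \<theta> by (intro ennreal_leI divide_right_mono) auto
    finally show "ennreal (1/2) * F (\<lambda>t. a t + 2 * \<phi> t n u) + ennreal (1/2) * F (\<lambda>t. a t - 2 * \<phi> t n u)
       \<le> ennreal ((ln q - 1 + s u + A / q + real n * \<sigma>) / \<theta>)" .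
  qed
  also have "\<dots> = ennreal (\<integral>u. (ln q - 1 + s u + A / q + real n * \<sigma>) / \<theta> \<partial>N)"
  proof (intro nn_integral_eq_integral AE_I2 divide_nonneg_nonneg)
    fix u
    have "0 \<le> ln q - 1 + A / q"
      unfolding A_def by (rule ln_exp_bound_nonneg[OF Suc.prems])
    moreover have "0 \<le> real n * \<sigma>" using \<sigma>_nn by simp
    ultimately show "0 \<le> ln q - 1 + s u + A / q + real n * \<sigma>"
      using s_nn[of u] by linarith
  qed (use \<theta> s_int in auto)
  also have "(\<integral>u. (ln q - 1 + s u + A / q + real n * \<sigma>) / \<theta> \<partial>N) = (ln q - 1 + A / q + real (Suc n) * \<sigma>) / \<theta>"
  proof -
    have e: "(ln q - 1 + s u + A / q + real n * \<sigma>) / \<theta> = s u / \<theta> + (ln q - 1 + A / q + real n * \<sigma>) / \<theta>" for u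
      by (simp add: add_divide_distrib[symmetric])
    have "(\<integral>u. s u / \<theta> + (ln q - 1 + A / q + real n * \<sigma>) / \<theta> \<partial>N) = \<sigma> / \<theta> + (ln q - 1 + A / q + real n * \<sigma>) / \<theta>"
      using s_int by (subst Bochner_Integration.integral_add) (auto simp: N.prob_space)
    also have "\<dots> = (ln q - 1 + A / q + real (Suc n) * \<sigma>) / \<theta>"
      by (simp add: add_divide_distrib[symmetric] distrib_right)
    finally show ?thesis unfolding e .
  qed
  finally show ?case unfolding A_def \<sigma>_def .
qed

lemma expectation_max_sum:
  fixes \<phi> :: "'t \<Rightarrow> nat \<Rightarrow> 'a \<Rightarrow> real" and V :: "'a \<Rightarrow> real"
  assumes "\<And>t i. t \<in> T \<Longrightarrow> \<phi> t i \<in> borel_measurable N"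
    and "V \<in> borel_measurable N" "integrable N (\<lambda>u. (V u)\<^sup>2)"
    and "\<And>t i. t \<in> T \<Longrightarrow> (\<integral>u. \<phi> t i u \<partial>N) = 0"
    and "\<And>t i u. t \<in> T \<Longrightarrow> u \<in> space N \<Longrightarrow> \<bar>\<phi> t i u\<bar> \<le> c * V u"
    and v: "(\<integral>u. (V u)\<^sup>2 \<partial>N) \<le> v" "v > 0" and c: "c > 0" and n: "n > 0"
  shows "(\<integral>\<^sup>+\<omega>. (SUP t\<in>T. ennreal \<bar>\<Sum>i<n. \<phi> t i (\<omega> i)\<bar>) \<partial>PiM {..<n} (\<lambda>_. N)) \<le>
    ennreal (3 * c * sqrt (real n * v * ln (2 * real (card T))))"
proof -
  define L where "L = ln (2 * real (card T))"
  have "card T > 0" using T by (simp add: card_gt_0_iff)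
  then have card: "2 * real (card T) > 1" by linarith
  then have L: "L > 0" unfolding L_def by simp
  define w where "w = real n * v"
  have w: "w > 0" using v n by (simp add: w_def)
  \<comment> \<open>With zero offsets and \<open>q = 2 * real (card T)\<close> the entropy term is
    \<open>L\<close>. This \<open>\<theta>\<close> makes the variance term \<open>L\<close> as well,
    so the bound is \<open>2 * L / \<theta> = 2 * sqrt 2 * c * sqrt (w * L)\<close>; the constant 3
    rounds up \<open>2 * sqrt 2\<close>.\<close>
  define \<theta> where "\<theta> = sqrt (L / (2 * c\<^sup>2 * w))"
  have \<theta>: "\<theta> > 0" using L w c by (simp add: \<theta>_def)
  have \<theta>2: "\<theta>\<^sup>2 = L / (2 * c\<^sup>2 * w)" using L w c by (simp add: \<theta>_def)
  have "(\<integral>\<^sup>+\<omega>. (SUP t\<in>T. ennreal \<bar>0 + (\<Sum>i<n. \<phi> t i (\<omega> i))\<bar>) \<partial>PiM {..<n} (\<lambda>_. N)) \<le>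
    ennreal ((ln (2 * real (card T)) - 1 + (\<Sum>t\<in>T. 2 * cosh (\<theta> * 0)) / (2 * real (card T))
      + real n * (2 * \<theta>\<^sup>2 * c\<^sup>2 * (\<integral>u. (V u)\<^sup>2 \<partial>N))) / \<theta>)"
    by (rule expectation_max_sum_aux) (use assms \<theta> card in auto)
  also have "\<dots> \<le> ennreal (3 * c * sqrt (w * L))"
  proof (rule ennreal_leI)
    have "ln (2 * real (card T)) - 1 + (\<Sum>t\<in>T. 2 * cosh (\<theta> * 0)) / (2 * real (card T)) = L"
      using card by (simp add: L_def)
    moreover have "real n * (2 * \<theta>\<^sup>2 * c\<^sup>2 * (\<integral>u. (V u)\<^sup>2 \<partial>N)) \<le> real n * (2 * \<theta>\<^sup>2 * c\<^sup>2 * v)"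
      using v by (intro mult_left_mono) auto
    moreover have "\<dots> = L" using w c n v by (simp add: \<theta>2 w_def)
    ultimately have "(ln (2 * real (card T)) - 1 + (\<Sum>t\<in>T. 2 * cosh (\<theta> * 0)) / (2 * real (card T))
      + real n * (2 * \<theta>\<^sup>2 * c\<^sup>2 * (\<integral>u. (V u)\<^sup>2 \<partial>N))) / \<theta> \<le> 2 * L / \<theta>"
      using \<theta> by (intro divide_right_mono) auto
    also have "\<dots> \<le> 3 * c * sqrt (w * L)"
    proof -
      have "(3 * c * sqrt (w * L) * \<theta>)\<^sup>2 = 9 / 2 * L\<^sup>2"
        using w L c by (simp add: power_mult_distrib \<theta>2 field_simps) (simp add: power2_eq_square)
      moreover have "(2 * L)\<^sup>2 \<le> 9 / 2 * L\<^sup>2"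
        by (simp add: power_mult_distrib)
      ultimately have "(2 * L)\<^sup>2 \<le> (3 * c * sqrt (w * L) * \<theta>)\<^sup>2"
        by linarith
      then have "2 * L \<le> 3 * c * sqrt (w * L) * \<theta>"
        by (rule power2_le_imp_le) (use w L c \<theta> in auto)
      then show ?thesis using \<theta> by (simp add: field_simps)
    qed
    finally show "(ln (2 * real (card T)) - 1 + (\<Sum>t\<in>T. 2 * cosh (\<theta> * 0)) / (2 * real (card T))
      + real n * (2 * \<theta>\<^sup>2 * c\<^sup>2 * (\<integral>u. (V u)\<^sup>2 \<partial>N))) / \<theta> \<le> 3 * c * sqrt (w * L)" .
  qed
  finally show ?thesis by (simp add: w_def L_def)
qed

end

section \<open>Uniform deviations over a square\<close>

definition grid_point :: "real \<Rightarrow> nat \<Rightarrow> nat \<Rightarrow> real" where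
  "grid_point r k a = - r + 2 * r * real a / 2 ^ k"

text \<open>The chain starts at the centre 0, where the process vanishes, and not at one of the
  level 0 points \<open>- r\<close> and \<open>r\<close>. On higher levels the parent is the nearest
  coarser point on the left.\<close>

definition grid_parent :: "real \<Rightarrow> nat \<Rightarrow> nat \<Rightarrow> real" where
  "grid_parent r k a = (if k = 0 then 0 else grid_point r (k - 1) (a div 2))"

definition grid_index :: "real \<Rightarrow> nat \<Rightarrow> real \<Rightarrow> nat" where
  "grid_index r k c = nat \<lfloor>(c + r) * 2 ^ k / (2 * r)\<rfloor>"

lemma abs_mult_le_left: "0 \<le> C \<Longrightarrow> \<bar>s\<bar> \<le> 1 \<Longrightarrow> \<bar>C * s\<bar> \<le> (C::real)"
  by (simp add: abs_mult mult_left_le)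

lemma abs_grid_point_le:
  assumes "r > 0" "a \<le> 2 ^ k"
  shows "\<bar>grid_point r k a\<bar> \<le> r"
proof -
  have "real a \<le> 2 ^ k" using assms(2) by (metis of_nat_le_iff of_nat_numeral of_nat_power)
  then have "real a / 2 ^ k \<le> 1" by simp
  then have "r * (real a / 2 ^ k) \<le> r * 1" using assms(1) by (intro mult_left_mono) auto
  moreover have "0 \<le> r * (real a / 2 ^ k)" using assms(1) by simp
  ultimately show ?thesis by (simp add: grid_point_def abs_le_iff)
qed

lemma abs_grid_parent_le:
  assumes "r > 0" "a \<le> 2 ^ k"
  shows "\<bar>grid_parent r k a\<bar> \<le> r"
proof (cases k)
  case (Suc l)
  then have "a div 2 \<le> 2 ^ l" using assms(2) by auto
  then show ?thesis using abs_grid_point_le[OF assms(1)] Suc by (simp add: grid_parent_def)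
qed (use assms in \<open>simp add: grid_parent_def\<close>)

text \<open>An index differs from twice its parent index by its parity, that is by at most one fine
  mesh width. At level 0 the true distance is \<open>r\<close>; the weaker bound lets one formula
  cover all levels.\<close>

lemma grid_point_parent_dist:
  assumes "r > 0" "a \<le> 2 ^ k"
  shows "\<bar>grid_point r k a - grid_parent r k a\<bar> \<le> 2 * r / 2 ^ k"
proof (cases k)
  case 0
  then show ?thesis using abs_grid_point_le[OF assms] assms by (simp add: grid_parent_def)
next
  case (Suc l)
  have "real a = 2 * real (a div 2) + real (a mod 2)"
    by (metis mult_div_mod_eq of_nat_add of_nat_mult of_nat_numeral)
  then have "grid_point r k a - grid_parent r k a = 2 * r / 2 ^ k * real (a mod 2)"
    using Suc by (simp add: grid_point_def grid_parent_def field_simps)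
  moreover have "\<bar>real (a mod 2)\<bar> \<le> 1" by (cases "even a") (auto simp: odd_iff_mod_2_eq_one)
  ultimately show ?thesis using assms(1) by (simp only:) (intro abs_mult_le_left; simp)
qed

lemma grid_index_le:
  assumes "r > 0" "\<bar>c\<bar> \<le> r"
  shows "grid_index r k c \<le> 2 ^ k"
proof -
  have "(c + r) * 2 ^ k / (2 * r) \<le> 2 ^ k"
    using assms by (simp add: field_simps)
  then have "\<lfloor>(c + r) * 2 ^ k / (2 * r)\<rfloor> \<le> 2 ^ k"
    by (metis floor_mono floor_of_int of_int_numeral of_int_power)
  then show ?thesis by (simp add: grid_index_def nat_le_iff)
qed

lemma grid_index_dist:
  assumes "r > 0" "\<bar>c\<bar> \<le> r"
  shows "\<bar>c - grid_point r k (grid_index r k c)\<bar> \<le> 2 * r / 2 ^ k"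
proof -
  define y where "y = (c + r) * 2 ^ k / (2 * r)"
  have y: "0 \<le> y" using assms by (simp add: y_def)
  have c: "c = - r + 2 * r / 2 ^ k * y" using assms by (simp add: y_def)
  have "real (grid_index r k c) = of_int \<lfloor>y\<rfloor>" using y by (simp add: grid_index_def y_def[symmetric])
  then have "c - grid_point r k (grid_index r k c) = 2 * r / 2 ^ k * (y - of_int \<lfloor>y\<rfloor>)"
    by (subst c) (simp add: grid_point_def field_simps)
  moreover have "\<bar>y - of_int \<lfloor>y\<rfloor>\<bar> \<le> 1" by linarith
  ultimately show ?thesis using assms(1) by (simp only:) (intro abs_mult_le_left; simp)
qed

text \<open>Rounding down on every level is consistent, since halving
  \<open>\<lfloor>2 * y\<rfloor>\<close> gives \<open>\<lfloor>y\<rfloor>\<close>. Hence the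
  successive approximations of one point form a chain of children and parents, and the increments
  along it telescope.\<close>

lemma grid_parent_index:
  assumes "r > 0" "\<bar>c\<bar> \<le> r"
  shows "grid_parent r (Suc k) (grid_index r (Suc k) c) = grid_point r k (grid_index r k c)"
proof -
  define y where "y = (c + r) * 2 ^ k / (2 * r)"
  have y: "0 \<le> y" using assms by (simp add: y_def)
  have e: "(c + r) * 2 ^ Suc k / (2 * r) = 2 * y" by (simp add: y_def)
  have "\<lfloor>2 * y\<rfloor> div 2 = \<lfloor>y\<rfloor>"
    using floor_divide_real_eq_div[of 2 "2 * y"] by simp
  then have "nat \<lfloor>2 * y\<rfloor> div 2 = nat \<lfloor>y\<rfloor>"
    by (metis nat_div_distrib nat_numeral y zero_le_floor zero_le_mult_iff zero_le_numeral)
  then show ?thesis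
    unfolding grid_parent_def grid_index_def e y_def[symmetric] by simp
qed

text \<open>This is the chaining series: the numerator is the growth of the square root of the
  entropy, the denominator the decay of the increments.\<close>

lemma sum_Suc_Suc_over_power2_le: "(\<Sum>k<m. (real k + 2) / 2 ^ k) \<le> 6"
proof -
  have "(\<Sum>k<m. (real k + 2) / 2 ^ k) = 6 - (2 * real m + 6) / 2 ^ m"
  proof (induction m)
    case (Suc m)
    have "(\<Sum>k<Suc m. (real k + 2) / 2 ^ k) = 6 - (2 * real m + 6) / 2 ^ m + (real m + 2) / 2 ^ m"
      by (simp add: Suc)
    also have "\<dots> = 6 - (2 * real (Suc m) + 6) / 2 ^ Suc m"
      by (simp add: add_divide_distrib)
    finally show ?case .
  qed simp
  then show ?thesis by simp
qed

text \<open>Because \<open>P \<ge> 2\<close>, every power of two is absorbed into a power of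
  \<open>P\<close>, so the grid enters only as a multiple of \<open>ln P\<close>. The multiple
  \<open>2 * k + 4\<close> is enlarged to a perfect square, whose root then leaves the bound of the
  maximal inequality.\<close>

lemma ln_grid_card_le:
  fixes P :: real and m :: nat
  assumes "P \<ge> 2" "real m \<le> P" "m > 0"
  shows "ln (2 * real (m * ((2 ^ k + 1) * (2 ^ k + 1)))) \<le> (real k + 2)\<^sup>2 * ln P"
proof -
  have "(2::real) ^ k + 1 \<le> 2 ^ (k + 1)" by simp
  then have "((2::real) ^ k + 1) * (2 ^ k + 1) \<le> 2 ^ (k + 1) * 2 ^ (k + 1)"
    by (intro mult_mono) auto
  note grid = this
  have "2 * real (m * ((2 ^ k + 1) * (2 ^ k + 1))) = 2 * (real m * ((2 ^ k + 1) * (2 ^ k + 1)))"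
    by (simp only: of_nat_mult of_nat_add of_nat_power of_nat_numeral of_nat_1)
  also have "\<dots> \<le> 2 * (P * (2 ^ (k + 1) * 2 ^ (k + 1)))"
    by (rule mult_left_mono[OF mult_mono[OF assms(2) grid]]) (use assms in simp_all)
  also have "\<dots> = P * 2 ^ (2 * k + 3)"
  proof -
    have "2 * k + 3 = Suc ((k + 1) + (k + 1))" by simp
    then show ?thesis by (simp only: power_Suc power_add mult.assoc mult.left_commute[of _ 2])
  qed
  also have "\<dots> \<le> P * P ^ (2 * k + 3)"
    using assms by (intro mult_left_mono power_mono) auto
  also have "\<dots> = P ^ (2 * k + 4)"
    by (simp only: power_Suc[symmetric]) (simp add: eval_nat_numeral)
  finally have le: "2 * real (m * ((2 ^ k + 1) * (2 ^ k + 1))) \<le> P ^ (2 * k + 4)" .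
  have "0 < m * ((2 ^ k + 1) * (2 ^ k + 1))" using assms by simp
  then have "0 < 2 * real (m * ((2 ^ k + 1) * (2 ^ k + 1)))"
    by (intro mult_pos_pos[OF zero_less_numeral] of_nat_0_less_iff[THEN iffD2])
  then have "ln (2 * real (m * ((2 ^ k + 1) * (2 ^ k + 1)))) \<le> ln (P ^ (2 * k + 4))"
    by (rule ln_mono[OF le])
  also have "\<dots> = real (2 * k + 4) * ln P"
    using assms by (subst ln_realpow) auto
  also have "\<dots> \<le> (real k + 2)\<^sup>2 * ln P"
    using assms by (intro mult_right_mono) (auto simp: power2_eq_square algebra_simps)
  finally show ?thesis .
qed

text \<open>The joint law is prescribed directly, so that integrals over the sample move to the
  product space, where coordinates can be peeled off one at a time. The empty sample is left out
  because the characterisation of independence by product laws, used in \<open>iid_sampleI\<close>,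
  needs a nonempty index set.\<close>

locale iid_sample = prob_space M
  for M :: "'w measure" and N :: "'a measure" and \<xi> :: "nat \<Rightarrow> 'w \<Rightarrow> 'a" +
  assumes N: "prob_space N"
    and \<xi>_meas [measurable]: "\<And>i. \<xi> i \<in> measurable M N"
    and distr_\<xi>: "\<And>n. n > 0 \<Longrightarrow> distr M (PiM {..<n} (\<lambda>_. N)) (\<lambda>\<omega>. \<lambda>i\<in>{..<n}. \<xi> i \<omega>) = PiM {..<n} (\<lambda>_. N)"
begin

lemma expectation_max_iid_sum:
  fixes \<phi> :: "'t \<Rightarrow> nat \<Rightarrow> 'a \<Rightarrow> real"
  assumes T: "finite T" "T \<noteq> {}" and \<phi>: "\<And>t i. t \<in> T \<Longrightarrow> \<phi> t i \<in> borel_measurable N"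
    and "V \<in> borel_measurable N" "integrable N (\<lambda>u. (V u)\<^sup>2)"
    and "\<And>t i. t \<in> T \<Longrightarrow> (\<integral>u. \<phi> t i u \<partial>N) = 0"
    and "\<And>t i u. t \<in> T \<Longrightarrow> u \<in> space N \<Longrightarrow> \<bar>\<phi> t i u\<bar> \<le> c * V u"
    and "(\<integral>u. (V u)\<^sup>2 \<partial>N) \<le> v" "v > 0" "c > 0" and n: "n > 0"
  shows "(\<integral>\<^sup>+\<omega>. (SUP t\<in>T. ennreal \<bar>\<Sum>i<n. \<phi> t i (\<xi> i \<omega>)\<bar>) \<partial>M) \<le>
    ennreal (3 * c * sqrt (real n * v * ln (2 * real (card T))))"
proof -
  note [measurable] = \<phi>
  have [simp]: "countable T" using T by (simp add: countable_finite)
  have "(\<integral>\<^sup>+\<omega>. (SUP t\<in>T. ennreal \<bar>\<Sum>i<n. \<phi> t i (\<xi> i \<omega>)\<bar>) \<partial>M)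
      = (\<integral>\<^sup>+\<omega>. (SUP t\<in>T. ennreal \<bar>\<Sum>i<n. \<phi> t i ((\<lambda>i\<in>{..<n}. \<xi> i \<omega>) i)\<bar>) \<partial>M)"
    by (intro nn_integral_cong SUP_cong refl arg_cong[where f=ennreal] arg_cong[where f=abs] sum.cong) auto
  also have "\<dots> = (\<integral>\<^sup>+\<omega>. (SUP t\<in>T. ennreal \<bar>\<Sum>i<n. \<phi> t i (\<omega> i)\<bar>)
      \<partial>distr M (PiM {..<n} (\<lambda>_. N)) (\<lambda>\<omega>. \<lambda>i\<in>{..<n}. \<xi> i \<omega>))"
    by (rule nn_integral_distr[symmetric]) measurable
  also have "\<dots> \<le> ennreal (3 * c * sqrt (real n * v * ln (2 * real (card T))))"
    unfolding distr_\<xi>[OF n] by (rule expectation_max_sum[OF N]) (use assms in auto)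
  finally show ?thesis .
qed

text \<open>Dyadic chaining from \<open>(0, 0)\<close>: level \<open>k\<close> has \<open>(2^k + 1)^2\<close> points with increments of
  size \<open>r / 2^k\<close>, so the entropy of the square costs only a constant and the logarithm is
  that of the number \<open>P\<close> of weight vectors.\<close>

lemma uniform_deviation:
  fixes g :: "real \<Rightarrow> real \<Rightarrow> 'a \<Rightarrow> real" and w :: "'j \<Rightarrow> nat \<Rightarrow> real" and P :: real
  assumes J: "finite J" "J \<noteq> {}" "real (card J) \<le> P" "P \<ge> 2"
    and w: "\<And>j i. j \<in> J \<Longrightarrow> i < n \<Longrightarrow> \<bar>w j i\<bar> \<le> K" and K: "K > 0" and r: "r > 0"
    and g [measurable]: "\<And>c d. g c d \<in> borel_measurable N"
    and g0: "\<And>u. g 0 0 u = 0"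
    and lip: "\<And>c d c' d' u. u \<in> space N \<Longrightarrow> \<bar>c\<bar> \<le> r \<Longrightarrow> \<bar>d\<bar> \<le> r \<Longrightarrow> \<bar>c'\<bar> \<le> r \<Longrightarrow> \<bar>d'\<bar> \<le> r \<Longrightarrow>
      \<bar>g c d u - g c' d' u\<bar> \<le> V u * (\<bar>c - c'\<bar> + \<bar>d - d'\<bar>)"
    and V: "V \<in> borel_measurable N" "integrable N (\<lambda>u. (V u)\<^sup>2)" "\<And>u. V u \<ge> 0"
    and v: "(\<integral>u. (V u)\<^sup>2 \<partial>N) \<le> v" "v > 0" and n: "n > 0" and t: "t > 0"
  shows "\<exists>A\<in>sets M. prob A \<le> 144 * K * r * sqrt (real n * v * ln P) / t \<and>
    (\<forall>\<omega>\<in>space M - A. \<forall>j\<in>J. \<forall>c d. \<bar>c\<bar> \<le> r \<longrightarrow> \<bar>d\<bar> \<le> r \<longrightarrow>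
      \<bar>\<Sum>i<n. w j i * (g c d (\<xi> i \<omega>) - (\<integral>u. g c d u \<partial>N))\<bar> \<le> t)"
proof -
  interpret N: prob_space N by (rule N)
  note V(1)[measurable]
  have Vint: "integrable N V"
    using N.square_integrable_imp_integrable[OF V(1,2)] .
  define E where "E = (\<integral>u. V u \<partial>N)"
  \<comment> \<open>Centring \<open>g\<close> by its mean adds the mean of \<open>V\<close> to the
    Lipschitz factor; by Jensen this raises the second moment to at most
    \<open>4 * v\<close>.\<close>
  define V' where "V' u = V u + E" for u
  have E: "E \<ge> 0" unfolding E_def using V(3) by simp
  have V'_meas: "V' \<in> borel_measurable N" unfolding V'_def by measurable
  have V'sq: "(V' u)\<^sup>2 = (V u)\<^sup>2 + 2 * E * V u + E\<^sup>2" for u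
    by (simp add: V'_def power2_eq_square algebra_simps)
  have V'_int: "integrable N (\<lambda>u. (V' u)\<^sup>2)"
    unfolding V'sq using V(2) Vint by auto
  have "E\<^sup>2 \<le> (\<integral>u. (V u)\<^sup>2 \<partial>N)"
    using N.variance_positive[of V] N.variance_eq[OF Vint V(2)] by (simp add: E_def)
  moreover have "(\<integral>u. (V' u)\<^sup>2 \<partial>N) = (\<integral>u. (V u)\<^sup>2 \<partial>N) + 2 * E * E + E\<^sup>2"
    unfolding V'sq using V(2) Vint by (simp add: N.prob_space E_def)
  ultimately have V'_le: "(\<integral>u. (V' u)\<^sup>2 \<partial>N) \<le> 4 * v"
    using v by (simp add: power2_eq_square)
  have gint: "integrable N (g c d)" if "\<bar>c\<bar> \<le> r" "\<bar>d\<bar> \<le> r" for c d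
    by (rule Bochner_Integration.integrable_bound[OF integrable_mult_left[OF Vint, of "\<bar>c\<bar> + \<bar>d\<bar>"]])
       (use lip[of _ c d 0 0] g0 r that V(3) in \<open>auto intro!: AE_I2\<close>)
  define m where "m c d = (\<integral>u. g c d u \<partial>N)" for c d
  have m0: "m 0 0 = 0" by (simp add: m_def g0)
  have lip': "\<bar>(g c d u - m c d) - (g c' d' u - m c' d')\<bar> \<le> V' u * (\<bar>c - c'\<bar> + \<bar>d - d'\<bar>)"
    if u: "u \<in> space N" and cd: "\<bar>c\<bar> \<le> r" "\<bar>d\<bar> \<le> r" "\<bar>c'\<bar> \<le> r" "\<bar>d'\<bar> \<le> r" for c d c' d' u
  proof -
    have "\<bar>m c d - m c' d'\<bar> = \<bar>\<integral>u. g c d u - g c' d' u \<partial>N\<bar>"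
      unfolding m_def using gint cd by (subst Bochner_Integration.integral_diff) auto
    also have "\<dots> \<le> (\<integral>u. \<bar>g c d u - g c' d' u\<bar> \<partial>N)" by (rule integral_abs_bound)
    also have "\<dots> \<le> (\<integral>u. V u * (\<bar>c - c'\<bar> + \<bar>d - d'\<bar>) \<partial>N)"
      using gint cd Vint lip by (intro integral_mono) auto
    also have "\<dots> = E * (\<bar>c - c'\<bar> + \<bar>d - d'\<bar>)" by (simp add: E_def)
    finally have "\<bar>m c d - m c' d'\<bar> \<le> E * (\<bar>c - c'\<bar> + \<bar>d - d'\<bar>)" .
    with lip[OF u cd] show ?thesis unfolding V'_def distrib_right by linarith
  qed
  \<comment> \<open>The maximal inequality wants its envelope bound for every index, so the weights
    are set to zero from \<open>n\<close> on.\<close>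
  define w' where "w' j i = (if i < n then w j i else 0)" for j i
  have w': "\<bar>w' j i\<bar> \<le> K" if "j \<in> J" for j i
    using w[OF that] K by (simp add: w'_def)
  define W where "W j c d \<omega> = (\<Sum>i<n. w' j i * (g c d (\<xi> i \<omega>) - m c d))" for j c d \<omega>
  define T where "T k = J \<times> ({..(2::nat) ^ k} \<times> {..(2::nat) ^ k})" for k :: nat
  define \<phi> where "\<phi> k = (\<lambda>(j, a, b) i u. w' j i * ((g (grid_point r k a) (grid_point r k b) u - m (grid_point r k a) (grid_point r k b))
      - (g (grid_parent r k a) (grid_parent r k b) u - m (grid_parent r k a) (grid_parent r k b))))" for k
  define D where "D k \<omega> = (SUP t\<in>T k. ennreal \<bar>\<Sum>i<n. \<phi> k t i (\<xi> i \<omega>)\<bar>)" for k \<omega>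
  have T_fin: "finite (T k)" "T k \<noteq> {}" for k using J by (auto simp: T_def)
  have cT: "countable (T k)" for k using T_fin by (simp add: countable_finite)
  have card_T: "card (T k) = card J * ((2 ^ k + 1) * (2 ^ k + 1))" for k
    unfolding T_def card_cartesian_product by simp
  have \<phi>_meas: "\<phi> k t i \<in> borel_measurable N" for k t i
    unfolding \<phi>_def by (cases t) auto
  have D_meas [measurable]: "D k \<in> borel_measurable M" for k
    unfolding D_def using cT \<phi>_meas by measurable
  have D_bound: "(\<integral>\<^sup>+\<omega>. D k \<omega> \<partial>M) \<le> ennreal (24 * K * r * sqrt (real n * v * ln P) * ((real k + 2) / 2 ^ k))" for k
  proof -
    have "(\<integral>\<^sup>+\<omega>. D k \<omega> \<partial>M) \<le> ennreal (3 * (K * (4 * r / 2 ^ k)) * sqrt (real n * (4 * v) * ln (2 * real (card (T k)))))"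
      unfolding D_def
    proof (rule expectation_max_iid_sum[OF T_fin \<phi>_meas V'_meas V'_int _ _ V'_le])
      fix t i assume "t \<in> T k"
      then obtain j a b where tj: "t = (j, a, b)" "j \<in> J" "a \<le> 2 ^ k" "b \<le> 2 ^ k"
        by (auto simp: T_def)
      note bds = abs_grid_point_le[OF r tj(3)] abs_grid_point_le[OF r tj(4)]
        abs_grid_parent_le[OF r tj(3)] abs_grid_parent_le[OF r tj(4)]
      show "(\<integral>u. \<phi> k t i u \<partial>N) = 0"
        using gint bds by (simp add: \<phi>_def tj m_def N.prob_space)
      fix u assume u: "u \<in> space N"
      have "\<bar>grid_point r k a - grid_parent r k a\<bar> + \<bar>grid_point r k b - grid_parent r k b\<bar> \<le> 4 * r / 2 ^ k"
        using grid_point_parent_dist[OF r tj(3)] grid_point_parent_dist[OF r tj(4)] by simp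
      moreover have "0 \<le> V' u" using V(3)[of u] E by (simp add: V'_def)
      ultimately have "V' u * (\<bar>grid_point r k a - grid_parent r k a\<bar> + \<bar>grid_point r k b - grid_parent r k b\<bar>) \<le> V' u * (4 * r / 2 ^ k)"
        by (rule mult_left_mono)
      with lip'[OF u bds] have "\<bar>(g (grid_point r k a) (grid_point r k b) u - m (grid_point r k a) (grid_point r k b))
        - (g (grid_parent r k a) (grid_parent r k b) u - m (grid_parent r k a) (grid_parent r k b))\<bar> \<le> V' u * (4 * r / 2 ^ k)"
        by linarith
      then have "\<bar>\<phi> k t i u\<bar> \<le> K * (V' u * (4 * r / 2 ^ k))"
        unfolding \<phi>_def tj prod.case abs_mult using w'[OF tj(2)] K by (intro mult_mono) auto
      then show "\<bar>\<phi> k t i u\<bar> \<le> K * (4 * r / 2 ^ k) * V' u" by (simp add: mult_ac)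
    qed (use K r v n in auto)
    also have "\<dots> \<le> ennreal (3 * (K * (4 * r / 2 ^ k)) * sqrt (real n * (4 * v) * ((real k + 2)\<^sup>2 * ln P)))"
      unfolding card_T using J K r n v
      by (intro ennreal_leI mult_left_mono real_sqrt_le_mono ln_grid_card_le) (auto simp: card_gt_0_iff)
    also have "real n * (4 * v) * ((real k + 2)\<^sup>2 * ln P) = (2 * (real k + 2))\<^sup>2 * (real n * v * ln P)"
      by (simp add: power2_eq_square algebra_simps)
    also have "sqrt \<dots> = 2 * (real k + 2) * sqrt (real n * v * ln P)"
      unfolding real_sqrt_mult by simp
    also have "3 * (K * (4 * r / 2 ^ k)) * (2 * (real k + 2) * sqrt (real n * v * ln P)) =
        24 * K * r * sqrt (real n * v * ln P) * ((real k + 2) / 2 ^ k)"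
      by simp
    finally show ?thesis .
  qed
  \<comment> \<open>The factor 24 collects 3 from the maximal inequality, 4 from an increment of
    \<open>2 * r / 2 ^ k\<close> in each of two coordinates, and 2 as the root of the 4 in
    \<open>4 * v\<close>. The chaining series contributes 6, hence 144.\<close>
  define B where "B = 24 * K * r * sqrt (real n * v * ln P)"
  have B: "B \<ge> 0" using K r v J by (simp add: B_def)
  define S where "S \<omega> = (\<Sum>k. D k \<omega>)" for \<omega>
  have [measurable]: "S \<in> borel_measurable M" unfolding S_def by measurable
  have S_int: "(\<integral>\<^sup>+\<omega>. S \<omega> \<partial>M) \<le> ennreal (6 * B)"
  proof -
    have "(\<integral>\<^sup>+\<omega>. S \<omega> \<partial>M) = (\<Sum>k. \<integral>\<^sup>+\<omega>. D k \<omega> \<partial>M)"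
      unfolding S_def by (rule nn_integral_suminf) measurable
    also have "\<dots> \<le> ennreal (6 * B)"
      unfolding suminf_eq_SUP
    proof (rule SUP_least)
      fix m
      have "(\<Sum>k<m. \<integral>\<^sup>+\<omega>. D k \<omega> \<partial>M) \<le> (\<Sum>k<m. ennreal (B * ((real k + 2) / 2 ^ k)))"
        unfolding B_def by (intro sum_mono D_bound)
      also have "\<dots> = ennreal (B * (\<Sum>k<m. (real k + 2) / 2 ^ k))"
        using B by (subst sum_ennreal) (auto simp: sum_distrib_left)
      also have "\<dots> \<le> ennreal (B * 6)"
        using B by (intro ennreal_leI mult_left_mono sum_Suc_Suc_over_power2_le) auto
      finally show "(\<Sum>k<m. \<integral>\<^sup>+\<omega>. D k \<omega> \<partial>M) \<le> ennreal (6 * B)" by (simp add: mult_ac)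
    qed
    finally show ?thesis .
  qed
  \<comment> \<open>\<open>S\<close> may be infinite. Such points belong to \<open>A\<close>, and
    outside \<open>A\<close> the whole chain sums to less than \<open>t\<close>.\<close>
  define A where "A = {\<omega>\<in>space M. 1 \<le> ennreal (1 / t) * S \<omega>}"
  have A: "A \<in> sets M" unfolding A_def by measurable
  have "emeasure M A \<le> ennreal (1 / t) * (\<integral>\<^sup>+\<omega>. S \<omega> * indicator (space M) \<omega> \<partial>M)"
    unfolding A_def by (rule nn_integral_Markov_inequality) auto
  also have "(\<integral>\<^sup>+\<omega>. S \<omega> * indicator (space M) \<omega> \<partial>M) = (\<integral>\<^sup>+\<omega>. S \<omega> \<partial>M)"
    by (intro nn_integral_cong) auto
  also have "ennreal (1 / t) * (\<integral>\<^sup>+\<omega>. S \<omega> \<partial>M) \<le> ennreal (1 / t) * ennreal (6 * B)"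
    by (intro mult_left_mono S_int) auto
  also have "\<dots> = ennreal (6 * B / t)"
    using t B by (simp add: ennreal_mult'[symmetric])
  finally have "prob A \<le> 6 * B / t"
    using t B by (simp add: emeasure_eq_measure)
  then have PA: "prob A \<le> 144 * K * r * sqrt (real n * v * ln P) / t"
    by (simp add: B_def)
  have "\<bar>\<Sum>i<n. w j i * (g c d (\<xi> i \<omega>) - (\<integral>u. g c d u \<partial>N))\<bar> \<le> t"
    if \<omega>: "\<omega> \<in> space M - A" and j: "j \<in> J" and cd: "\<bar>c\<bar> \<le> r" "\<bar>d\<bar> \<le> r" for \<omega> j c d
  proof -
    have sp: "\<xi> i \<omega> \<in> space N" for i using \<omega> measurable_space[OF \<xi>_meas] by auto
    define a where "a k = grid_index r k c" for k
    define b where "b k = grid_index r k d" for k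
    have ab: "a k \<le> 2 ^ k" "b k \<le> 2 ^ k" for k
      unfolding a_def b_def using grid_index_le r cd by auto
    define \<Delta> where "\<Delta> k = (\<Sum>i<n. \<phi> k (j, a k, b k) i (\<xi> i \<omega>))" for k
    have \<Delta>: "\<Delta> k = W j (grid_point r k (a k)) (grid_point r k (b k)) \<omega> - W j (grid_parent r k (a k)) (grid_parent r k (b k)) \<omega>" for k
      by (simp add: \<Delta>_def \<phi>_def W_def right_diff_distrib sum_subtractf)
    have tele: "W j (grid_point r k (a k)) (grid_point r k (b k)) \<omega> = (\<Sum>l\<le>k. \<Delta> l)" for k
    proof (induction k)
      case 0
      show ?case using g0 m0 by (simp add: \<Delta> grid_parent_def W_def)
    next
      case (Suc k)
      show ?case
        using Suc grid_parent_index[OF r cd(1), of k] grid_parent_index[OF r cd(2), of k]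
        by (simp add: \<Delta> a_def b_def)
    qed
    have Wk: "\<bar>W j (grid_point r k (a k)) (grid_point r k (b k)) \<omega>\<bar> \<le> t" for k
    proof -
      have "\<bar>W j (grid_point r k (a k)) (grid_point r k (b k)) \<omega>\<bar> \<le> (\<Sum>l\<le>k. \<bar>\<Delta> l\<bar>)"
        unfolding tele by (rule sum_abs)
      then have "ennreal \<bar>W j (grid_point r k (a k)) (grid_point r k (b k)) \<omega>\<bar> \<le> ennreal (\<Sum>l\<le>k. \<bar>\<Delta> l\<bar>)"
        by (rule ennreal_leI)
      also have "\<dots> = (\<Sum>l\<le>k. ennreal \<bar>\<Delta> l\<bar>)" by simp
      also have "\<dots> \<le> (\<Sum>l\<le>k. D l \<omega>)"
        unfolding \<Delta>_def D_def using ab j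
        by (intro sum_mono SUP_upper) (auto simp: T_def)
      also have "\<dots> \<le> S \<omega>"
        unfolding S_def by (rule sum_le_suminf) auto
      finally have "ennreal (1 / t) * ennreal \<bar>W j (grid_point r k (a k)) (grid_point r k (b k)) \<omega>\<bar> \<le> ennreal (1 / t) * S \<omega>"
        by (rule mult_left_mono) simp
      also have "\<dots> < 1" using \<omega> by (auto simp: A_def not_le)
      finally have "\<bar>W j (grid_point r k (a k)) (grid_point r k (b k)) \<omega>\<bar> / t < 1"
        using t by (simp add: ennreal_mult'[symmetric])
      then show ?thesis using t by simp
    qed
    \<comment> \<open>The passage from the grid to an arbitrary point is pathwise: for a fixed
      \<open>\<omega>\<close> the remainder is a finite random constant times
      \<open>(1 / 2) ^ k\<close>. So one event serves the whole uncountable square.\<close>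
    define R where "R = K * (\<Sum>i<n. V' (\<xi> i \<omega>)) * (4 * r)"
    have "\<bar>W j c d \<omega>\<bar> \<le> t + R * (1 / 2) ^ k" for k
    proof -
      note bds = abs_grid_point_le[OF r ab(1)[of k]] abs_grid_point_le[OF r ab(2)[of k]]
      have "\<bar>W j c d \<omega> - W j (grid_point r k (a k)) (grid_point r k (b k)) \<omega>\<bar>
        \<le> (\<Sum>i<n. \<bar>w' j i * ((g c d (\<xi> i \<omega>) - m c d) - (g (grid_point r k (a k)) (grid_point r k (b k)) (\<xi> i \<omega>) - m (grid_point r k (a k)) (grid_point r k (b k))))\<bar>)"
        unfolding W_def sum_subtractf[symmetric] right_diff_distrib[symmetric] by (rule sum_abs)
      also have "\<dots> \<le> (\<Sum>i<n. K * (V' (\<xi> i \<omega>) * (4 * r / 2 ^ k)))"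
        unfolding abs_mult
      proof (intro sum_mono mult_mono w' j)
        fix i
        have "\<bar>c - grid_point r k (a k)\<bar> + \<bar>d - grid_point r k (b k)\<bar> \<le> 4 * r / 2 ^ k"
          using grid_index_dist[OF r cd(1), of k] grid_index_dist[OF r cd(2), of k] by (simp add: a_def b_def)
        moreover have "0 \<le> V' (\<xi> i \<omega>)" using V(3) E by (simp add: V'_def)
        ultimately have "V' (\<xi> i \<omega>) * (\<bar>c - grid_point r k (a k)\<bar> + \<bar>d - grid_point r k (b k)\<bar>) \<le> V' (\<xi> i \<omega>) * (4 * r / 2 ^ k)"
          by (rule mult_left_mono)
        then show "\<bar>(g c d (\<xi> i \<omega>) - m c d) - (g (grid_point r k (a k)) (grid_point r k (b k)) (\<xi> i \<omega>) - m (grid_point r k (a k)) (grid_point r k (b k)))\<bar>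
            \<le> V' (\<xi> i \<omega>) * (4 * r / 2 ^ k)"
          using lip'[OF sp[of i] cd bds] by linarith
      qed (use K in auto)
      also have "\<dots> = R * (1 / 2) ^ k"
        unfolding R_def power_one_over sum_distrib_left sum_distrib_right by (intro sum.cong refl) simp
      finally show ?thesis using Wk[of k] by linarith
    qed
    moreover have "(\<lambda>k. t + R * (1 / 2) ^ k) \<longlonglongrightarrow> t + R * 0"
      by (intro tendsto_intros LIMSEQ_power_zero) simp
    ultimately have "\<bar>W j c d \<omega>\<bar> \<le> t"
      using LIMSEQ_le_const[of "\<lambda>k. t + R * (1 / 2) ^ k" t "\<bar>W j c d \<omega>\<bar>"] by auto
    then show ?thesis by (simp add: W_def w'_def m_def)
  qed
  with A PA show ?thesis by blast
qed

end

section \<open>Location and scale perturbations of the noise\<close>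

lemma norm_real_2_eq: "(norm (v :: real ^ 2))\<^sup>2 = (v $ 1)\<^sup>2 + (v $ 2)\<^sup>2"
  unfolding power2_norm_eq_inner by (simp add: inner_vec_def sum_2 power2_eq_square)

lemma posdef_lower_bound:
  fixes A :: "real ^ 'n ^ 'n"
  assumes "\<And>v. v \<noteq> 0 \<Longrightarrow> inner v (A *v v) > 0"
  shows "\<exists>\<mu>>0. \<forall>v. inner v (A *v v) \<ge> \<mu> * (norm v)\<^sup>2"
proof -
  have cont: "continuous_on (sphere 0 1) (\<lambda>v. inner v (A *v v))"
    by (intro continuous_intros matrix_vector_mult_linear_continuous_on)
  have ne: "sphere (0 :: real ^ 'n) 1 \<noteq> {}"
    by auto
  obtain v0 where v0: "v0 \<in> sphere 0 1" "\<And>v. v \<in> sphere 0 1 \<Longrightarrow> inner v0 (A *v v0) \<le> inner v (A *v v)"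
    using continuous_attains_inf[OF _ ne cont] by auto
  define \<mu> where "\<mu> = inner v0 (A *v v0)"
  have "v0 \<noteq> 0" using v0(1) by auto
  then have "\<mu> > 0" unfolding \<mu>_def by (rule assms)
  moreover have "inner v (A *v v) \<ge> \<mu> * (norm v)\<^sup>2" for v
  proof (cases "v = 0")
    case False
    have "\<mu> \<le> inner (v /\<^sub>R norm v) (A *v (v /\<^sub>R norm v))"
      unfolding \<mu>_def by (rule v0(2)) (use False in simp)
    also have "\<dots> = inner v (A *v v) / (norm v)\<^sup>2"
      by (simp add: matrix_vector_mult_scaleR power2_eq_square divide_inverse)
    finally show ?thesis using False by (simp add: field_simps)
  qed simp
  ultimately show ?thesis by blast
qed

text \<open>The bound \<open>min\<close> is an equality at \<open>v = 0\<close>, so \<open>h\<close>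
  minus the logarithm has a local minimum at \<open>z0\<close> and the gradient of \<open>h\<close>
  there is the second unit vector. Positive definiteness then lifts \<open>h\<close> quadratically
  above the linear function \<open>v $ 2\<close>, which dominates
  \<open>ln (1 + v $ 2)\<close>.\<close>

lemma quadratic_growth:
  fixes h :: "real ^ 2 \<Rightarrow> real"
  assumes hess: "has_hessian h A z0" and z0: "z0 $ 2 = 1"
    and pos: "\<And>v. v \<noteq> 0 \<Longrightarrow> inner v (A *v v) > 0"
    and \<delta>: "\<delta> > 0" and min: "\<And>v. norm v < \<delta> \<Longrightarrow> h (z0 + v) - h z0 \<ge> ln (1 + v $ 2)"
  shows "\<exists>\<kappa>>0. \<exists>\<epsilon>>0. \<forall>v. norm v < \<epsilon> \<longrightarrow> h (z0 + v) - h z0 - ln (1 + v $ 2) \<ge> \<kappa> * (norm v)\<^sup>2"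
proof -
  obtain g where g: "\<forall>\<^sub>F w in nhds z0. GDERIV h w :> g w" and g': "(g has_derivative (\<lambda>v. A *v v)) (at z0)"
    using hess unfolding has_hessian_def by blast
  obtain \<delta>1 where \<delta>1: "\<delta>1 > 0" "\<And>w. dist w z0 < \<delta>1 \<Longrightarrow> (h has_derivative (\<lambda>v. inner v (g w))) (at w)"
    using g unfolding eventually_nhds_metric gderiv_def by blast
  obtain \<mu> where \<mu>: "\<mu> > 0" "\<And>v. inner v (A *v v) \<ge> \<mu> * (norm v)\<^sup>2"
    using posdef_lower_bound[OF pos] by blast
  obtain \<delta>2 where \<delta>2: "\<delta>2 > 0" "\<And>w. norm (w - z0) < \<delta>2 \<Longrightarrow> norm (g w - g z0 - A *v (w - z0)) \<le> \<mu> / 2 * norm (w - z0)"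
    using g' \<mu>(1) unfolding has_derivative_at_alt by (meson half_gt_zero)
  have bl: "bounded_linear (\<lambda>v :: real ^ 2. v $ 2)"
    by (rule bounded_linear_vec_nth)
  have g0: "inner v (g z0) = v $ 2" for v
  proof -
    have sm: "\<bar>v $ 2\<bar> < 1" if "norm v < 1" for v :: "real ^ 2"
      using component_le_norm_cart[of v 2] that by linarith
    have "((\<lambda>w. h w - ln (w $ 2)) has_derivative (\<lambda>v. inner v (g z0) - v $ 2)) (at z0)"
      using \<delta>1(2)[of z0] \<delta>1(1) z0
      by (auto intro!: derivative_eq_intros bounded_linear.has_derivative[OF bl])
    then have "(\<lambda>v. inner v (g z0) - v $ 2) = (\<lambda>v. 0)"
    proof (rule differential_zero_maxmin[rotated 2])
      show "z0 \<in> ball z0 \<delta>" using \<delta> by simp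
      show "(\<forall>w\<in>ball z0 \<delta>. h w - ln (w $ 2) \<le> h z0 - ln (z0 $ 2)) \<or> (\<forall>w\<in>ball z0 \<delta>. h z0 - ln (z0 $ 2) \<le> h w - ln (w $ 2))"
      proof (intro disjI2 ballI)
        fix w assume "w \<in> ball z0 \<delta>"
        then have "norm (w - z0) < \<delta>" by (simp add: dist_norm norm_minus_commute)
        from min[OF this] show "h z0 - ln (z0 $ 2) \<le> h w - ln (w $ 2)"
          by (simp add: z0)
      qed
    qed simp
    then show ?thesis by (metis eq_iff_diff_eq_0)
  qed
  define \<epsilon> where "\<epsilon> = Min {\<delta>1, \<delta>2, 1}"
  have \<epsilon>: "\<epsilon> > 0" "\<epsilon> \<le> \<delta>1" "\<epsilon> \<le> \<delta>2" "\<epsilon> \<le> 1" using \<delta>1 \<delta>2 by (auto simp: \<epsilon>_def)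
  have "h (z0 + v) - h z0 - ln (1 + v $ 2) \<ge> \<mu> / 4 * (norm v)\<^sup>2" if v: "norm v < \<epsilon>" for v
  proof -
    \<comment> \<open>The gradient is expanded at the single point \<open>z0\<close>. Its error uses
      up half of \<open>\<mu>\<close>, so the slope along the ray exceeds \<open>v $ 2\<close> by at
      least \<open>t * \<mu> / 2 * (norm v)\<^sup>2\<close>, which integrates to the
      \<open>\<mu> / 4\<close> subtracted here.\<close>
    define \<psi> where "\<psi> t = h (z0 + t *\<^sub>R v) - t * (v $ 2) - t\<^sup>2 * (\<mu> / 4) * (norm v)\<^sup>2" for t
    have "\<exists>y. DERIV \<psi> t :> y \<and> y \<ge> 0" if t: "0 \<le> t" "t \<le> 1" for t
    proof -
      have nt: "norm (t *\<^sub>R v) < \<epsilon>"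
        using v t mult_left_le_one_le[of "norm v" t] by simp
      define w where "w = z0 + t *\<^sub>R v"
      have "dist w z0 < \<delta>1" using nt \<epsilon> by (simp add: w_def dist_norm)
      note hd = \<delta>1(2)[OF this]
      have "((\<lambda>t. z0 + t *\<^sub>R v) has_derivative (\<lambda>s. s *\<^sub>R v)) (at t)"
        by (auto intro!: derivative_eq_intros)
      from has_derivative_compose[OF this, of h "\<lambda>v. inner v (g w)"] hd
      have "((\<lambda>t. h (z0 + t *\<^sub>R v)) has_derivative (\<lambda>s. inner (s *\<^sub>R v) (g w))) (at t)"
        by (simp add: w_def)
      then have "DERIV (\<lambda>t. h (z0 + t *\<^sub>R v)) t :> inner v (g w)"
        unfolding has_field_derivative_def by (simp add: mult_commute_abs)
      then have D: "DERIV \<psi> t :> inner v (g w) - v $ 2 - 2 * t * (\<mu> / 4) * (norm v)\<^sup>2"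
        unfolding \<psi>_def by (auto intro!: derivative_eq_intros)
      have "norm (w - z0) < \<delta>2" using nt \<epsilon> by (simp add: w_def)
      from \<delta>2(2)[OF this] have e: "norm (g w - g z0 - A *v (t *\<^sub>R v)) \<le> \<mu> / 2 * (t * norm v)"
        using t by (simp add: w_def)
      have "\<bar>inner v (g w - g z0 - A *v (t *\<^sub>R v))\<bar> \<le> norm v * (\<mu> / 2 * (t * norm v))"
        by (rule order_trans[OF Cauchy_Schwarz_ineq2 mult_left_mono[OF e]]) simp
      then have "inner v (g w - g z0 - A *v (t *\<^sub>R v)) \<ge> - (\<mu> / 2 * t * (norm v)\<^sup>2)"
        by (simp add: power2_eq_square mult_ac)
      moreover have "inner v (g w - g z0 - A *v (t *\<^sub>R v)) = inner v (g w) - v $ 2 - t * inner v (A *v v)"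
        by (simp add: inner_diff_right g0 matrix_vector_mult_scaleR)
      moreover have "t * (\<mu> * (norm v)\<^sup>2) \<le> t * inner v (A *v v)"
        using \<mu>(2) t by (intro mult_left_mono) auto
      ultimately have "0 \<le> inner v (g w) - v $ 2 - 2 * t * (\<mu> / 4) * (norm v)\<^sup>2"
        by (simp add: mult_ac)
      with D show ?thesis by blast
    qed
    then have "\<psi> 0 \<le> \<psi> 1"
      by (intro DERIV_nonneg_imp_nondecreasing[of 0 1 \<psi>]) auto
    then have "h (z0 + v) - h z0 \<ge> v $ 2 + \<mu> / 4 * (norm v)\<^sup>2"
      by (simp add: \<psi>_def)
    moreover have "ln (1 + v $ 2) \<le> v $ 2"
      using v \<epsilon>(4) component_le_norm_cart[of v 2] by (intro ln_add_one_self_le_self2) auto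
    ultimately show ?thesis by linarith
  qed
  then show ?thesis using \<epsilon>(1) \<mu>(1)
    by (intro exI[of _ "\<mu> / 4"] conjI exI[of _ \<epsilon>]) auto
qed

text \<open>These are the distributional assumptions with a Lipschitz window free of the sample
  size. The bound \<open>r0 \<le> 1 / 2\<close> keeps the scale factor \<open>1 + e\<close> away
  from zero.\<close>

locale regular_noise =
  fixes f G :: "real \<Rightarrow> real" and r0 :: real
  assumes f_pos: "\<And>u. f u > 0"
    and prob_noise: "prob_space (noise f)"
    and diff_loss: "\<And>u. loss f differentiable (at u)"
    and int_loss: "integrable (noise f) (loss f)"
    and int_score: "integrable (noise f) (\<lambda>u. (deriv (loss f) u)\<^sup>2)"
    and int_score_id: "integrable (noise f) (\<lambda>u. (deriv (loss f) u * u)\<^sup>2)"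
    and G_pos: "\<And>u. G u > 0"
    and int_G: "integrable (noise f) (\<lambda>u. (G u)\<^sup>2)"
    and int_G4: "integrable (noise f) (\<lambda>u. (G u)\<^sup>2 * u ^ 4)"
    and r0: "0 < r0" "r0 \<le> 1 / 2"
    and lip_AE: "AE u in noise f. \<forall>v v'. max \<bar>v\<bar> \<bar>v'\<bar> \<le> (1 + \<bar>u\<bar>) * r0 \<longrightarrow>
              \<bar>deriv (loss f) (u + v) - deriv (loss f) (u + v')\<bar> \<le> G u * \<bar>v - v'\<bar>"
begin

abbreviation score :: "real \<Rightarrow> real" where "score \<equiv> deriv (loss f)"

sublocale N: prob_space "noise f" by (rule prob_noise)

lemma sets_noise [simp, measurable_cong]: "sets (noise f) = sets borel"
  by (simp add: noise_def)

lemma space_noise [simp]: "space (noise f) = UNIV"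
  by (simp add: noise_def)

lemma DERIV_loss: "DERIV (loss f) u :> score u"
  using diff_loss DERIV_deriv_iff_real_differentiable by blast

lemma continuous_loss: "continuous_on UNIV (loss f)"
  using DERIV_loss DERIV_isCont by (blast intro: continuous_at_imp_continuous_on)

lemma loss_measurable [measurable]: "loss f \<in> borel_measurable borel"
  by (rule borel_measurable_continuous_onI[OF continuous_loss])

lemma f_measurable [measurable]: "f \<in> borel_measurable borel"
proof -
  have "(\<lambda>u. exp (- loss f u)) \<in> borel_measurable borel" by measurable
  also have "(\<lambda>u. exp (- loss f u)) = f" using f_pos by (simp add: loss_def)
  finally show ?thesis .
qed

lemma score_measurable [measurable]: "score \<in> borel_measurable borel"
proof (rule borel_measurable_LIMSEQ_real)
  fix u :: real
  have "((\<lambda>h. (loss f (u + h) - loss f u) / h) \<longlongrightarrow> score u) (at 0)"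
    using DERIV_loss[of u] by (simp add: DERIV_def)
  moreover have "filterlim (\<lambda>n. inverse (real (Suc n))) (at 0) sequentially"
    using LIMSEQ_inverse_real_of_nat by (simp add: filterlim_at)
  ultimately show "(\<lambda>n. (loss f (u + inverse (real (Suc n))) - loss f u) / inverse (real (Suc n))) \<longlonglongrightarrow> score u"
    by (rule filterlim_compose)
qed measurable

text \<open>The square is measurable because it is integrable, and positivity recovers
  \<open>G\<close> as its root.\<close>

lemma G_measurable [measurable]: "G \<in> borel_measurable borel"
proof -
  have "G u = sqrt ((G u)\<^sup>2)" for u using G_pos[of u] by simp
  moreover have "(\<lambda>u. sqrt ((G u)\<^sup>2)) \<in> borel_measurable (noise f)"
    using int_G by measurable
  ultimately show ?thesis by (simp add: measurable_def sets_eq_imp_space_eq[OF sets_noise])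
qed

definition lip_at :: "real \<Rightarrow> bool" where
  "lip_at u \<longleftrightarrow> (\<forall>v v'. max \<bar>v\<bar> \<bar>v'\<bar> \<le> (1 + \<bar>u\<bar>) * r0 \<longrightarrow>
    \<bar>score (u + v) - score (u + v')\<bar> \<le> G u * \<bar>v - v'\<bar>)"

text \<open>A Borel set of full measure inside the set of points where \<open>lip_at\<close> holds, which need
  not be measurable.\<close>

definition regular_pts :: "real set" where
  "regular_pts = (SOME A. A \<in> sets borel \<and> (AE u in noise f. u \<in> A) \<and> (\<forall>u\<in>A. lip_at u))"

lemma regular_pts:
  shows regular_pts_sets [measurable]: "regular_pts \<in> sets borel"
    and regular_pts_AE: "AE u in noise f. u \<in> regular_pts"
    and regular_pts_lip_at: "\<And>u. u \<in> regular_pts \<Longrightarrow> lip_at u"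
proof -
  have "AE u in noise f. lip_at u"
    using lip_AE unfolding lip_at_def .
  then obtain B where B: "B \<in> null_sets (noise f)" "{u \<in> space (noise f). \<not> lip_at u} \<subseteq> B"
    unfolding eventually_ae_filter by blast
  have "AE u in noise f. u \<in> - B"
    using B(1) by (intro AE_I'[of B]) auto
  moreover have "- B \<in> sets borel" using B(1) by (metis borel_comp null_setsD2 sets_noise)
  moreover have "\<forall>u\<in>- B. lip_at u" using B(2) by auto
  ultimately have "\<exists>A. A \<in> sets borel \<and> (AE u in noise f. u \<in> A) \<and> (\<forall>u\<in>A. lip_at u)"
    by (intro exI[of _ "- B"] conjI)
  from someI_ex[OF this] show "regular_pts \<in> sets borel" "AE u in noise f. u \<in> regular_pts"
    "\<And>u. u \<in> regular_pts \<Longrightarrow> lip_at u"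
    unfolding regular_pts_def[symmetric] by simp_all
qed

lemma regular_pts_lip:
  assumes "u \<in> regular_pts" "\<bar>v\<bar> \<le> (1 + \<bar>u\<bar>) * r0" "\<bar>v'\<bar> \<le> (1 + \<bar>u\<bar>) * r0"
  shows "\<bar>score (u + v) - score (u + v')\<bar> \<le> G u * \<bar>v - v'\<bar>"
  using regular_pts_lip_at[OF assms(1)] assms(2,3) unfolding lip_at_def by simp

text \<open>A common Lipschitz factor in \<open>(c, e)\<close> for loss and score: the bracket
  bounds the score throughout the window around \<open>u\<close>, and the last factor bounds how
  fast \<open>e * u - c\<close> moves. It also dominates the score itself. Expanding its square
  leaves precisely the four moments assumed in the locale.\<close>

definition envelope :: "real \<Rightarrow> real" where
  "envelope u = (\<bar>score u\<bar> + G u * (1 + \<bar>u\<bar>)) * (1 + \<bar>u\<bar>)"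

lemma envelope_measurable [measurable]: "envelope \<in> borel_measurable borel"
  unfolding envelope_def[abs_def] by measurable

lemma envelope_nonneg: "envelope u \<ge> 0"
  using G_pos[of u] by (simp add: envelope_def)

lemma envelope_sq_integrable: "integrable (noise f) (\<lambda>u. (envelope u)\<^sup>2)"
proof (rule Bochner_Integration.integrable_bound)
  show "integrable (noise f) (\<lambda>u. 4 * (score u)\<^sup>2 + 4 * (score u * u)\<^sup>2 + 16 * (G u)\<^sup>2 + 16 * ((G u)\<^sup>2 * u ^ 4))"
    using int_score int_score_id int_G int_G4 by auto
  have sq: "(a + b)\<^sup>2 \<le> 2 * a\<^sup>2 + 2 * b\<^sup>2" for a b :: real
    using sum_squares_bound[of a b] by (simp add: power2_sum)
  have "(envelope u)\<^sup>2 \<le> 4 * (score u)\<^sup>2 + 4 * (score u * u)\<^sup>2 + 16 * (G u)\<^sup>2 + 16 * ((G u)\<^sup>2 * u ^ 4)" for u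
  proof -
    have one: "(1 + \<bar>u\<bar>)\<^sup>2 \<le> 2 + 2 * u\<^sup>2" using sq[of 1 "\<bar>u\<bar>"] by simp
    have "((1 + \<bar>u\<bar>)\<^sup>2)\<^sup>2 \<le> (2 + 2 * u\<^sup>2)\<^sup>2" using one by (intro power_mono) auto
    also have "\<dots> \<le> 8 + 8 * u ^ 4" using sq[of 2 "2 * u\<^sup>2"] by (simp add: power_mult_distrib flip: power_mult)
    finally have four: "((1 + \<bar>u\<bar>)\<^sup>2)\<^sup>2 \<le> 8 + 8 * u ^ 4" .
    have "(envelope u)\<^sup>2 = (\<bar>score u\<bar> * (1 + \<bar>u\<bar>) + G u * (1 + \<bar>u\<bar>)\<^sup>2)\<^sup>2"
      by (simp add: envelope_def power2_eq_square algebra_simps)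
    also have "\<dots> \<le> 2 * ((score u)\<^sup>2 * (1 + \<bar>u\<bar>)\<^sup>2) + 2 * ((G u)\<^sup>2 * ((1 + \<bar>u\<bar>)\<^sup>2)\<^sup>2)"
      using sq[of "\<bar>score u\<bar> * (1 + \<bar>u\<bar>)" "G u * (1 + \<bar>u\<bar>)\<^sup>2"] by (simp only: power_mult_distrib power2_abs)
    also have "\<dots> \<le> 2 * ((score u)\<^sup>2 * (2 + 2 * u\<^sup>2)) + 2 * ((G u)\<^sup>2 * (8 + 8 * u ^ 4))"
      using one four by (intro add_mono mult_left_mono) auto
    also have "\<dots> = 4 * (score u)\<^sup>2 + 4 * (score u * u)\<^sup>2 + 16 * (G u)\<^sup>2 + 16 * ((G u)\<^sup>2 * u ^ 4)"
      by (simp add: power_mult_distrib algebra_simps)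
    finally show ?thesis .
  qed
  then show "AE u in noise f. norm ((envelope u)\<^sup>2) \<le> norm (4 * (score u)\<^sup>2 + 4 * (score u * u)\<^sup>2 + 16 * (G u)\<^sup>2 + 16 * ((G u)\<^sup>2 * u ^ 4))"
    by (intro AE_I2) (auto intro: order_trans)
qed measurable

lemma envelope_integrable: "integrable (noise f) envelope"
  by (rule N.square_integrable_imp_integrable[OF _ envelope_sq_integrable]) measurable

lemma score_diff_le:
  assumes u: "u \<in> regular_pts" and a: "\<bar>a\<bar> \<le> (1 + \<bar>u\<bar>) * r0"
  shows "\<bar>score (u + a) - score u\<bar> \<le> G u * \<bar>a\<bar>"
  using regular_pts_lip[OF u a, of 0] r0 by simp

lemma loss_diff_le:
  assumes u: "u \<in> regular_pts" and a: "\<bar>a\<bar> \<le> (1 + \<bar>u\<bar>) * r0" and b: "\<bar>b\<bar> \<le> (1 + \<bar>u\<bar>) * r0"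
  shows "\<bar>loss f (u + a) - loss f (u + b)\<bar> \<le> (\<bar>score u\<bar> + G u * (1 + \<bar>u\<bar>)) * \<bar>a - b\<bar>"
proof -
  have "norm (loss f (u + a) - loss f (u + b)) \<le> (\<bar>score u\<bar> + G u * (1 + \<bar>u\<bar>)) * norm ((u + a) - (u + b))"
  proof (rule field_differentiable_bound)
    let ?S = "{u - (1 + \<bar>u\<bar>) * r0 .. u + (1 + \<bar>u\<bar>) * r0}"
    show "convex ?S" by simp
    show "u + a \<in> ?S" "u + b \<in> ?S" using a b by (auto simp: abs_le_iff)
    fix z assume z: "z \<in> ?S"
    show "(loss f has_field_derivative score z) (at z within ?S)"
      by (rule has_field_derivative_at_within[OF DERIV_loss])
    have az: "\<bar>z - u\<bar> \<le> (1 + \<bar>u\<bar>) * r0" using z by (auto simp: abs_le_iff)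
    also have "\<dots> \<le> (1 + \<bar>u\<bar>) * 1" using r0 by (intro mult_left_mono) auto
    finally have "G u * \<bar>z - u\<bar> \<le> G u * (1 + \<bar>u\<bar>)"
      using G_pos[of u] by (intro mult_left_mono) auto
    moreover have "\<bar>score z - score u\<bar> \<le> G u * \<bar>z - u\<bar>"
      using score_diff_le[OF u az] by simp
    ultimately show "norm (score z) \<le> \<bar>score u\<bar> + G u * (1 + \<bar>u\<bar>)" by simp
  qed
  then show ?thesis by simp
qed

text \<open>Mean value bound for the loss minus its tangent at \<open>u\<close>; it provides the
  first-order comparison behind \<open>score_mean_zero\<close>.\<close>

lemma loss_linear_approx:
  assumes u: "u \<in> regular_pts" and a: "\<bar>a\<bar> \<le> (1 + \<bar>u\<bar>) * r0"
  shows "\<bar>loss f (u + a) - loss f u - a * score u\<bar> \<le> G u * a\<^sup>2"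
proof -
  have "norm ((loss f (u + a) - score u * (u + a)) - (loss f u - score u * u)) \<le> (G u * \<bar>a\<bar>) * norm ((u + a) - u)"
  proof (rule field_differentiable_bound)
    let ?S = "{u - \<bar>a\<bar> .. u + \<bar>a\<bar>}"
    show "convex ?S" by simp
    show "u + a \<in> ?S" "u \<in> ?S" by (auto simp: abs_le_iff)
    fix z assume z: "z \<in> ?S"
    show "((\<lambda>z. loss f z - score u * z) has_field_derivative (score z - score u)) (at z within ?S)"
      by (rule has_field_derivative_at_within) (auto intro!: derivative_eq_intros DERIV_loss)
    have az: "\<bar>z - u\<bar> \<le> \<bar>a\<bar>" using z by (auto simp: abs_le_iff)
    then have "\<bar>score z - score u\<bar> \<le> G u * \<bar>z - u\<bar>"
      using score_diff_le[OF u, of "z - u"] a by simp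
    also have "\<dots> \<le> G u * \<bar>a\<bar>" using az G_pos[of u] by (intro mult_left_mono) auto
    finally show "norm (score z - score u) \<le> G u * \<bar>a\<bar>" by simp
  qed
  then show ?thesis by (simp add: algebra_simps power2_eq_square flip: abs_mult)
qed

text \<open>\<open>uniform_deviation\<close> asks for a Lipschitz bound at every \<open>u\<close>.
  Setting the differences to zero off \<open>regular_pts\<close> provides it and changes them only
  on a null set.\<close>

definition loss_diff :: "real \<Rightarrow> real \<Rightarrow> real \<Rightarrow> real" where
  "loss_diff c e u = (if u \<in> regular_pts then loss f ((1 + e) * u - c) - loss f u else 0)"

definition score_diff :: "real \<Rightarrow> real \<Rightarrow> real \<Rightarrow> real" where
  "score_diff c e u = (if u \<in> regular_pts then score ((1 + e) * u - c) - score u else 0)"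

lemma loss_diff_measurable [measurable]: "loss_diff c e \<in> borel_measurable borel"
  unfolding loss_diff_def[abs_def] by measurable

lemma score_diff_measurable [measurable]: "score_diff c e \<in> borel_measurable borel"
  unfolding score_diff_def[abs_def] by measurable

lemma loss_diff_0: "loss_diff 0 0 u = 0" and score_diff_0: "score_diff 0 0 u = 0"
  by (simp_all add: loss_diff_def score_diff_def)

lemma shift_le:
  assumes "\<bar>c\<bar> \<le> r0" "\<bar>e\<bar> \<le> r0"
  shows "\<bar>e * u - c\<bar> \<le> (1 + \<bar>u\<bar>) * r0"
proof -
  have "\<bar>e * u - c\<bar> \<le> \<bar>e\<bar> * \<bar>u\<bar> + \<bar>c\<bar>" by (metis abs_mult abs_triangle_ineq4)
  also have "\<dots> \<le> r0 * \<bar>u\<bar> + r0" using assms by (intro add_mono mult_right_mono) auto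
  finally show ?thesis by (simp add: algebra_simps)
qed

lemma shift_diff_le: "\<bar>(e * u - c) - (e' * u - c')\<bar> \<le> (1 + \<bar>u\<bar>) * (\<bar>c - c'\<bar> + \<bar>e - e'\<bar>)" for u :: real
proof -
  have "(e * u - c) - (e' * u - c') = (e - e') * u - (c - c')" by (simp add: algebra_simps)
  also have "\<bar>\<dots>\<bar> \<le> \<bar>e - e'\<bar> * \<bar>u\<bar> + \<bar>c - c'\<bar>" by (metis abs_mult abs_triangle_ineq4)
  also have "\<dots> \<le> (1 + \<bar>u\<bar>) * (\<bar>c - c'\<bar> + \<bar>e - e'\<bar>)" by (simp add: algebra_simps)
  finally show ?thesis .
qed

lemma
  assumes "\<bar>c\<bar> \<le> r0" "\<bar>e\<bar> \<le> r0" "\<bar>c'\<bar> \<le> r0" "\<bar>e'\<bar> \<le> r0"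
  shows loss_diff_lip: "\<bar>loss_diff c e u - loss_diff c' e' u\<bar> \<le> envelope u * (\<bar>c - c'\<bar> + \<bar>e - e'\<bar>)"
    and score_diff_lip: "\<bar>score_diff c e u - score_diff c' e' u\<bar> \<le> envelope u * (\<bar>c - c'\<bar> + \<bar>e - e'\<bar>)"
proof -
  define D where "D = \<bar>c - c'\<bar> + \<bar>e - e'\<bar>"
  define a where "a = e * u - c"
  define a' where "a' = e' * u - c'"
  have D: "D \<ge> 0" by (simp add: D_def)
  have aa: "\<bar>a - a'\<bar> \<le> (1 + \<bar>u\<bar>) * D"
    unfolding D_def a_def a'_def by (rule shift_diff_le)
  have eq: "(1 + e) * u - c = u + a" "(1 + e') * u - c' = u + a'"
    by (simp_all add: a_def a'_def algebra_simps)
  have bd: "\<bar>a\<bar> \<le> (1 + \<bar>u\<bar>) * r0" "\<bar>a'\<bar> \<le> (1 + \<bar>u\<bar>) * r0"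
    unfolding a_def a'_def using assms by (auto intro: shift_le)
  have H: "0 \<le> \<bar>score u\<bar> + G u * (1 + \<bar>u\<bar>)" "G u \<le> \<bar>score u\<bar> + G u * (1 + \<bar>u\<bar>)"
    using G_pos[of u] by (auto simp: algebra_simps)
  show "\<bar>loss_diff c e u - loss_diff c' e' u\<bar> \<le> envelope u * D"
  proof (cases "u \<in> regular_pts")
    case True
    have "\<bar>loss_diff c e u - loss_diff c' e' u\<bar> = \<bar>loss f (u + a) - loss f (u + a')\<bar>"
      using True by (simp add: loss_diff_def eq)
    also have "\<dots> \<le> (\<bar>score u\<bar> + G u * (1 + \<bar>u\<bar>)) * \<bar>a - a'\<bar>"
      by (rule loss_diff_le[OF True bd])
    also have "\<dots> \<le> (\<bar>score u\<bar> + G u * (1 + \<bar>u\<bar>)) * ((1 + \<bar>u\<bar>) * D)"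
      by (rule mult_left_mono[OF aa H(1)])
    finally show ?thesis by (simp add: envelope_def mult.assoc)
  qed (use envelope_nonneg[of u] D in \<open>simp add: loss_diff_def\<close>)
  show "\<bar>score_diff c e u - score_diff c' e' u\<bar> \<le> envelope u * D"
  proof (cases "u \<in> regular_pts")
    case True
    have "\<bar>score_diff c e u - score_diff c' e' u\<bar> = \<bar>score (u + a) - score (u + a')\<bar>"
      using True by (simp add: score_diff_def eq)
    also have "\<dots> \<le> G u * \<bar>a - a'\<bar>"
      by (rule regular_pts_lip[OF True bd])
    also have "\<dots> \<le> (\<bar>score u\<bar> + G u * (1 + \<bar>u\<bar>)) * ((1 + \<bar>u\<bar>) * D)"
      using H by (intro mult_mono aa) auto
    finally show ?thesis by (simp add: envelope_def mult.assoc)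
  qed (use envelope_nonneg[of u] D in \<open>simp add: score_diff_def\<close>)
qed

lemma loss_diff_integrable:
  assumes "\<bar>c\<bar> \<le> r0" "\<bar>e\<bar> \<le> r0"
  shows "integrable (noise f) (loss_diff c e)"
proof (rule Bochner_Integration.integrable_bound)
  show "integrable (noise f) (\<lambda>u. envelope u * (\<bar>c\<bar> + \<bar>e\<bar>))"
    using envelope_integrable by simp
  show "AE u in noise f. norm (loss_diff c e u) \<le> norm (envelope u * (\<bar>c\<bar> + \<bar>e\<bar>))"
    using loss_diff_lip[OF assms, of 0 0] r0 envelope_nonneg
    by (intro AE_I2) (auto simp: loss_diff_0)
qed measurable

lemma AE_loss_diff: "AE u in noise f. loss_diff c e u = loss f ((1 + e) * u - c) - loss f u"
  using regular_pts_AE by eventually_elim (simp add: loss_diff_def)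

text \<open>Gibbs' inequality: \<open>u \<mapsto> (1 + e) f ((1 + e) u - c)\<close> is again a probability density.\<close>

lemma loss_diff_ge_ln:
  assumes "\<bar>c\<bar> \<le> r0" "\<bar>e\<bar> \<le> r0"
  shows "(\<integral>u. loss_diff c e u \<partial>noise f) \<ge> ln (1 + e)"
proof -
  define d where "d = 1 + e"
  have d: "d > 0" using assms r0 by (auto simp: d_def abs_le_iff)
  \<comment> \<open>The ratio of the transformed density to \<open>f\<close>: it has mean 1, and
    almost everywhere the loss difference is \<open>ln d - ln (\<phi> u)\<close>, so
    \<open>ln (\<phi> u) \<le> \<phi> u - 1\<close> suffices.\<close>
  define \<phi> where "\<phi> u = d * f (d * u - c) / f u" for u
  have \<phi>_meas [measurable]: "\<phi> \<in> borel_measurable borel" unfolding \<phi>_def by measurable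
  have \<phi>_pos: "\<phi> u > 0" for u using d f_pos by (simp add: \<phi>_def)
  have "(\<integral>\<^sup>+u. ennreal (\<phi> u) \<partial>noise f) = (\<integral>\<^sup>+u. ennreal (f u) * ennreal (\<phi> u) \<partial>lborel)"
    unfolding noise_def by (subst nn_integral_density) auto
  also have "\<dots> = (\<integral>\<^sup>+u. ennreal \<bar>d\<bar> * ennreal (f (- c + d * u)) \<partial>lborel)"
  proof (rule nn_integral_cong)
    fix u
    have "ennreal (f u) * ennreal (\<phi> u) = ennreal (f u * \<phi> u)"
      using f_pos by (simp add: ennreal_mult' less_imp_le)
    also have "f u * \<phi> u = \<bar>d\<bar> * f (- c + d * u)"
      using f_pos[of u] d by (simp add: \<phi>_def)
    finally show "ennreal (f u) * ennreal (\<phi> u) = ennreal \<bar>d\<bar> * ennreal (f (- c + d * u))"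
      by (simp add: ennreal_mult')
  qed
  also have "\<dots> = (\<integral>\<^sup>+u. ennreal (f u) \<partial>lborel)"
    by (subst (2) nn_integral_real_affine[of _ d "- c"]) (use d in \<open>auto simp: nn_integral_cmult\<close>)
  also have "\<dots> = emeasure (noise f) (space (noise f))"
    unfolding noise_def by (subst emeasure_density) auto
  also have "\<dots> = 1" by (rule N.emeasure_space_1)
  finally have \<phi>1: "(\<integral>\<^sup>+u. ennreal (\<phi> u) \<partial>noise f) = 1" .
  have \<phi>_int: "integrable (noise f) \<phi>"
    by (rule integrableI_nonneg) (use \<phi>1 \<phi>_pos in \<open>auto simp: less_imp_le\<close>)
  have \<phi>_val: "(\<integral>u. \<phi> u \<partial>noise f) = 1"
    by (subst integral_eq_nn_integral) (use \<phi>1 \<phi>_pos in \<open>auto simp: less_imp_le\<close>)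
  have "(\<integral>u. ln d + (1 - \<phi> u) \<partial>noise f) \<le> (\<integral>u. loss_diff c e u \<partial>noise f)"
  proof (rule integral_mono_AE)
    show "AE u in noise f. ln d + (1 - \<phi> u) \<le> loss_diff c e u"
      using AE_loss_diff[of c e]
    proof eventually_elim
      case (elim u)
      have "ln (\<phi> u) \<le> \<phi> u - 1" by (rule ln_le_minus_one[OF \<phi>_pos])
      moreover have "ln (\<phi> u) = ln d + ln (f (d * u - c)) - ln (f u)"
        using d f_pos[of u] f_pos[of "d * u - c"] by (simp add: \<phi>_def ln_div ln_mult)
      ultimately show ?case using elim by (simp add: loss_def d_def)
    qed
  qed (use \<phi>_int loss_diff_integrable[OF assms] in auto)
  also have "(\<integral>u. ln d + (1 - \<phi> u) \<partial>noise f) = ln d"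
    using \<phi>_int \<phi>_val N.prob_space by simp
  finally show ?thesis by (simp add: d_def)
qed

section \<open>The mean score and the growth of the population risk\<close>

lemma score_integrable: "integrable (noise f) score"
  by (rule N.square_integrable_imp_integrable[OF _ int_score]) measurable

lemma G_integrable: "integrable (noise f) G"
  by (rule N.square_integrable_imp_integrable[OF _ int_G]) measurable

text \<open>No differentiation under the integral: Gibbs' inequality says that a pure shift by
  \<open>c\<close> has nonnegative expected loss difference, and the tangent bound makes it at most
  \<open>- c * m + c\<^sup>2 * E\<close>. Taking both signs of \<open>c\<close> and letting
  \<open>c\<close> tend to 0 forces \<open>m = 0\<close>.\<close>

lemma score_mean_zero: "(\<integral>u. score u \<partial>noise f) = 0"
proof -
  define m where "m = (\<integral>u. score u \<partial>noise f)"
  define E where "E = (\<integral>u. G u \<partial>noise f)"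
  have E: "E \<ge> 0" unfolding E_def using G_pos by (intro integral_nonneg_AE AE_I2) (auto simp: less_imp_le)
  have le: "c * m \<le> c\<^sup>2 * E" if c: "\<bar>c\<bar> \<le> r0" for c
  proof -
    have "0 \<le> (\<integral>u. loss_diff c 0 u \<partial>noise f)"
      using loss_diff_ge_ln[OF c, of 0] r0 by simp
    also have "\<dots> \<le> (\<integral>u. - c * score u + c\<^sup>2 * G u \<partial>noise f)"
    proof (rule integral_mono_AE)
      show "AE u in noise f. loss_diff c 0 u \<le> - c * score u + c\<^sup>2 * G u"
        using regular_pts_AE
      proof eventually_elim
        case (elim u)
        have "\<bar>- c\<bar> \<le> (1 + \<bar>u\<bar>) * r0" using shift_le[OF c, of 0 u] r0 by simp
        from loss_linear_approx[OF elim this] show ?case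
          using elim by (simp add: loss_diff_def mult.commute)
      qed
    qed (use loss_diff_integrable[OF c, of 0] r0 score_integrable G_integrable in auto)
    also have "\<dots> = - c * m + c\<^sup>2 * E"
      using score_integrable G_integrable by (simp add: m_def E_def)
    finally show ?thesis by simp
  qed
  have "\<bar>m\<bar> \<le> c * E" if c: "0 < c" "c \<le> r0" for c
  proof -
    have "c * m \<le> c * (c * E)" "c * (- m) \<le> c * (c * E)"
      using le[of c] le[of "- c"] c by (auto simp: power2_eq_square)
    then have "m \<le> c * E" "- m \<le> c * E"
      using c(1) by (simp_all only: mult_le_cancel_left_pos)
    then show ?thesis by (rule abs_leI)
  qed
  then have "\<forall>\<^sub>F c in at_right 0. \<bar>m\<bar> \<le> c * E"
    unfolding eventually_at_right_field using r0 by (intro exI[of _ r0]) auto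
  moreover have "((\<lambda>c. c * E) \<longlongrightarrow> 0 * E) (at_right 0)"
    by (intro tendsto_intros)
  ultimately have "\<bar>m\<bar> \<le> 0 * E"
    by (intro tendsto_lowerbound[of "\<lambda>c. c * E" "0 * E" "at_right 0"]) auto
  then show ?thesis by (simp add: m_def)
qed

lemma risk_diff:
  fixes z :: "real ^ 2"
  assumes "\<bar>z $ 1\<bar> \<le> r0" "\<bar>z $ 2 - 1\<bar> \<le> r0"
  shows "risk f z - risk f (vector [0, 1]) = (\<integral>u. loss_diff (z $ 1) (z $ 2 - 1) u \<partial>noise f)"
proof -
  have i: "integrable (noise f) (loss_diff (z $ 1) (z $ 2 - 1))"
    by (rule loss_diff_integrable[OF assms])
  have "(\<integral>u. loss f (z $ 2 * u - z $ 1) \<partial>noise f) = (\<integral>u. loss_diff (z $ 1) (z $ 2 - 1) u + loss f u \<partial>noise f)"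
  proof (rule integral_cong_AE)
    show "AE u in noise f. loss f (z $ 2 * u - z $ 1) = loss_diff (z $ 1) (z $ 2 - 1) u + loss f u"
      using AE_loss_diff[of "z $ 1" "z $ 2 - 1"] by eventually_elim simp
  qed measurable
  also have "\<dots> = (\<integral>u. loss_diff (z $ 1) (z $ 2 - 1) u \<partial>noise f) + (\<integral>u. loss f u \<partial>noise f)"
    using i int_loss by (rule Bochner_Integration.integral_add)
  finally show ?thesis by (simp add: risk_def)
qed

text \<open>Gibbs' inequality is the lower bound that \<open>quadratic_growth\<close> asks for.
  Capping \<open>\<kappa>\<close> at 1 is a normalisation that later turns a risk gap of
  \<open>\<kappa> * \<rho>\<^sup>2 / 2\<close> into one of
  \<open>\<rho>\<^sup>2 / 2\<close>.\<close>

lemma expected_loss_growth: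
  assumes hess: "has_hessian (risk f) A (vector [0, 1])"
    and pos: "\<And>v. v \<noteq> 0 \<Longrightarrow> inner v (A *v v) > 0"
  shows "\<exists>\<kappa> \<epsilon>. 0 < \<kappa> \<and> \<kappa> \<le> 1 \<and> 0 < \<epsilon> \<and> \<epsilon> \<le> r0 \<and> (\<forall>c e. \<bar>c\<bar> \<le> \<epsilon> \<longrightarrow> \<bar>e\<bar> \<le> \<epsilon> \<longrightarrow>
    (\<integral>u. loss_diff c e u \<partial>noise f) - ln (1 + e) \<ge> \<kappa> * (c\<^sup>2 + e\<^sup>2))"
proof -
  define z0 :: "real ^ 2" where "z0 = vector [0, 1]"
  have z0: "z0 $ 1 = 0" "z0 $ 2 = 1" by (simp_all add: z0_def)
  have rd: "risk f (z0 + v) - risk f z0 = (\<integral>u. loss_diff (v $ 1) (v $ 2) u \<partial>noise f)"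
    if "\<bar>v $ 1\<bar> \<le> r0" "\<bar>v $ 2\<bar> \<le> r0" for v
    using risk_diff[of "z0 + v"] that unfolding z0_def[symmetric] by (simp add: z0)
  have "\<exists>\<kappa>>0. \<exists>\<epsilon>>0. \<forall>v. norm v < \<epsilon> \<longrightarrow> risk f (z0 + v) - risk f z0 - ln (1 + v $ 2) \<ge> \<kappa> * (norm v)\<^sup>2"
  proof (rule quadratic_growth[OF hess[folded z0_def] z0(2) pos r0(1)])
    fix v :: "real ^ 2" assume "norm v < r0"
    then have "\<bar>v $ 1\<bar> \<le> r0" "\<bar>v $ 2\<bar> \<le> r0"
      using component_le_norm_cart[of v 1] component_le_norm_cart[of v 2] by linarith+
    then show "ln (1 + v $ 2) \<le> risk f (z0 + v) - risk f z0"
      using rd loss_diff_ge_ln by simp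
  qed
  then obtain \<kappa> \<epsilon> where \<kappa>: "\<kappa> > 0" "\<epsilon> > 0"
    "\<And>v. norm v < \<epsilon> \<Longrightarrow> risk f (z0 + v) - risk f z0 - ln (1 + v $ 2) \<ge> \<kappa> * (norm v)\<^sup>2"
    by blast
  \<comment> \<open>Two coordinates of size at most \<open>\<epsilon> / 3\<close> keep the norm
    strictly below \<open>\<epsilon>\<close>.\<close>
  define \<epsilon>' where "\<epsilon>' = min r0 (\<epsilon> / 3)"
  have "(\<integral>u. loss_diff c e u \<partial>noise f) - ln (1 + e) \<ge> min \<kappa> 1 * (c\<^sup>2 + e\<^sup>2)"
    if ce: "\<bar>c\<bar> \<le> \<epsilon>'" "\<bar>e\<bar> \<le> \<epsilon>'" for c e
  proof -
    define v :: "real ^ 2" where "v = vector [c, e]"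
    have v: "v $ 1 = c" "v $ 2 = e" by (simp_all add: v_def)
    have "norm v \<le> \<bar>v $ 1\<bar> + \<bar>v $ 2\<bar>" using norm_le_l1_cart[of v] by (simp add: sum_2)
    also have "\<dots> < \<epsilon>" using ce \<kappa>(2) by (simp add: v \<epsilon>'_def)
    finally have "\<kappa> * (norm v)\<^sup>2 \<le> (\<integral>u. loss_diff c e u \<partial>noise f) - ln (1 + e)"
      using \<kappa>(3)[of v] rd[of v] ce by (simp add: v \<epsilon>'_def)
    moreover have "min \<kappa> 1 * (c\<^sup>2 + e\<^sup>2) \<le> \<kappa> * (c\<^sup>2 + e\<^sup>2)" by (intro mult_right_mono) auto
    ultimately show ?thesis by (simp add: norm_real_2_eq v)
  qed
  then show ?thesis using \<kappa>(1,2) r0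
    by (intro exI[of _ "min \<kappa> 1"] exI[of _ \<epsilon>']) (auto simp: \<epsilon>'_def)
qed

end

section \<open>Null fits of the exp-Lasso\<close>

text \<open>With \<open>d = 1 / s\<close> and \<open>c\<close> the intercept error divided by
  \<open>s\<close>, the standardised residuals are affine in \<open>(c, d)\<close> and
  \<open>ln s\<close> becomes the convex term \<open>- ln d\<close>. A convex loss thus gives a
  jointly convex risk.\<close>

definition loc_scale_risk :: "(real \<Rightarrow> real) \<Rightarrow> nat \<Rightarrow> (nat \<Rightarrow> real) \<Rightarrow> real \<Rightarrow> real \<Rightarrow> real" where
  "loc_scale_risk f n e c d = (1 / real n) * (\<Sum>i<n. loss f (d * e i - c)) - ln d"

lemma row_mult_two:
  assumes "0 < p" "j \<in> {1..<p}" "\<And>k. k \<in> {1..<p} \<Longrightarrow> k \<noteq> j \<Longrightarrow> b k = 0"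
  shows "row_mult p v b = v 0 * b 0 + v j * b j"
proof -
  have "row_mult p v b = (\<Sum>k\<in>{0, j}. v k * b k)"
    unfolding row_mult_def by (rule sum.mono_neutral_right) (use assms in auto)
  then show ?thesis using assms by simp
qed

lemma row_mult_intercept:
  assumes "0 < p" "\<And>k. k \<in> {1..<p} \<Longrightarrow> b k = 0"
  shows "row_mult p v b = v 0 * b 0"
proof -
  have "row_mult p v b = (\<Sum>k\<in>{0}. v k * b k)"
    unfolding row_mult_def by (rule sum.mono_neutral_right) (use assms in auto)
  then show ?thesis by simp
qed

lemma emp_risk_residual:
  assumes "n > 0" "s > 0"
    and "\<And>i. i < n \<Longrightarrow> y i - row_mult p (x i) b = s * u i"
  shows "emp_risk f n p x y b s = (1 / real n) * (\<Sum>i<n. loss f (u i)) + ln s"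
proof -
  have "(\<Sum>i<n. loss f ((y i - row_mult p (x i) b) / s) + ln s) = (\<Sum>i<n. loss f (u i) + ln s)"
    using assms by (intro sum.cong refl) simp
  then show ?thesis using assms(1) by (simp add: emp_risk_def sum.distrib distrib_left)
qed

text \<open>Difference quotients from the right bound \<open>D\<close> below by
  \<open>- lam\<close>, those from the left bound it above by \<open>lam\<close>.\<close>

lemma penalized_min_derivative_bound:
  fixes \<phi> :: "real \<Rightarrow> real"
  assumes D: "DERIV \<phi> 0 :> D" and min: "\<And>t. \<phi> 0 \<le> \<phi> t + lam * \<bar>t\<bar>"
  shows "\<bar>D\<bar> \<le> lam"
proof -
  have lim: "((\<lambda>t. (\<phi> t - \<phi> 0) / t) \<longlongrightarrow> D) (at 0)"
    using D by (simp add: DERIV_def)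
  have "\<forall>\<^sub>F t in at_right 0. - lam \<le> (\<phi> t - \<phi> 0) / t"
    unfolding eventually_at_right_field
  proof (intro exI[of _ 1] conjI allI impI)
    fix t :: real assume "0 < t"
    then show "- lam \<le> (\<phi> t - \<phi> 0) / t" using min[of t] by (simp add: pos_le_divide_eq)
  qed simp
  moreover have "((\<lambda>t. (\<phi> t - \<phi> 0) / t) \<longlongrightarrow> D) (at_right 0)"
    using lim by (rule filterlim_mono) (auto simp: at_le)
  ultimately have "- lam \<le> D"
    by (intro tendsto_lowerbound[of "\<lambda>t. (\<phi> t - \<phi> 0) / t" D "at_right 0"]) auto
  moreover have "\<forall>\<^sub>F t in at_left 0. (\<phi> t - \<phi> 0) / t \<le> lam"
    unfolding eventually_at_left_field
  proof (intro exI[of _ "-1"] conjI allI impI)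
    fix t :: real assume "t < 0"
    then show "(\<phi> t - \<phi> 0) / t \<le> lam" using min[of t] by (simp add: neg_divide_le_eq)
  qed simp
  moreover have "((\<lambda>t. (\<phi> t - \<phi> 0) / t) \<longlongrightarrow> D) (at_left 0)"
    using lim by (rule filterlim_mono) (auto simp: at_le)
  ultimately have "D \<le> lam"
    by (intro tendsto_upperbound[of "\<lambda>t. (\<phi> t - \<phi> 0) / t" D "at_left 0"]) auto
  with \<open>- lam \<le> D\<close> show ?thesis by (simp add: abs_le_iff)
qed

lemma loc_scale_risk_convex:
  assumes conv: "convex_on UNIV (loss f)" and d: "d > 0" and t: "0 \<le> t" "t \<le> 1"
  shows "loc_scale_risk f n e (t * c) (1 + t * (d - 1)) \<le>
    (1 - t) * loc_scale_risk f n e 0 1 + t * loc_scale_risk f n e c d"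
proof -
  have "loss f ((1 + t * (d - 1)) * e i - t * c) \<le> (1 - t) * loss f (e i) + t * loss f (d * e i - c)" for i
  proof -
    have "(1 + t * (d - 1)) * e i - t * c = (1 - t) *\<^sub>R e i + t *\<^sub>R (d * e i - c)"
      by (simp add: algebra_simps)
    then show ?thesis using convex_onD[OF conv t, of "e i" "d * e i - c"] by simp
  qed
  then have "(\<Sum>i<n. loss f ((1 + t * (d - 1)) * e i - t * c)) \<le>
      (\<Sum>i<n. (1 - t) * loss f (e i) + t * loss f (d * e i - c))"
    by (rule sum_mono)
  then have s: "(1 / real n) * (\<Sum>i<n. loss f ((1 + t * (d - 1)) * e i - t * c)) \<le>
      (1 / real n) * (\<Sum>i<n. (1 - t) * loss f (e i) + t * loss f (d * e i - c))"
    by (rule mult_left_mono) simp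
  have "concave_on {0<..} (ln :: real \<Rightarrow> real)" by (rule ln_concave)
  from concave_onD[OF this t, of 1 d] d have "(1 - t) * ln 1 + t * ln d \<le> ln (1 + t * (d - 1))"
    by (simp add: algebra_simps)
  moreover have "(1 / real n) * (\<Sum>i<n. (1 - t) * loss f (e i) + t * loss f (d * e i - c)) =
      (1 - t) * ((1 / real n) * (\<Sum>i<n. loss f (e i))) + t * ((1 / real n) * (\<Sum>i<n. loss f (d * e i - c)))"
    unfolding sum.distrib sum_distrib_left[symmetric] by (simp only: distrib_left mult.left_commute)
  ultimately show ?thesis
    using s unfolding loc_scale_risk_def by (simp add: right_diff_distrib)
qed

text \<open>The segment from the truth to a point outside the square crosses its boundary. There the
  risk exceeds its value at the truth, whereas convexity keeps it below whenever the outer end is no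
  worse than the truth.\<close>

lemma loc_scale_risk_localization:
  assumes conv: "convex_on UNIV (loss f)" and d: "d > 0" and \<rho>: "\<rho> > 0"
    and boundary: "\<And>c' h. max \<bar>c'\<bar> \<bar>h\<bar> = \<rho> \<Longrightarrow> loc_scale_risk f n e 0 1 < loc_scale_risk f n e c' (1 + h)"
    and le: "loc_scale_risk f n e c d \<le> loc_scale_risk f n e 0 1"
  shows "\<bar>c\<bar> \<le> \<rho> \<and> \<bar>d - 1\<bar> \<le> \<rho>"
proof (rule ccontr)
  assume neg: "\<not> ?thesis"
  define m where "m = max \<bar>c\<bar> \<bar>d - 1\<bar>"
  have m: "m > \<rho>" using neg by (auto simp: m_def)
  define t where "t = \<rho> / m"
  have t: "0 < t" "t \<le> 1" using m \<rho> by (auto simp: t_def)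
  have "max \<bar>t * c\<bar> \<bar>t * (d - 1)\<bar> = t * m"
    using t by (simp add: m_def abs_mult max_mult_distrib_left)
  also have "\<dots> = \<rho>" using m \<rho> by (simp add: t_def)
  finally have "loc_scale_risk f n e 0 1 < loc_scale_risk f n e (t * c) (1 + t * (d - 1))"
    by (rule boundary)
  also have "\<dots> \<le> (1 - t) * loc_scale_risk f n e 0 1 + t * loc_scale_risk f n e c d"
    using t by (intro loc_scale_risk_convex[OF conv d]) auto
  also have "\<dots> \<le> (1 - t) * loc_scale_risk f n e 0 1 + t * loc_scale_risk f n e 0 1"
    using t le by (intro add_left_mono mult_left_mono) auto
  finally show False by (simp add: algebra_simps)
qed

text \<open>Two families of competitors are used. Those without penalised coefficients pay no
  penalty, so the fit minimises the location-scale risk globally. Those moving one coordinate at the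
  fitted scale give stationarity; the chain rule contributes the exponential factor and the factor
  \<open>d\<close>.\<close>

lemma exp_lasso_null_conditions:
  assumes lasso: "is_exp_lasso f n p x y lam b s"
    and null: "\<And>j. j \<in> {1..<p} \<Longrightarrow> b j = 0"
    and n: "n > 0" and p: "p > 0"
    and x0: "\<And>i. i < n \<Longrightarrow> x i 0 = 1"
    and y: "\<And>i. i < n \<Longrightarrow> y i = b0 + e i"
    and diff: "\<And>u. DERIV (loss f) u :> deriv (loss f) u"
  shows "\<exists>c d. d > 0 \<and> (\<forall>c' d'. d' > 0 \<longrightarrow> loc_scale_risk f n e c d \<le> loc_scale_risk f n e c' d') \<and>
    (\<forall>j\<in>{1..<p}. exp (loc_scale_risk f n e c d) *
      \<bar>d * ((1 / real n) * (\<Sum>i<n. deriv (loss f) (d * e i - c) * x i j))\<bar> \<le> lam)"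
proof -
  have s: "s > 0"
    and min': "\<And>b' s'. \<not> (s' > 0 \<and> exp_lasso_objective f n p x y lam (b', s') < exp_lasso_objective f n p x y lam (b, s))"
    using lasso unfolding is_exp_lasso_def is_arg_min_def by auto
  have min: "exp_lasso_objective f n p x y lam (b, s) \<le> exp_lasso_objective f n p x y lam (b', s')" if "s' > 0" for b' s'
    using min'[of s' b'] that by (simp add: not_less)
  define d where "d = 1 / s"
  define c where "c = (b 0 - b0) / s"
  have d: "d > 0" using s by (simp add: d_def)
  have risk0: "emp_risk f n p x y b' s' = loc_scale_risk f n e ((b' 0 - b0) / s') (1 / s')"
    if "s' > 0" "\<And>j. j \<in> {1..<p} \<Longrightarrow> b' j = 0" for b' s'
  proof -
    have "emp_risk f n p x y b' s' = (1 / real n) * (\<Sum>i<n. loss f ((1 / s') * e i - (b' 0 - b0) / s')) + ln s'"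
      by (rule emp_risk_residual[OF n that(1)])
        (use that x0 y row_mult_intercept[OF p, of b'] in \<open>simp add: field_simps\<close>)
    then show ?thesis using that(1) by (simp add: loc_scale_risk_def ln_div)
  qed
  have pen0: "(\<Sum>j\<in>{1..<p}. \<bar>b' j\<bar>) = 0" if "\<And>j. j \<in> {1..<p} \<Longrightarrow> b' j = 0" for b' :: "nat \<Rightarrow> real"
    using that by simp
  have obj: "exp_lasso_objective f n p x y lam (b, s) = exp (loc_scale_risk f n e c d)"
  proof -
    have "(\<Sum>j\<in>{1..<p}. \<bar>b j\<bar>) = 0" by (rule pen0, rule null)
    moreover have "emp_risk f n p x y b s = loc_scale_risk f n e c d"
      unfolding c_def d_def by (rule risk0[OF s], rule null)
    ultimately show ?thesis unfolding exp_lasso_objective_def prod.case by simp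
  qed
  show ?thesis
  proof (rule exI[of _ c], rule exI[of _ d], intro conjI d allI impI ballI)
    fix c' d' :: real assume d': "d' > 0"
    \<comment> \<open>The intercept and scale \<open>1 / d'\<close> that the reparametrisation sends
      to \<open>(c', d')\<close>.\<close>
    define b' :: "nat \<Rightarrow> real" where "b' = (\<lambda>j. if j = 0 then b0 + c' / d' else 0)"
    have b': "b' j = 0" if "j \<in> {1..<p}" for j using that by (auto simp: b'_def)
    have s': "1 / d' > 0" using d' by simp
    have "exp (loc_scale_risk f n e c d) \<le> exp_lasso_objective f n p x y lam (b', 1 / d')"
      using min[OF s', of b'] unfolding obj .
    also have "\<dots> = exp (loc_scale_risk f n e c' d')"
    proof -
      have "(\<Sum>j\<in>{1..<p}. \<bar>b' j\<bar>) = 0" by (rule pen0, rule b')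
      moreover have "emp_risk f n p x y b' (1 / d') = loc_scale_risk f n e c' d'"
        using risk0[OF s', of b'] b' d' by (simp add: b'_def)
      ultimately show ?thesis unfolding exp_lasso_objective_def prod.case by simp
    qed
    finally show "loc_scale_risk f n e c d \<le> loc_scale_risk f n e c' d'" by simp
  next
    fix j assume j: "j \<in> {1..<p}"
    \<comment> \<open>In this block \<open>\<rho>\<close> is the empirical risk along coordinate
      \<open>j\<close> at the fitted scale, not a radius.\<close>
    define \<rho> where "\<rho> t = (1 / real n) * (\<Sum>i<n. loss f (d * e i - c - t * (d * x i j))) + ln s" for t
    have risk_t: "emp_risk f n p x y (fun_upd b j t) s = \<rho> t" for t
      unfolding \<rho>_def
    proof (rule emp_risk_residual[OF n s])
      fix i assume i: "i < n"
      have "row_mult p (x i) (fun_upd b j t) = x i 0 * fun_upd b j t 0 + x i j * fun_upd b j t j"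
        by (rule row_mult_two[OF p j]) (use null in auto)
      then have "row_mult p (x i) (fun_upd b j t) = b 0 + t * x i j"
        using j x0[OF i] by simp
      then show "y i - row_mult p (x i) (fun_upd b j t) = s * (d * e i - c - t * (d * x i j))"
        using s y[OF i] by (simp add: c_def d_def field_simps)
    qed
    have \<rho>0: "\<rho> 0 = loc_scale_risk f n e c d"
      using s by (simp add: \<rho>_def loc_scale_risk_def d_def ln_div)
    have pen: "(\<Sum>k\<in>{1..<p}. \<bar>fun_upd b j t k\<bar>) = \<bar>t\<bar>" for t
    proof -
      have "(\<Sum>k\<in>{1..<p}. \<bar>fun_upd b j t k\<bar>) = (\<Sum>k\<in>{j}. \<bar>fun_upd b j t k\<bar>)"
        by (rule sum.mono_neutral_right) (use j null in auto)
      then show ?thesis by simp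
    qed
    have "exp (\<rho> 0) \<le> exp (\<rho> t) + lam * \<bar>t\<bar>" for t
      using min[OF s, of "fun_upd b j t"]
      unfolding obj unfolding \<rho>0 exp_lasso_objective_def prod.case pen risk_t .
    moreover have "DERIV (\<lambda>t. exp (\<rho> t)) 0 :> exp (\<rho> 0) * ((1 / real n) * (\<Sum>i<n. deriv (loss f) (d * e i - c) * (- (d * x i j))))"
    proof -
      have "DERIV (\<lambda>t. loss f (d * e i - c - t * (d * x i j))) 0 :> deriv (loss f) (d * e i - c) * (- (d * x i j))" for i
        by (rule DERIV_chain2[OF diff, THEN DERIV_cong]) (auto intro!: derivative_eq_intros)
      then have "DERIV (\<lambda>t. \<Sum>i<n. loss f (d * e i - c - t * (d * x i j))) 0 :>
          (\<Sum>i<n. deriv (loss f) (d * e i - c) * (- (d * x i j)))"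
        by (rule DERIV_sum)
      from DERIV_add[OF DERIV_cmult[OF this, of "1 / real n"] DERIV_const[of "ln s"]]
      have "DERIV \<rho> 0 :> (1 / real n) * (\<Sum>i<n. deriv (loss f) (d * e i - c) * (- (d * x i j)))"
        unfolding \<rho>_def[abs_def] by simp
      then show ?thesis by (rule DERIV_fun_exp)
    qed
    ultimately have "\<bar>exp (\<rho> 0) * ((1 / real n) * (\<Sum>i<n. deriv (loss f) (d * e i - c) * (- (d * x i j))))\<bar> \<le> lam"
      by (intro penalized_min_derivative_bound)
    also have "exp (\<rho> 0) * ((1 / real n) * (\<Sum>i<n. deriv (loss f) (d * e i - c) * (- (d * x i j)))) =
      - (exp (\<rho> 0) * (d * ((1 / real n) * (\<Sum>i<n. deriv (loss f) (d * e i - c) * x i j))))"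
      by (simp add: sum_distrib_left sum_negf mult_ac)
    finally show "exp (loc_scale_risk f n e c d) * \<bar>d * ((1 / real n) * (\<Sum>i<n. deriv (loss f) (d * e i - c) * x i j))\<bar> \<le> lam"
      by (simp add: \<rho>0 abs_mult)
  qed
qed

text \<open>The price of replacing the fitted normalisation \<open>exp R' * d\<close> by
  \<open>exp R\<close>, with \<open>a\<close> the risk gap and \<open>d\<close> the fitted inverse
  scale. The numerator is at most \<open>1 + \<rho>\<close>, and
  \<open>1 + \<rho> \<le> (1 + 4 * \<rho>) * (1 - \<rho>)\<close> for small
  \<open>\<rho>\<close>.\<close>

lemma exp_ratio_bound:
  fixes \<rho> a d :: real
  assumes "0 < \<rho>" "\<rho> \<le> 1 / 4" "a \<le> \<rho>\<^sup>2 / 2" "\<bar>d - 1\<bar> \<le> \<rho>"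
  shows "exp a / d \<le> 1 + 4 * \<rho>"
proof -
  have sq: "\<rho>\<^sup>2 \<le> \<rho> / 4" unfolding power2_eq_square using mult_left_mono[OF assms(2), of \<rho>] assms(1) by simp
  have d: "d \<ge> 1 - \<rho>" "1 - \<rho> > 0" using assms by (auto simp: abs_le_iff)
  have "exp a \<le> exp (\<rho>\<^sup>2 / 2)" using assms by simp
  also have "\<dots> \<le> 1 + 2 * (\<rho>\<^sup>2 / 2)" using sq assms by (intro real_exp_bound_lemma) auto
  also have "\<dots> \<le> 1 + \<rho>" using sq assms by simp
  also have "\<dots> \<le> (1 + 4 * \<rho>) * (1 - \<rho>)"
  proof -
    have "2 * \<rho>\<^sup>2 \<le> \<rho>" using sq assms(1) by linarith
    then show ?thesis by (simp add: power2_eq_square algebra_simps)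
  qed
  also have "\<dots> \<le> (1 + 4 * \<rho>) * d" using d assms by (intro mult_left_mono) auto
  finally show ?thesis using d by (simp add: divide_le_eq)
qed

text \<open>All randomness sits in \<open>dev_loss\<close>, \<open>dev_score\<close>,
  \<open>risk_le\<close> and \<open>intercept_le\<close>; the rest is deterministic.
  \<open>E c h\<close> will be the expected loss difference, and \<open>t\<close> a crude bound on
  the risk at the truth that makes the tolerances nonrandom.\<close>

lemma lambda_star_le_of_null_lasso:
  fixes E :: "real \<Rightarrow> real \<Rightarrow> real"
  assumes lasso: "is_exp_lasso f n p x y lam b s"
    and null: "\<And>j. j \<in> {1..<p} \<Longrightarrow> b j = 0"
    and n: "n > 0" and p: "p > 0"
    and x0: "\<And>i. i < n \<Longrightarrow> x i 0 = 1"
    and y: "\<And>i. i < n \<Longrightarrow> y i = b0 + e i"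
    and conv: "convex_on UNIV (loss f)"
    and diff: "\<And>u. DERIV (loss f) u :> deriv (loss f) u"
    and \<kappa>: "0 < \<kappa>" "\<kappa> \<le> 1"
    and growth: "\<And>c h. \<bar>c\<bar> \<le> \<rho> \<Longrightarrow> \<bar>h\<bar> \<le> \<rho> \<Longrightarrow> \<kappa> * (c\<^sup>2 + h\<^sup>2) \<le> E c h - ln (1 + h)"
    and dev_loss: "\<And>c h. \<bar>c\<bar> \<le> \<rho> \<Longrightarrow> \<bar>h\<bar> \<le> \<rho> \<Longrightarrow>
      \<bar>\<Sum>i<n. loss f ((1 + h) * e i - c) - loss f (e i) - E c h\<bar> \<le> real n * (\<kappa> * \<rho>\<^sup>2 / 2)"
    and dev_score: "\<And>j c h. j \<in> {1..<p} \<Longrightarrow> \<bar>c\<bar> \<le> \<rho> \<Longrightarrow> \<bar>h\<bar> \<le> \<rho> \<Longrightarrow>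
      \<bar>\<Sum>i<n. x i j * (deriv (loss f) ((1 + h) * e i - c) - deriv (loss f) (e i))\<bar> \<le> real n * (\<eta> * lam * exp (- t) / 2)"
    and risk_le: "(1 / real n) * (\<Sum>i<n. loss f (e i)) \<le> t"
    and intercept_le: "\<bar>(1 / real n) * (\<Sum>i<n. deriv (loss f) (e i))\<bar> \<le> lam * exp (- t)"
    and \<rho>: "0 < \<rho>" "\<rho> \<le> 1 / 4" "8 * \<rho> \<le> \<eta>" and \<eta>: "\<eta> < 1" and lam: "lam > 0"
  shows "lambda_star f n p x e * (1 - \<eta>) \<le> lam"
proof -
  define R where "R = (1 / real n) * (\<Sum>i<n. loss f (e i))"
  have R0: "loc_scale_risk f n e 0 1 = R" by (simp add: loc_scale_risk_def R_def)
  have diff_lower: "\<kappa> * (c\<^sup>2 + h\<^sup>2) - \<kappa> * \<rho>\<^sup>2 / 2 \<le> loc_scale_risk f n e c (1 + h) - R"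
    if ch: "\<bar>c\<bar> \<le> \<rho>" "\<bar>h\<bar> \<le> \<rho>" for c h
  proof -
    have "loc_scale_risk f n e c (1 + h) - R - (E c h - ln (1 + h))
        = (1 / real n) * (\<Sum>i<n. loss f ((1 + h) * e i - c) - loss f (e i) - E c h)"
      using n by (simp add: loc_scale_risk_def R_def sum_subtractf right_diff_distrib)
    also have "\<bar>\<dots>\<bar> \<le> (1 / real n) * (real n * (\<kappa> * \<rho>\<^sup>2 / 2))"
      unfolding abs_mult using dev_loss[OF ch] by (intro mult_mono) auto
    also have "\<dots> = \<kappa> * \<rho>\<^sup>2 / 2" using n by simp
    finally show ?thesis using growth[OF ch] by linarith
  qed
  have "\<exists>c d. d > 0 \<and> (\<forall>c' d'. d' > 0 \<longrightarrow> loc_scale_risk f n e c d \<le> loc_scale_risk f n e c' d') \<and>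
    (\<forall>j\<in>{1..<p}. exp (loc_scale_risk f n e c d) *
      \<bar>d * ((1 / real n) * (\<Sum>i<n. deriv (loss f) (d * e i - c) * x i j))\<bar> \<le> lam)"
    by (rule exp_lasso_null_conditions[OF lasso null n p x0 y diff])
  then obtain c d where d: "d > 0"
    and min: "\<forall>c' d'. d' > 0 \<longrightarrow> loc_scale_risk f n e c d \<le> loc_scale_risk f n e c' d'"
    and kkt: "\<forall>j\<in>{1..<p}. exp (loc_scale_risk f n e c d) *
      \<bar>d * ((1 / real n) * (\<Sum>i<n. deriv (loss f) (d * e i - c) * x i j))\<bar> \<le> lam"
    by (elim exE conjE)
  have cd: "\<bar>c\<bar> \<le> \<rho>" "\<bar>d - 1\<bar> \<le> \<rho>"
  proof -
    have "\<bar>c\<bar> \<le> \<rho> \<and> \<bar>d - 1\<bar> \<le> \<rho>"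
    proof (rule loc_scale_risk_localization[OF conv d \<rho>(1)])
      fix c' h :: real assume m: "max \<bar>c'\<bar> \<bar>h\<bar> = \<rho>"
      \<comment> \<open>On the boundary the growth is at least
        \<open>\<kappa> * \<rho>\<^sup>2\<close>, twice the deviation allowed by
        \<open>dev_loss\<close>.\<close>
      have "\<rho>\<^sup>2 \<le> c'\<^sup>2 + h\<^sup>2"
        using m by (cases "\<bar>c'\<bar> \<le> \<bar>h\<bar>") (auto simp: max_def)
      then have "\<kappa> * \<rho>\<^sup>2 \<le> \<kappa> * (c'\<^sup>2 + h\<^sup>2)" using \<kappa> by (intro mult_left_mono) auto
      moreover have "\<kappa> * \<rho>\<^sup>2 > 0" using \<kappa> \<rho> by simp
      ultimately show "loc_scale_risk f n e 0 1 < loc_scale_risk f n e c' (1 + h)"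
        using diff_lower[of c' h] m unfolding R0 by linarith
    qed (simp add: min)
    then show "\<bar>c\<bar> \<le> \<rho>" "\<bar>d - 1\<bar> \<le> \<rho>" by auto
  qed
  define R' where "R' = loc_scale_risk f n e c d"
  have "R - R' \<le> \<kappa> * \<rho>\<^sup>2 / 2"
  proof -
    have "0 \<le> \<kappa> * (c\<^sup>2 + (d - 1)\<^sup>2)" using \<kappa> by simp
    then show ?thesis using diff_lower[OF cd] by (simp add: R'_def)
  qed
  also have "\<dots> \<le> \<rho>\<^sup>2 / 2" using mult_right_mono[OF \<kappa>(2), of "\<rho>\<^sup>2"] by simp
  finally have ratio: "exp (R - R') / d \<le> 1 + 4 * \<rho>"
    using \<rho> cd by (intro exp_ratio_bound) auto
  define S where "S j = (1 / real n) * (\<Sum>i<n. deriv (loss f) (e i) * x i j)" for j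
  \<comment> \<open>Tolerances scaled by \<open>exp (- t)\<close> therefore survive multiplication
    by \<open>exp R\<close>.\<close>
  have expR: "exp R * exp (- t) \<le> 1"
    using risk_le by (simp add: R_def flip: exp_add)
  have \<eta>0: "0 < \<eta>" using \<rho> by simp
  have main: "\<bar>S j\<bar> * exp R * (1 - \<eta>) \<le> lam" if j: "j < p" for j
  proof (cases "j = 0")
    case True
    \<comment> \<open>\<open>kkt\<close> covers penalised coordinates only; the intercept coordinate
      of \<open>lambda_star\<close> has its own bound.\<close>
    have "\<bar>S j\<bar> \<le> lam * exp (- t)"
      using intercept_le x0 True by (simp add: S_def)
    then have "\<bar>S j\<bar> * exp R \<le> lam * exp (- t) * exp R" by (rule mult_right_mono) simp
    also have "\<dots> \<le> lam" using mult_left_mono[OF expR, of lam] lam by (simp add: mult_ac)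
    finally have "\<bar>S j\<bar> * exp R * (1 - \<eta>) \<le> lam * (1 - \<eta>)" using \<eta> by (intro mult_right_mono) auto
    also have "\<dots> \<le> lam" using lam \<eta>0 by (simp add: algebra_simps)
    finally show ?thesis .
  next
    case False
    with j have j': "j \<in> {1..<p}" by auto
    define S' where "S' = (1 / real n) * (\<Sum>i<n. deriv (loss f) (d * e i - c) * x i j)"
    have "exp R' * (d * \<bar>S'\<bar>) \<le> lam"
      using bspec[OF kkt j'] d by (simp add: R'_def S'_def abs_mult)
    then have "\<bar>S'\<bar> * (exp R' * d) \<le> lam" by (simp add: mult_ac)
    then have S': "\<bar>S'\<bar> \<le> lam / (exp R' * d)"
      using d by (subst pos_le_divide_eq) auto
    have "S' - S j = (1 / real n) * (\<Sum>i<n. x i j * (deriv (loss f) ((1 + (d - 1)) * e i - c) - deriv (loss f) (e i)))"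
      by (simp add: S'_def S_def right_diff_distrib sum_subtractf mult_ac)
    also have "\<bar>\<dots>\<bar> \<le> (1 / real n) * (real n * (\<eta> * lam * exp (- t) / 2))"
      unfolding abs_mult using dev_score[OF j' cd] by (intro mult_mono) auto
    also have "\<dots> = \<eta> * lam * exp (- t) / 2" using n by simp
    finally have "\<bar>S j\<bar> \<le> lam / (exp R' * d) + \<eta> * lam * exp (- t) / 2"
      using S' by linarith
    then have "\<bar>S j\<bar> * exp R \<le> (lam / (exp R' * d) + \<eta> * lam * exp (- t) / 2) * exp R"
      by (rule mult_right_mono) simp
    also have "\<dots> = lam * (exp (R - R') / d) + \<eta> * lam / 2 * (exp R * exp (- t))"
      by (simp add: exp_diff field_simps)
    also have "\<dots> \<le> lam * (1 + 4 * \<rho>) + \<eta> * lam / 2 * 1"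
      using ratio expR lam \<eta>0 by (intro add_mono mult_left_mono) auto
    finally have "\<bar>S j\<bar> * exp R * (1 - \<eta>) \<le> (lam * (1 + 4 * \<rho>) + \<eta> * lam / 2 * 1) * (1 - \<eta>)"
      using \<eta> by (intro mult_right_mono) auto
    also have "\<dots> = lam * ((1 + 4 * \<rho> + \<eta> / 2) * (1 - \<eta>))" by (simp add: algebra_simps)
    \<comment> \<open>The change of normalisation costs \<open>4 * \<rho> \<le> \<eta> / 2\<close>
      and the score deviation the other half; the shrinkage \<open>1 - \<eta>\<close> compensates
      for both.\<close>
    also have "\<dots> \<le> lam * ((1 + \<eta>) * (1 - \<eta>))"
      using lam \<rho> \<eta> by (intro mult_left_mono mult_right_mono) auto
    also have "\<dots> \<le> lam * 1" using lam by (intro mult_left_mono) (auto simp: algebra_simps)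
    finally show ?thesis by simp
  qed
  have "lambda_star f n p x e = Max ((\<lambda>j. \<bar>S j\<bar>) ` {..<p}) * exp R"
    unfolding lambda_star_def S_def R_def loss_def by (simp add: sum_negf)
  moreover have "Max ((\<lambda>j. \<bar>S j\<bar>) ` {..<p}) \<in> (\<lambda>j. \<bar>S j\<bar>) ` {..<p}"
    using p by (intro Max_in) auto
  then obtain j where "j < p" "Max ((\<lambda>j. \<bar>S j\<bar>) ` {..<p}) = \<bar>S j\<bar>" by auto
  ultimately show ?thesis using main[of j] by simp
qed

section \<open>Probability of a null selection\<close>

lemma (in iid_sample) integral_sample_component:
  fixes \<phi> :: "'a \<Rightarrow> real"
  assumes "\<And>i. distr M N (\<xi> i) = N" "integrable N \<phi>"
  shows "integrable M (\<lambda>\<omega>. \<phi> (\<xi> i \<omega>))" "(\<integral>\<omega>. \<phi> (\<xi> i \<omega>) \<partial>M) = (\<integral>u. \<phi> u \<partial>N)"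
proof -
  have [measurable]: "\<phi> \<in> borel_measurable N" using assms(2) by blast
  show "integrable M (\<lambda>\<omega>. \<phi> (\<xi> i \<omega>))"
    using assms integrable_distr_eq[of "\<xi> i" M N \<phi>] by simp
  show "(\<integral>\<omega>. \<phi> (\<xi> i \<omega>) \<partial>M) = (\<integral>u. \<phi> u \<partial>N)"
    using integral_distr[of "\<xi> i" M N \<phi>] assms(1) by simp
qed

text \<open>A null selection localises the scalar location-scale fit within \<open>\<rho>\<close> of the truth. There
  the columns orthogonal to the intercept see only the centred fluctuations of the score, so
  the stationarity conditions at the fit and at the truth differ by less than the slack.\<close>

lemma (in regular_noise) null_selection_probability:
  fixes M :: "'w measure" and \<xi> :: "nat \<Rightarrow> 'w \<Rightarrow> real" and x :: "nat \<Rightarrow> nat \<Rightarrow> real"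
  assumes iid: "iid_sample M (noise f) \<xi>" and distr1: "\<And>i. distr M (noise f) (\<xi> i) = noise f"
    and conv: "convex_on UNIV (loss f)"
    and n: "n > 0" and p: "p \<ge> 2"
    and x0: "\<And>i. i < n \<Longrightarrow> x i 0 = 1"
    and xK: "\<And>i j. i < n \<Longrightarrow> j < p \<Longrightarrow> \<bar>x i j\<bar> \<le> K" and K: "K \<ge> 1"
    and centred: "\<And>j. j \<in> {1..<p} \<Longrightarrow> (\<Sum>i<n. x i j) = 0"
    and \<kappa>: "0 < \<kappa>" "\<kappa> \<le> 1"
    and growth: "\<And>c h. \<bar>c\<bar> \<le> \<rho> \<Longrightarrow> \<bar>h\<bar> \<le> \<rho> \<Longrightarrow> \<kappa> * (c\<^sup>2 + h\<^sup>2) \<le> (\<integral>u. loss_diff c h u \<partial>noise f) - ln (1 + h)"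
    and \<rho>: "0 < \<rho>" "\<rho> \<le> 1 / 4" "8 * \<rho> \<le> \<eta>" "\<rho> \<le> r0" and \<eta>: "\<eta> < 1" and lam: "lam > 0" and t: "t > 0"
    and v: "(\<integral>u. (envelope u)\<^sup>2 \<partial>noise f) \<le> v" "v > 0"
  shows "\<exists>A\<in>sets M. measure M A \<le>
      144 * \<rho> * sqrt (real n * v * ln 2) / (real n * (\<kappa> * \<rho>\<^sup>2 / 2))
      + 144 * K * \<rho> * sqrt (real n * v * ln (real p)) / (real n * (\<eta> * lam * exp (- t) / 2))
      + (\<integral>u. \<bar>loss f u\<bar> \<partial>noise f) / t
      + 3 * sqrt (real n * v * ln 2) / (real n * (lam * exp (- t))) \<and>
    (\<forall>\<omega>\<in>space M - A. \<forall>b s b0 y. is_exp_lasso f n p x y lam b s \<longrightarrow> (\<forall>j\<in>{1..<p}. b j = 0) \<longrightarrow>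
      (\<forall>i<n. y i = b0 + \<xi> i \<omega>) \<longrightarrow> lambda_star f n p x (\<lambda>i. \<xi> i \<omega>) * (1 - \<eta>) \<le> lam)"
proof -
  interpret iid_sample M "noise f" \<xi> by (rule iid)
  have \<xi>_borel [measurable]: "\<xi> i \<in> borel_measurable M" for i
    using \<xi>_meas[of i] by (simp add: measurable_def)
  have \<eta>0: "\<eta> > 0" using \<rho> by simp
  have env: "envelope \<in> borel_measurable (noise f)" by measurable
  have r: "\<bar>c\<bar> \<le> r0" if "\<bar>c\<bar> \<le> \<rho>" for c using that \<rho> by linarith
  \<comment> \<open>The loss needs a single constant weight vector; \<open>P = 2\<close> is the
    least value that \<open>uniform_deviation\<close> admits, whence \<open>ln 2\<close>.\<close>
  have "\<exists>A\<in>sets M. prob A \<le> 144 * 1 * \<rho> * sqrt (real n * v * ln 2) / (real n * (\<kappa> * \<rho>\<^sup>2 / 2)) \<and>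
    (\<forall>\<omega>\<in>space M - A. \<forall>j\<in>{()}. \<forall>c h. \<bar>c\<bar> \<le> \<rho> \<longrightarrow> \<bar>h\<bar> \<le> \<rho> \<longrightarrow>
      \<bar>\<Sum>i<n. 1 * (loss_diff c h (\<xi> i \<omega>) - (\<integral>u. loss_diff c h u \<partial>noise f))\<bar> \<le> real n * (\<kappa> * \<rho>\<^sup>2 / 2))"
    by (rule uniform_deviation[where V = envelope])
      (use n \<kappa> \<rho> v r in \<open>auto intro!: loss_diff_lip simp: loss_diff_0 envelope_nonneg envelope_sq_integrable\<close>)
  then obtain A1 where A1: "A1 \<in> sets M"
      "prob A1 \<le> 144 * \<rho> * sqrt (real n * v * ln 2) / (real n * (\<kappa> * \<rho>\<^sup>2 / 2))"
    and A1': "\<And>\<omega> c h. \<omega> \<in> space M - A1 \<Longrightarrow> \<bar>c\<bar> \<le> \<rho> \<Longrightarrow> \<bar>h\<bar> \<le> \<rho> \<Longrightarrow>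
      \<bar>\<Sum>i<n. loss_diff c h (\<xi> i \<omega>) - (\<integral>u. loss_diff c h u \<partial>noise f)\<bar> \<le> real n * (\<kappa> * \<rho>\<^sup>2 / 2)"
    by (simp only: mult_1 mult_1_right) blast
  have "\<exists>A\<in>sets M. prob A \<le> 144 * K * \<rho> * sqrt (real n * v * ln (real p)) / (real n * (\<eta> * lam * exp (- t) / 2)) \<and>
    (\<forall>\<omega>\<in>space M - A. \<forall>j\<in>{1..<p}. \<forall>c h. \<bar>c\<bar> \<le> \<rho> \<longrightarrow> \<bar>h\<bar> \<le> \<rho> \<longrightarrow>
      \<bar>\<Sum>i<n. x i j * (score_diff c h (\<xi> i \<omega>) - (\<integral>u. score_diff c h u \<partial>noise f))\<bar> \<le> real n * (\<eta> * lam * exp (- t) / 2))"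
    by (rule uniform_deviation[where V = envelope and w = "\<lambda>j i. x i j"])
      (use n p K \<eta>0 lam \<rho> v r xK in \<open>auto intro!: score_diff_lip simp: score_diff_0 envelope_nonneg envelope_sq_integrable\<close>)
  then obtain A2 where A2: "A2 \<in> sets M"
      "prob A2 \<le> 144 * K * \<rho> * sqrt (real n * v * ln (real p)) / (real n * (\<eta> * lam * exp (- t) / 2))"
    and A2': "\<And>\<omega> j c h. \<omega> \<in> space M - A2 \<Longrightarrow> j \<in> {1..<p} \<Longrightarrow> \<bar>c\<bar> \<le> \<rho> \<Longrightarrow> \<bar>h\<bar> \<le> \<rho> \<Longrightarrow>
      \<bar>\<Sum>i<n. x i j * (score_diff c h (\<xi> i \<omega>) - (\<integral>u. score_diff c h u \<partial>noise f))\<bar> \<le> real n * (\<eta> * lam * exp (- t) / 2)"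
    by blast
  \<comment> \<open>The loss is assumed to have a first moment only, so the risk is bounded by
    Markov's inequality at a level \<open>t\<close> to be chosen large.\<close>
  define A3 where "A3 = {\<omega>\<in>space M. t \<le> (1 / real n) * (\<Sum>i<n. \<bar>loss f (\<xi> i \<omega>)\<bar>)}"
  have A3: "A3 \<in> sets M" unfolding A3_def by measurable
  have abs_loss: "integrable (noise f) (\<lambda>u. \<bar>loss f u\<bar>)" using int_loss by (rule integrable_abs)
  note loss_comp = integral_sample_component[OF distr1 abs_loss]
  have PA3: "prob A3 \<le> (\<integral>u. \<bar>loss f u\<bar> \<partial>noise f) / t"
  proof -
    have "prob A3 \<le> (\<integral>\<omega>. (1 / real n) * (\<Sum>i<n. \<bar>loss f (\<xi> i \<omega>)\<bar>) \<partial>M) / t"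
      unfolding A3_def using t loss_comp(1)
      by (intro integral_Markov_inequality_measure[where A = "space M"] AE_I2) (auto intro!: sum_nonneg divide_nonneg_nonneg)
    also have "(\<integral>\<omega>. (1 / real n) * (\<Sum>i<n. \<bar>loss f (\<xi> i \<omega>)\<bar>) \<partial>M) = (\<integral>u. \<bar>loss f u\<bar> \<partial>noise f)"
      using loss_comp n by simp
    finally show ?thesis .
  qed
  \<comment> \<open>The intercept score is the maximal inequality with a one-element index set,
    centred by \<open>score_mean_zero\<close>.\<close>
  define A4 where "A4 = {\<omega>\<in>space M. 1 \<le> ennreal (1 / (real n * (lam * exp (- t)))) * ennreal \<bar>\<Sum>i<n. score (\<xi> i \<omega>)\<bar>}"
  have A4: "A4 \<in> sets M" unfolding A4_def by measurable
  have PA4: "prob A4 \<le> 3 * sqrt (real n * v * ln 2) / (real n * (lam * exp (- t)))"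
  proof -
    let ?c = "1 / (real n * (lam * exp (- t)))"
    have c: "?c > 0" using n lam by simp
    have "emeasure M A4 \<le> ennreal ?c * (\<integral>\<^sup>+\<omega>. ennreal \<bar>\<Sum>i<n. score (\<xi> i \<omega>)\<bar> * indicator (space M) \<omega> \<partial>M)"
      unfolding A4_def by (rule nn_integral_Markov_inequality) auto
    also have "(\<integral>\<^sup>+\<omega>. ennreal \<bar>\<Sum>i<n. score (\<xi> i \<omega>)\<bar> * indicator (space M) \<omega> \<partial>M)
        = (\<integral>\<^sup>+\<omega>. (SUP _\<in>{()}. ennreal \<bar>\<Sum>i<n. score (\<xi> i \<omega>)\<bar>) \<partial>M)"
      by (intro nn_integral_cong) auto
    also have "\<dots> \<le> ennreal (3 * 1 * sqrt (real n * v * ln (2 * real (card {()}))))"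
    proof (rule expectation_max_iid_sum[where V = envelope])
      fix u
      have "0 \<le> \<bar>score u\<bar> * \<bar>u\<bar> + G u * (1 + \<bar>u\<bar>) * (1 + \<bar>u\<bar>)"
        using G_pos[of u] by (intro add_nonneg_nonneg mult_nonneg_nonneg) auto
      then show "\<bar>score u\<bar> \<le> 1 * envelope u"
        by (simp add: envelope_def algebra_simps)
    qed (use n v score_mean_zero envelope_sq_integrable in auto)
    finally have "emeasure M A4 \<le> ennreal ?c * ennreal (3 * 1 * sqrt (real n * v * ln (2 * real (card {()}))))"
      by (simp add: mult_left_mono)
    also have "\<dots> = ennreal (3 * sqrt (real n * v * ln 2) / (real n * (lam * exp (- t))))"
      using c v by (subst ennreal_mult'[symmetric]) auto
    finally show ?thesis
      using n lam v by (simp add: emeasure_eq_measure)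
  qed
  \<comment> \<open>A null event, outside which the truncated differences agree with the actual ones
    at every observation.\<close>
  define A5 where "A5 = {\<omega>\<in>space M. \<exists>i<n. \<xi> i \<omega> \<notin> regular_pts}"
  have A5: "A5 \<in> sets M" unfolding A5_def by measurable
  have "AE \<omega> in M. \<xi> i \<omega> \<in> regular_pts" for i
  proof -
    have "AE u in distr M (noise f) (\<xi> i). u \<in> regular_pts"
      unfolding distr1 by (rule regular_pts_AE)
    then show ?thesis by (subst (asm) AE_distr_iff) auto
  qed
  then have "AE \<omega> in M. \<forall>i\<in>{..<n}. \<xi> i \<omega> \<in> regular_pts"
    by (intro AE_finite_allI) auto
  then have "AE \<omega> in M. \<omega> \<notin> A5"
    by eventually_elim (auto simp: A5_def)
  then have PA5: "prob A5 = 0" using A5 by (simp add: prob_eq_0)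
  define A where "A = A1 \<union> A2 \<union> A3 \<union> A4 \<union> A5"
  have A: "A \<in> sets M" unfolding A_def using A1 A2 A3 A4 A5 by auto
  have "prob A \<le> prob A1 + prob A2 + prob A3 + prob A4 + prob A5"
    unfolding A_def using A1 A2 A3 A4 A5
    by (intro order_trans[OF measure_Un_le] add_mono order_refl) auto
  also have "\<dots> \<le> 144 * \<rho> * sqrt (real n * v * ln 2) / (real n * (\<kappa> * \<rho>\<^sup>2 / 2))
      + 144 * K * \<rho> * sqrt (real n * v * ln (real p)) / (real n * (\<eta> * lam * exp (- t) / 2))
      + (\<integral>u. \<bar>loss f u\<bar> \<partial>noise f) / t
      + 3 * sqrt (real n * v * ln 2) / (real n * (lam * exp (- t)))"
    using A1(2) A2(2) PA3 PA4 PA5 by linarith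
  finally have PA: "prob A \<le> \<dots>" .
  have "lambda_star f n p x (\<lambda>i. \<xi> i \<omega>) * (1 - \<eta>) \<le> lam"
    if \<omega>: "\<omega> \<in> space M - A" and lasso: "is_exp_lasso f n p x y lam b s"
      and null: "\<forall>j\<in>{1..<p}. b j = 0" and y: "\<forall>i<n. y i = b0 + \<xi> i \<omega>" for \<omega> b s b0 y
  proof (rule lambda_star_le_of_null_lasso[OF lasso _ n _ x0 _ conv DERIV_loss \<kappa> growth])
    have reg: "\<xi> i \<omega> \<in> regular_pts" if "i < n" for i
      using \<omega> that by (auto simp: A_def A5_def)
    show "b j = 0" if "j \<in> {1..<p}" for j using null that by blast
    show "y i = b0 + \<xi> i \<omega>" if "i < n" for i using y that by blast
    fix c h :: real assume ch: "\<bar>c\<bar> \<le> \<rho>" "\<bar>h\<bar> \<le> \<rho>"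
    have "(\<Sum>i<n. loss f ((1 + h) * \<xi> i \<omega> - c) - loss f (\<xi> i \<omega>) - (\<integral>u. loss_diff c h u \<partial>noise f))
        = (\<Sum>i<n. loss_diff c h (\<xi> i \<omega>) - (\<integral>u. loss_diff c h u \<partial>noise f))"
      using reg by (intro sum.cong refl) (simp add: loss_diff_def)
    then show "\<bar>\<Sum>i<n. loss f ((1 + h) * \<xi> i \<omega> - c) - loss f (\<xi> i \<omega>) - (\<integral>u. loss_diff c h u \<partial>noise f)\<bar> \<le> real n * (\<kappa> * \<rho>\<^sup>2 / 2)"
      using A1'[OF _ ch, of \<omega>] \<omega> by (simp add: A_def)
    fix j assume j: "j \<in> {1..<p}"
    have "(\<Sum>i<n. x i j * (score_diff c h (\<xi> i \<omega>) - (\<integral>u. score_diff c h u \<partial>noise f)))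
        = (\<Sum>i<n. x i j * score_diff c h (\<xi> i \<omega>)) - (\<Sum>i<n. x i j) * (\<integral>u. score_diff c h u \<partial>noise f)"
      by (simp add: right_diff_distrib sum_subtractf sum_distrib_right)
    also have "\<dots> = (\<Sum>i<n. x i j * (score ((1 + h) * \<xi> i \<omega> - c) - score (\<xi> i \<omega>)))"
      unfolding centred[OF j] using reg by (simp, intro sum.cong refl) (simp add: score_diff_def)
    finally show "\<bar>\<Sum>i<n. x i j * (score ((1 + h) * \<xi> i \<omega> - c) - score (\<xi> i \<omega>))\<bar> \<le> real n * (\<eta> * lam * exp (- t) / 2)"
      using A2'[OF _ j ch, of \<omega>] \<omega> by (simp add: A_def)
  next
    have "(1 / real n) * (\<Sum>i<n. loss f (\<xi> i \<omega>)) \<le> (1 / real n) * (\<Sum>i<n. \<bar>loss f (\<xi> i \<omega>)\<bar>)"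
      by (intro mult_left_mono sum_mono) auto
    also have "\<dots> \<le> t" using \<omega> by (auto simp: A_def A3_def)
    finally show "(1 / real n) * (\<Sum>i<n. loss f (\<xi> i \<omega>)) \<le> t" .
    have "ennreal (1 / (real n * (lam * exp (- t)))) * ennreal \<bar>\<Sum>i<n. score (\<xi> i \<omega>)\<bar> < 1"
      using \<omega> by (auto simp: A_def A4_def not_le)
    then have "1 / (real n * (lam * exp (- t))) * \<bar>\<Sum>i<n. score (\<xi> i \<omega>)\<bar> < 1"
      using n lam by (subst (asm) ennreal_mult'[symmetric]) auto
    then show "\<bar>(1 / real n) * (\<Sum>i<n. score (\<xi> i \<omega>))\<bar> \<le> lam * exp (- t)"
      using n lam by (simp add: abs_mult divide_simps mult_ac)
  qed (use p \<rho> \<eta> lam in auto)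
  with A PA show ?thesis by blast
qed

section \<open>The product law of the sample and the asymptotic orders\<close>

lemma noise_eq_distr:
  assumes "distributed M lborel X (\<lambda>u. ennreal (f u))"
  shows "distr M (noise f) X = noise f"
proof -
  have "distr M (noise f) X = distr M lborel X"
    by (rule distr_cong) (simp_all add: noise_def)
  also have "\<dots> = noise f"
    using distributed_distr_eq_density[OF assms] by (simp add: noise_def)
  finally show ?thesis .
qed

lemma iid_sampleI:
  assumes M: "prob_space M" and indep: "prob_space.indep_vars M (\<lambda>_. borel) \<xi> UNIV"
    and dist: "\<And>i. distributed M lborel (\<xi> i) (\<lambda>u. ennreal (f u))"
  shows "iid_sample M (noise f) \<xi>"
proof -
  interpret prob_space M by (rule M)
  have sets: "sets (noise f) = sets borel" by (simp add: noise_def)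
  have rv: "\<xi> i \<in> measurable M borel" for i
    using distributed_measurable[OF dist[of i]] by simp
  have rv': "\<xi> i \<in> measurable M (noise f)" for i
    using rv[of i] measurable_cong_sets[OF refl sets] by auto
  have d1: "distr M (noise f) (\<xi> i) = noise f" for i by (rule noise_eq_distr[OF dist])
  have d2: "distr M borel (\<xi> i) = noise f" for i
    using d1[of i] distr_cong[OF refl sets[symmetric], of M "\<xi> i" "\<xi> i"] by simp
  show ?thesis
  proof (intro iid_sample.intro iid_sample_axioms.intro M)
    show "prob_space (noise f)" using prob_space_distr[OF rv'[of 0]] by (simp only: d1)
    show "\<xi> i \<in> measurable M (noise f)" for i by (rule rv')
    fix n :: nat assume n: "n > 0"
    have "indep_vars (\<lambda>_. borel) \<xi> {..<n}" by (rule indep_vars_subset[OF indep]) simp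
    then have "distr M (\<Pi>\<^sub>M i\<in>{..<n}. borel) (\<lambda>\<omega>. \<lambda>i\<in>{..<n}. \<xi> i \<omega>) = (\<Pi>\<^sub>M i\<in>{..<n}. distr M borel (\<xi> i))"
      using n rv by (subst (asm) indep_vars_iff_distr_eq_PiM) auto
    moreover have "distr M (PiM {..<n} (\<lambda>_. noise f)) (\<lambda>\<omega>. \<lambda>i\<in>{..<n}. \<xi> i \<omega>)
        = distr M (\<Pi>\<^sub>M i\<in>{..<n}. borel) (\<lambda>\<omega>. \<lambda>i\<in>{..<n}. \<xi> i \<omega>)"
      by (rule distr_cong) (auto intro!: sets_PiM_cong simp: sets)
    ultimately show "distr M (PiM {..<n} (\<lambda>_. noise f)) (\<lambda>\<omega>. \<lambda>i\<in>{..<n}. \<xi> i \<omega>) = PiM {..<n} (\<lambda>_. noise f)"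
      by (simp add: d2)
  qed
qed

text \<open>With \<open>L\<close> the root of the logarithm of the dimension, the loss and intercept
  terms are of order \<open>1 / L\<close> and the score term is of order
  \<open>K\<^sup>2 * \<rho> / \<eta>\<close>. A radius without the factor \<open>L\<close> would
  leave the loss term bounded but not vanishing. \<open>K\<close> is enlarged to
  \<open>K\<^sup>2\<close> to match the slack condition.\<close>

lemma deviation_bounds_simplify:
  fixes n L K \<rho> v \<kappa> \<eta> lam t c0 :: real
  assumes n: "n > 0" and L: "L > 0" and \<rho>: "\<rho> = L / sqrt n" and v: "v > 0" and \<kappa>: "\<kappa> > 0" and K: "K \<ge> 1"
    and \<eta>: "\<eta> > 0" and c0: "c0 > 0" and lam: "lam \<ge> c0 * \<rho>"
  shows "144 * \<rho> * sqrt (n * v * ln 2) / (n * (\<kappa> * \<rho>\<^sup>2 / 2)) = 288 * sqrt (v * ln 2) / \<kappa> / L"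
    and "144 * K * \<rho> * sqrt (n * v * L\<^sup>2) / (n * (\<eta> * lam * exp (- t) / 2)) \<le> 288 * sqrt v * exp t / c0 * (K\<^sup>2 * \<rho> / \<eta>)"
    and "3 * sqrt (n * v * ln 2) / (n * (lam * exp (- t))) \<le> 3 * sqrt (v * ln 2) * exp t / c0 / L"
proof -
  define q where "q = sqrt n"
  have q: "q > 0" and nq: "n = q * q" using n by (simp_all add: q_def)
  have Lq: "L = \<rho> * q" and \<rho>0: "\<rho> > 0" using \<rho> L q by (simp_all add: q_def[symmetric])
  have lam0: "lam > 0" using lam mult_pos_pos[OF c0 \<rho>0] by linarith
  define w where "w = sqrt (v * ln 2)"
  have w: "w \<ge> 0" using v by (simp add: w_def)
  have s1: "sqrt (n * v * ln 2) = q * w"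
    using n by (simp add: q_def w_def real_sqrt_mult[symmetric] mult.assoc)
  have s2: "sqrt (n * v * L\<^sup>2) = q * sqrt v * (\<rho> * q)"
    using n L by (simp add: q_def real_sqrt_mult Lq[unfolded q_def, symmetric])
  show "144 * \<rho> * sqrt (n * v * ln 2) / (n * (\<kappa> * \<rho>\<^sup>2 / 2)) = 288 * sqrt (v * ln 2) / \<kappa> / L"
    unfolding s1 w_def[symmetric] using q \<rho>0 \<kappa> by (simp add: nq Lq power2_eq_square field_simps)
  have "144 * K * \<rho> * sqrt (n * v * L\<^sup>2) / (n * (\<eta> * lam * exp (- t) / 2))
      = 288 * sqrt v * exp t * (K * \<rho>\<^sup>2 / (\<eta> * lam))"
    unfolding s2 using q \<eta> lam0 by (simp add: nq power2_eq_square exp_minus field_simps)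
  also have "\<dots> \<le> 288 * sqrt v * exp t * (K\<^sup>2 * \<rho>\<^sup>2 / (\<eta> * (c0 * \<rho>)))"
  proof (rule mult_left_mono, rule frac_le)
    show "K * \<rho>\<^sup>2 \<le> K\<^sup>2 * \<rho>\<^sup>2" using K by (intro mult_right_mono) (auto simp: power2_eq_square)
    show "\<eta> * (c0 * \<rho>) \<le> \<eta> * lam" using lam \<eta> by (intro mult_left_mono) auto
  qed (use \<eta> c0 \<rho>0 v in auto)
  also have "\<dots> = 288 * sqrt v * exp t / c0 * (K\<^sup>2 * \<rho> / \<eta>)"
    using \<rho>0 by (simp add: power2_eq_square mult_ac)
  finally show "144 * K * \<rho> * sqrt (n * v * L\<^sup>2) / (n * (\<eta> * lam * exp (- t) / 2)) \<le> 288 * sqrt v * exp t / c0 * (K\<^sup>2 * \<rho> / \<eta>)" .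
  have "3 * sqrt (n * v * ln 2) / (n * (lam * exp (- t))) = 3 * w * exp t / (q * lam)"
    unfolding s1 using q lam0 by (simp add: nq exp_minus field_simps)
  also have "\<dots> \<le> 3 * w * exp t / (q * (c0 * \<rho>))"
    using q lam c0 \<rho>0 w by (intro divide_left_mono mult_left_mono) (auto simp: lam0)
  also have "\<dots> = 3 * w * exp t / c0 / L" by (simp add: Lq mult_ac)
  finally show "3 * sqrt (n * v * ln 2) / (n * (lam * exp (- t))) \<le> 3 * sqrt (v * ln 2) * exp t / c0 / L"
    by (simp add: w_def)
qed

theorem lemma4p2:
  fixes M :: "'w measure"
    and \<xi> :: "nat \<Rightarrow> 'w \<Rightarrow> real"
    and f G :: "real \<Rightarrow> real"
    and p :: "nat \<Rightarrow> nat"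
    and x :: "nat \<Rightarrow> nat \<Rightarrow> nat \<Rightarrow> real"
    and beta_star :: "nat \<Rightarrow> nat \<Rightarrow> real"
    and sigma_star :: real
    and y :: "nat \<Rightarrow> 'w \<Rightarrow> nat \<Rightarrow> real"
    and K s_max \<alpha> \<eta> lam :: "nat \<Rightarrow> real"
    and \<Sigma> :: "nat \<Rightarrow> real mat"
    and \<Lambda> :: real
    and beta_hat :: "nat \<Rightarrow> 'w \<Rightarrow> nat \<Rightarrow> real"
    and sigma_hat :: "nat \<Rightarrow> 'w \<Rightarrow> real"
  assumes "prob_space M"
    \<comment> \<open>the linear model\<close>
    and "sigma_star = 1"
    and "\<forall>\<^sub>F n in sequentially. \<forall>i<n. x n i 0 = 1"
    and "\<forall>\<^sub>F n in sequentially. \<forall>\<omega>\<in>space M. \<forall>i<n.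
           y n \<omega> i = row_mult (p n) (x n i) (beta_star n) + sigma_star * \<xi> i \<omega>"
    \<comment> \<open>the estimator and its tuning parameter\<close>
    and "\<And>n j. j < p n \<Longrightarrow> (\<lambda>\<omega>. beta_hat n \<omega> j) \<in> borel_measurable M"
    and "\<And>n. sigma_hat n \<in> borel_measurable M"
    and "(\<lambda>n. \<P>(\<omega> in M. is_exp_lasso f n (p n) (x n) (y n \<omega>) (lam n)
                          (beta_hat n \<omega>) (sigma_hat n \<omega>))) \<longlonglongrightarrow> 1"
    and "\<forall>\<^sub>F n in sequentially. lam n > 0"
    and "lam \<in> \<Theta>(\<lambda>n. sqrt (ln (real (p n)) / real n))"
    \<comment> \<open>(1)\<close>
    and "prob_space.indep_vars M (\<lambda>_. borel) \<xi> UNIV"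
    and "\<And>i. distributed M lborel (\<xi> i) (\<lambda>u. ennreal (f u))"
    and "\<And>u. f u > 0"
    and "convex_on UNIV (loss f)"
    and "\<And>u. loss f differentiable (at u)"
    and "integrable (noise f) (loss f)"
    and "integrable (noise f) (\<lambda>u. (deriv (loss f) u)\<^sup>2)"
    and "integrable (noise f) (\<lambda>u. (deriv (loss f) u * u)\<^sup>2)"
    \<comment> \<open>(2)\<close>
    and "\<forall>\<^sub>F n in sequentially. K n \<ge> 1"
    and "\<forall>\<^sub>F n in sequentially. \<forall>i<n. \<forall>j<p n. \<bar>x n i j\<bar> \<le> K n"
    \<comment> \<open>(3)\<close>
    and "\<And>u. G u > 0"
    and "integrable (noise f) (\<lambda>u. (G u)\<^sup>2)"
    and "integrable (noise f) (\<lambda>u. (G u)\<^sup>2 * u ^ 4)"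
    and "\<forall>\<^sub>F n in sequentially. \<exists>r0>0. \<forall>r. 0 < r \<and> r \<le> r0 \<longrightarrow>
           (AE u in noise f. \<forall>v v'. max \<bar>v\<bar> \<bar>v'\<bar> \<le> (K n + \<bar>u\<bar>) * r \<longrightarrow>
              \<bar>deriv (loss f) (u + v) - deriv (loss f) (u + v')\<bar> \<le> G u * \<bar>v - v'\<bar>)"
    \<comment> \<open>(4)\<close>
    and "\<exists>\<delta>>0. \<exists>A B L.
           (\<forall>z\<in>near_truth \<delta>. has_hessian (risk f) (A z) z) \<and>
           continuous_on (near_truth \<delta>) A \<and>
           (\<forall>v. v \<noteq> 0 \<longrightarrow> inner v (A (vector [0, 1]) *v v) > 0) \<and>
           (\<forall>z\<in>near_truth \<delta>. has_hessian (\<lambda>w. risk f w - ln (w $ 2)) (B z) z \<and>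
              infnorm (B z - B (vector [0, 1])) \<le> L * (\<bar>z $ 1\<bar> + \<bar>z $ 2 - 1\<bar>))"
    \<comment> \<open>(5)\<close>
    and "filterlim p at_top sequentially"
    and "(\<lambda>n. ln (real (p n)) / real n) \<longlonglongrightarrow> 0"
    \<comment> \<open>(6)\<close>
    and "\<Lambda>\<^sup>2 > 0"
    and "\<forall>\<^sub>F n in sequentially. \<Sigma> n \<in> carrier_mat (p n) (p n) \<and> smallest_eigenvalue (\<Sigma> n) (\<Lambda>\<^sup>2)"
    and "(\<lambda>n. max_abs_entry (gram n (p n) (x n) - \<Sigma> n))
           \<in> O(\<lambda>n. (K n)\<^sup>2 * sqrt (ln (real (p n)) / real n))"
    \<comment> \<open>(7)\<close>
    and "(\<exists>a. 0 < a \<and> a < 1 / 2 \<and> (\<forall>\<^sub>F n in sequentially. \<alpha> n = a)) \<or>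
         (\<forall>\<^sub>F n in sequentially. \<alpha> n = 1 / real (p n))"
    and "(\<lambda>n. quantile
                (distr M borel (\<lambda>\<omega>. lambda_star f n (p n) (x n) (\<lambda>i. \<xi> i \<omega>))) (1 - \<alpha> n))
           \<in> \<Theta>(\<lambda>n. sqrt (ln (real (p n)) / real n))"
    \<comment> \<open>(8)\<close>
    and "\<forall>\<^sub>F n in sequentially. real (card {j\<in>{1..<p n}. beta_star n j \<noteq> 0}) \<le> s_max n"
    and "\<forall>\<^sub>F n in sequentially. s_max n \<ge> 1"
    and "s_max \<in> o(\<lambda>n. \<Lambda>\<^sup>2 * sqrt (real n / ln (real (p n))) / (K n)\<^sup>2)"
    \<comment> \<open>(9)\<close>
    and "\<forall>\<^sub>F n in sequentially. \<forall>j\<in>{1..<p n}. (\<Sum>i<n. x n i j) = 0"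
    and "(\<lambda>_. 1) \<in> O(\<lambda>n. Min ((\<lambda>j. (\<Sum>i<n. (x n i j)\<^sup>2) / real n) ` {1..<p n}))"
    \<comment> \<open>the null hypothesis\<close>
    and "\<forall>\<^sub>F n in sequentially. \<forall>j\<in>{1..<p n}. beta_star n j = 0"
    \<comment> \<open>the slack \<open>\<eta>\<close>\<close>
    and "\<forall>\<^sub>F n in sequentially. 0 < \<eta> n \<and> \<eta> n < 1"
    and "(\<lambda>n. (K n)\<^sup>2 * sqrt (ln (real (p n)) / real n)) \<in> o(\<eta>)"
  shows "\<exists>rem :: nat \<Rightarrow> real. rem \<longlonglongrightarrow> 0 \<and>
           (\<forall>n. \<P>(\<omega> in M. \<exists>j\<in>{1..<p n}. beta_hat n \<omega> j \<noteq> 0)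
                  \<ge> \<P>(\<omega> in M. lambda_star f n (p n) (x n) (\<lambda>i. \<xi> i \<omega>) * (1 - \<eta> n) > lam n) + rem n)"
proof -
  interpret M: prob_space M by (rule assms(1))
  \<comment> \<open>The Lipschitz window depends on the sample size through \<open>K n\<close>. One
    index with \<open>K n0 \<ge> 1\<close> is fixed: its window contains the one with 1 in place of
    \<open>K n0\<close>, which gives a condition on \<open>f\<close> and \<open>G\<close>
    alone.\<close>
  obtain n0 r1 where n0: "K n0 \<ge> 1" and r1: "r1 > 0" and r1_AE: "\<And>r. 0 < r \<Longrightarrow> r \<le> r1 \<Longrightarrow>
      AE u in noise f. \<forall>v v'. max \<bar>v\<bar> \<bar>v'\<bar> \<le> (K n0 + \<bar>u\<bar>) * r \<longrightarrow>
        \<bar>deriv (loss f) (u + v) - deriv (loss f) (u + v')\<bar> \<le> G u * \<bar>v - v'\<bar>"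
    using eventually_happens'[OF _ eventually_conj[OF assms(18) assms(23)]] by auto
  define r0 where "r0 = min r1 (1 / 2)"
  have r0: "0 < r0" "r0 \<le> 1 / 2" "r0 \<le> r1" using r1 by (auto simp: r0_def)
  have iid: "iid_sample M (noise f) \<xi>" by (rule iid_sampleI[OF assms(1,10,11)])
  interpret iid_sample M "noise f" \<xi> by (rule iid)
  interpret regular_noise f G r0
  proof (rule regular_noise.intro)
    show "AE u in noise f. \<forall>v v'. max \<bar>v\<bar> \<bar>v'\<bar> \<le> (1 + \<bar>u\<bar>) * r0 \<longrightarrow>
        \<bar>deriv (loss f) (u + v) - deriv (loss f) (u + v')\<bar> \<le> G u * \<bar>v - v'\<bar>"
      using r1_AE[OF r0(1,3)]
    proof eventually_elim
      case (elim u)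
      have "(1 + \<bar>u\<bar>) * r0 \<le> (K n0 + \<bar>u\<bar>) * r0" using n0 r0 by (intro mult_right_mono) auto
      with elim show ?case by (meson order_trans)
    qed
    show "prob_space (noise f)" by (rule N)
  qed (use assms(12,14-17,20-22) r0 in auto)
  obtain A where "has_hessian (risk f) A (vector [0, 1])" "\<And>v. v \<noteq> 0 \<Longrightarrow> inner v (A *v v) > 0"
  proof -
    obtain \<delta> A' where \<delta>: "\<delta> > 0" "\<forall>z\<in>near_truth \<delta>. has_hessian (risk f) (A' z) z"
        "\<forall>v. v \<noteq> 0 \<longrightarrow> inner v (A' (vector [0, 1]) *v v) > 0"
      using assms(24) by blast
    moreover have "vector [0, 1] \<in> near_truth \<delta>" using \<delta>(1) by (simp add: near_truth_def)
    ultimately show thesis by (intro that[of "A' (vector [0, 1])"]) auto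
  qed
  from expected_loss_growth[OF this] obtain \<kappa> \<epsilon>0 where \<kappa>: "0 < \<kappa>" "\<kappa> \<le> 1" and \<epsilon>0: "0 < \<epsilon>0" "\<epsilon>0 \<le> r0"
    and growth: "\<And>c h. \<bar>c\<bar> \<le> \<epsilon>0 \<Longrightarrow> \<bar>h\<bar> \<le> \<epsilon>0 \<Longrightarrow> \<kappa> * (c\<^sup>2 + h\<^sup>2) \<le> (\<integral>u. loss_diff c h u \<partial>noise f) - ln (1 + h)"
    by blast
  define v where "v = (\<integral>u. (envelope u)\<^sup>2 \<partial>noise f) + 1"
  have v: "(\<integral>u. (envelope u)\<^sup>2 \<partial>noise f) \<le> v" "v > 0"
    by (simp_all add: v_def add_nonneg_pos)
  define El where "El = (\<integral>u. \<bar>loss f u\<bar> \<partial>noise f)"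
  have El: "El \<ge> 0" by (simp add: El_def)
  define L where "L n = sqrt (ln (real (p n)))" for n
  define \<rho> where "\<rho> n = sqrt (ln (real (p n)) / real n)" for n
  have \<rho>_eq: "\<rho> n = L n / sqrt (real n)" for n by (simp add: \<rho>_def L_def real_sqrt_divide)
  have L_top: "filterlim L at_top sequentially"
    unfolding L_def by (intro filterlim_compose[OF sqrt_at_top] filterlim_compose[OF ln_at_top]
      filterlim_compose[OF filterlim_real_sequentially] assms(25))
  have \<rho>_lim: "\<rho> \<longlonglongrightarrow> 0"
    using tendsto_real_sqrt[OF assms(26)] by (simp add: \<rho>_def[abs_def])
  have p2: "\<forall>\<^sub>F n in sequentially. p n \<ge> 2"
    using assms(25) by (simp add: filterlim_at_top)
  obtain c0 where c0: "c0 > 0" and lam_ge: "\<forall>\<^sub>F n in sequentially. norm (lam n) \<ge> c0 * norm (\<rho> n)"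
    using assms(9) unfolding \<rho>_def[symmetric, abs_def] bigtheta_def by (auto elim!: landau_omega.bigE)
  have q_small: "\<forall>\<^sub>F n in sequentially. (K n)\<^sup>2 * \<rho> n \<le> c * \<eta> n" if "c > 0" for c
  proof -
    have "\<forall>\<^sub>F n in sequentially. norm ((K n)\<^sup>2 * \<rho> n) \<le> c * norm (\<eta> n)"
      using landau_o.smallD[OF assms(39) that] by (simp add: \<rho>_def)
    with assms(38) show ?thesis by eventually_elim auto
  qed
  define P1 where "P1 n = \<P>(\<omega> in M. \<exists>j\<in>{1..<p n}. beta_hat n \<omega> j \<noteq> 0)" for n
  define P2 where "P2 n = \<P>(\<omega> in M. lambda_star f n (p n) (x n) (\<lambda>i. \<xi> i \<omega>) * (1 - \<eta> n) > lam n)" for n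
  define PL where "PL n = \<P>(\<omega> in M. is_exp_lasso f n (p n) (x n) (y n \<omega>) (lam n) (beta_hat n \<omega>) (sigma_hat n \<omega>))" for n
  have PL: "PL \<longlonglongrightarrow> 1" using assms(7) by (simp add: PL_def[abs_def])
  \<comment> \<open>\<open>\<epsilon>\<close> is split into fifths: four for the terms bounding the
    exceptional event, one for the event that the estimate is not a minimiser.\<close>
  have key: "\<forall>\<^sub>F n in sequentially. P2 n - P1 n < \<epsilon>" if \<epsilon>: "\<epsilon> > 0" for \<epsilon>
  proof -
    \<comment> \<open>\<open>t\<close> depends on \<open>\<epsilon>\<close> but not on
      \<open>n\<close>, so \<open>exp t\<close> is a constant in \<open>C2\<close> and
      \<open>C3\<close>.\<close>
    define t where "t = 5 * El / \<epsilon> + 1"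
    have t: "t > 0" using El \<epsilon> by (simp add: t_def add_nonneg_pos)
    have El_t: "El / t \<le> \<epsilon> / 5"
    proof -
      have "El \<le> \<epsilon> / 5 * t" using \<epsilon> by (simp add: t_def field_simps)
      then show ?thesis using t by (simp add: divide_le_eq)
    qed
    define C1 where "C1 = 288 * sqrt (v * ln 2) / \<kappa>"
    define C2 where "C2 = 288 * sqrt v * exp t / c0"
    define C3 where "C3 = 3 * sqrt (v * ln 2) * exp t / c0"
    have C: "C1 > 0" "C2 > 0" "C3 > 0" using v \<kappa> c0 by (auto simp: C1_def C2_def C3_def)
    have evL: "\<forall>\<^sub>F n in sequentially. L n \<ge> 5 * C1 / \<epsilon>" "\<forall>\<^sub>F n in sequentially. L n \<ge> 5 * C3 / \<epsilon>"
      using L_top by (simp_all add: filterlim_at_top)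
    have ev\<rho>: "\<forall>\<^sub>F n in sequentially. \<rho> n < min (1 / 4) \<epsilon>0"
      by (rule order_tendstoD(2)[OF \<rho>_lim]) (use \<epsilon>0 in simp)
    have evq: "\<forall>\<^sub>F n in sequentially. (K n)\<^sup>2 * \<rho> n \<le> \<epsilon> / (5 * C2) * \<eta> n" "\<forall>\<^sub>F n in sequentially. (K n)\<^sup>2 * \<rho> n \<le> 1 / 8 * \<eta> n"
      using \<epsilon> C by (auto intro!: q_small simp del: times_divide_eq_left)
    \<comment> \<open>The event of being a minimiser is not assumed measurable.
      \<open>measure\<close> is 0 on nonmeasurable sets, so a positive probability certifies
      measurability; this is why the threshold is at least 0.\<close>
    have evPL: "\<forall>\<^sub>F n in sequentially. PL n > max 0 (1 - \<epsilon> / 5)"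
      using order_tendstoD(1)[OF PL, of "max 0 (1 - \<epsilon> / 5)"] \<epsilon> by simp
    from p2 eventually_gt_at_top[of 0] assms(3,4,8,18,19,35,37,38) lam_ge evL ev\<rho> evq evPL
    show ?thesis
    proof eventually_elim
      case (elim n)
      have n: "n > 0" and p: "p n \<ge> 2" by fact+
      have L0: "L n > 0" using p by (simp add: L_def)
      have \<rho>0: "\<rho> n > 0" using n L0 by (simp add: \<rho>_eq)
      have K2: "\<rho> n \<le> (K n)\<^sup>2 * \<rho> n"
        using \<open>1 \<le> K n\<close> \<rho>0 by (simp add: one_le_power)
      have \<eta>0: "\<eta> n > 0" "\<eta> n < 1" using elim by auto
      have \<rho>_small: "\<rho> n < 1 / 4" "\<rho> n < \<epsilon>0" using \<open>\<rho> n < min (1 / 4) \<epsilon>0\<close> by simp_all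
      have \<rho>_\<eta>: "8 * \<rho> n \<le> \<eta> n" using K2 \<open>(K n)\<^sup>2 * \<rho> n \<le> 1 / 8 * \<eta> n\<close> by linarith
      have \<rho>_r0: "\<rho> n \<le> r0" using \<rho>_small \<epsilon>0 by linarith
      have lam_n: "lam n \<ge> c0 * \<rho> n" using lam_ge elim \<rho>0 by auto
      have "\<exists>A\<in>sets M. M.prob A \<le>
          144 * \<rho> n * sqrt (real n * v * ln 2) / (real n * (\<kappa> * (\<rho> n)\<^sup>2 / 2))
          + 144 * K n * \<rho> n * sqrt (real n * v * ln (real (p n))) / (real n * (\<eta> n * lam n * exp (- t) / 2))
          + (\<integral>u. \<bar>loss f u\<bar> \<partial>noise f) / t
          + 3 * sqrt (real n * v * ln 2) / (real n * (lam n * exp (- t))) \<and>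
        (\<forall>\<omega>\<in>space M - A. \<forall>b s b0 y. is_exp_lasso f n (p n) (x n) y (lam n) b s \<longrightarrow> (\<forall>j\<in>{1..<p n}. b j = 0) \<longrightarrow>
          (\<forall>i<n. y i = b0 + \<xi> i \<omega>) \<longrightarrow> lambda_star f n (p n) (x n) (\<lambda>i. \<xi> i \<omega>) * (1 - \<eta> n) \<le> lam n)"
      proof (rule null_selection_probability[OF iid noise_eq_distr[OF assms(11)] assms(13)])
        show "\<kappa> * (c\<^sup>2 + h\<^sup>2) \<le> (\<integral>u. loss_diff c h u \<partial>noise f) - ln (1 + h)"
          if "\<bar>c\<bar> \<le> \<rho> n" "\<bar>h\<bar> \<le> \<rho> n" for c h
          using growth[of c h] that elim by simp
      qed (use \<rho>0 less_imp_le[OF \<rho>_small(1)] \<rho>_\<eta> \<rho>_r0 in \<open>simp_all add: elim \<kappa> t v \<eta>0\<close>)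
      then obtain A where A: "A \<in> sets M" and PA: "M.prob A \<le>
          144 * \<rho> n * sqrt (real n * v * ln 2) / (real n * (\<kappa> * (\<rho> n)\<^sup>2 / 2))
          + 144 * K n * \<rho> n * sqrt (real n * v * ln (real (p n))) / (real n * (\<eta> n * lam n * exp (- t) / 2))
          + El / t
          + 3 * sqrt (real n * v * ln 2) / (real n * (lam n * exp (- t)))"
        and A': "\<forall>\<omega>\<in>space M - A. \<forall>b s b0 y. is_exp_lasso f n (p n) (x n) y (lam n) b s \<longrightarrow> (\<forall>j\<in>{1..<p n}. b j = 0) \<longrightarrow>
          (\<forall>i<n. y i = b0 + \<xi> i \<omega>) \<longrightarrow> lambda_star f n (p n) (x n) (\<lambda>i. \<xi> i \<omega>) * (1 - \<eta> n) \<le> lam n"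
        unfolding El_def[symmetric] by (elim bexE conjE)
      have lnp: "ln (real (p n)) = (L n)\<^sup>2" using p by (simp add: L_def)
      have n': "real n > 0" using n by simp
      note db = deviation_bounds_simplify[OF n' L0 \<rho>_eq v(2) \<kappa>(1) \<open>1 \<le> K n\<close> \<eta>0(1) c0 lam_n]
      have b1: "144 * \<rho> n * sqrt (real n * v * ln 2) / (real n * (\<kappa> * (\<rho> n)\<^sup>2 / 2)) \<le> \<epsilon> / 5"
      proof -
        have "C1 / L n \<le> \<epsilon> / 5" using \<open>5 * C1 / \<epsilon> \<le> L n\<close> \<epsilon> L0 by (simp add: field_simps)
        then show ?thesis using db(1) unfolding C1_def by linarith
      qed
      have b2: "144 * K n * \<rho> n * sqrt (real n * v * ln (real (p n))) / (real n * (\<eta> n * lam n * exp (- t) / 2)) \<le> \<epsilon> / 5"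
      proof -
        have "(K n)\<^sup>2 * \<rho> n / \<eta> n \<le> \<epsilon> / (5 * C2)"
          using \<open>(K n)\<^sup>2 * \<rho> n \<le> \<epsilon> / (5 * C2) * \<eta> n\<close> \<eta>0 by (simp add: divide_le_eq)
        then have "C2 * ((K n)\<^sup>2 * \<rho> n / \<eta> n) \<le> C2 * (\<epsilon> / (5 * C2))"
          using C by (intro mult_left_mono) auto
        also have "\<dots> = \<epsilon> / 5" using C by simp
        finally show ?thesis using db(2)[of t] unfolding lnp C2_def by linarith
      qed
      have b3: "3 * sqrt (real n * v * ln 2) / (real n * (lam n * exp (- t))) \<le> \<epsilon> / 5"
      proof -
        have "C3 / L n \<le> \<epsilon> / 5" using \<open>5 * C3 / \<epsilon> \<le> L n\<close> \<epsilon> L0 by (simp add: field_simps)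
        then show ?thesis using db(3)[of t] unfolding C3_def by linarith
      qed
      have PA': "M.prob A \<le> 4 * \<epsilon> / 5" using PA b1 b2 b3 El_t by linarith
      define SL where "SL = {\<omega>\<in>space M. is_exp_lasso f n (p n) (x n) (y n \<omega>) (lam n) (beta_hat n \<omega>) (sigma_hat n \<omega>)}"
      define S1 where "S1 = {\<omega>\<in>space M. \<exists>j\<in>{1..<p n}. beta_hat n \<omega> j \<noteq> 0}"
      have "M.prob SL > max 0 (1 - \<epsilon> / 5)" using elim by (simp add: PL_def SL_def)
      then have SL: "SL \<in> sets M" and PSL: "M.prob (space M - SL) < \<epsilon> / 5"
      proof -
        assume a: "M.prob SL > max 0 (1 - \<epsilon> / 5)"
        then show "SL \<in> sets M" using measure_notin_sets[of SL M] by force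
        then show "M.prob (space M - SL) < \<epsilon> / 5" using a by (simp add: M.prob_compl)
      qed
      have [measurable]: "(\<lambda>\<omega>. beta_hat n \<omega> j) \<in> borel_measurable M" if "j \<in> {1..<p n}" for j
        using assms(5) that by simp
      have S1: "S1 \<in> sets M" unfolding S1_def by measurable
      have "{\<omega>\<in>space M. lambda_star f n (p n) (x n) (\<lambda>i. \<xi> i \<omega>) * (1 - \<eta> n) > lam n} \<subseteq> A \<union> (space M - SL) \<union> S1"
      proof
        fix \<omega> assume \<omega>: "\<omega> \<in> {\<omega>\<in>space M. lambda_star f n (p n) (x n) (\<lambda>i. \<xi> i \<omega>) * (1 - \<eta> n) > lam n}"
        show "\<omega> \<in> A \<union> (space M - SL) \<union> S1"
        proof (rule ccontr)
          assume neg: "\<not> ?thesis"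
          have "y n \<omega> i = beta_star n 0 + \<xi> i \<omega>" if i: "i < n" for i
          proof -
            have "row_mult (p n) (x n i) (beta_star n) = x n i 0 * beta_star n 0"
              by (rule row_mult_intercept) (use p elim in auto)
            then show ?thesis using elim \<omega> i assms(2) by auto
          qed
          moreover have "\<forall>j\<in>{1..<p n}. beta_hat n \<omega> j = 0" using neg \<omega> by (auto simp: S1_def)
          moreover have "is_exp_lasso f n (p n) (x n) (y n \<omega>) (lam n) (beta_hat n \<omega>) (sigma_hat n \<omega>)"
            using neg \<omega> by (auto simp: SL_def)
          ultimately have "lambda_star f n (p n) (x n) (\<lambda>i. \<xi> i \<omega>) * (1 - \<eta> n) \<le> lam n"
            using bspec[OF A', of \<omega>] neg \<omega> by blast
          with \<omega> show False by simp
        qed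
      qed
      \<comment> \<open>Monotonicity asks for measurability of the larger set only.\<close>
      then have "P2 n \<le> M.prob (A \<union> (space M - SL) \<union> S1)"
        unfolding P2_def using A SL S1 by (intro M.finite_measure_mono) auto
      also have "\<dots> \<le> M.prob A + M.prob (space M - SL) + M.prob S1"
        using A SL S1 by (intro order_trans[OF measure_Un_le] add_mono measure_Un_le order_refl) auto
      finally show ?case using PA' PSL by (simp add: P1_def S1_def)
    qed
  qed
  \<comment> \<open>The negative part of the gap makes the inequality hold for every
    \<open>n\<close>, and \<open>key\<close> bounds it from below in the limit.\<close>
  define rem where "rem n = min 0 (P1 n - P2 n)" for n
  have "rem \<longlonglongrightarrow> 0"
  proof (rule order_tendstoI)
    fix a :: real assume "a < 0"
    with key[of "- a"] show "\<forall>\<^sub>F n in sequentially. a < rem n"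
      by (auto elim!: eventually_mono simp: rem_def)
  qed (auto simp: rem_def min_less_iff_disj)
  moreover have "P1 n \<ge> P2 n + rem n" for n by (simp add: rem_def)
  ultimately show ?thesis unfolding P1_def P2_def by blast
qed

end
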